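(* Let $s\in(0,\frac12]$ and let $\mu$ be a finite Borel measure on $[0,1]$ with $\dim_{\mathcal H}(\operatorname{supp}\mu)=s$ for which there are constants $0<c\leq K<\infty$ such that $$c\,r^{s/2}\leq\mu([0,r])\leq K r^{s/2}\quad\text{for all }0<r\leq 1,$$ and $$\mu([x,x+r])\leq K\min\{1,x^{-s/2}r^s\}\quad\text{for all }x\in\operatorname{supp}\mu\setminus\{0\},\ r>0.$$ Let $\omega(t)$, $t\geq0$, be the standard one-dimensional Brownian motion with $\omega(0)=0$ and let $\mu_\omega:=\omega_*\mu$ be the push-forward of $\mu$ under $t\mapsto\omega(t)$. Then, almost surely, $\mu_\omega$ is a $2s$-dimensional Salem measure on $\mathbb{R}$ that does not admit any Fourier frame.
   Context: For a finite Borel measure $\mu$ on $\mathbb{R}$, $\widehat{\mu}(\xi)=\int e^{-2\pi i x\xi}\,d\mu(x)$, and for $f\in L^2(\mu)$, $\widehat{f\,d\mu}(\xi)=\int e^{-2\pi i x\xi}f(x)\,d\mu(x)$. A discrete set $\Lambda\subset\mathbb{R}$ is a frame spectrum of $\mu$ if there exist constants $0<A\leq B<\infty$ with $$A\|f\|_{L^2(\mu)}^2\leq\sum_{\lambda\in\Lambda}|\widehat{f\,d\mu}(\lambda)|^2\leq B\|f\|_{L^2(\mu)}^2\quad\forall f\in L^2(\mu).$$ If such a $\Lambda$ exists, $\mu$ is said to admit a Fourier frame. A nonzero finite compactly supported Borel measure $\mu$ is called a Salem measure if for every $\epsilon>0$ there is $C_\epsilon$ with $|\widehat{\mu}(\xi)|\leq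 C_\epsilon|\xi|^{-\dim_{\mathcal H}(\operatorname{supp}\mu)/2+\epsilon}$ for all $|\xi|\ge 1$, where $\dim_{\mathcal H}$ is Hausdorff dimension. It is $t$-dimensional if $\dim_{\mathcal H}(\operatorname{supp}\mu)=t$. *)

theory Defs
  imports "HOL-Probability.Probability"
begin

section \<open>Hausdorff dimension\<close>

text \<open>The case distinction makes the 0-th power of the diameter 1 for every nonempty \<open>U\<close>, singletons included
  (in HOL, \<open>0 powr 0 = 0\<close>), so that the 0-dimensional measure is counting measure.\<close>

definition diam_powr :: "real \<Rightarrow> 'a::metric_space set \<Rightarrow> ennreal" where
  "diam_powr s U = (if U = {} then 0 else if s = 0 then 1 else ennreal (diameter U powr s))"

text \<open>Boundedness is required explicitly because \<^term>\<open>diameter U\<close> is unspecified for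
  unbounded \<open>U\<close>. Finite covers are included: pad with empty sets.\<close>

definition hausdorff_premeasure :: "real \<Rightarrow> real \<Rightarrow> 'a::metric_space set \<Rightarrow> ennreal" where
  "hausdorff_premeasure \<delta> s S =
     (INF U \<in> {U :: nat \<Rightarrow> 'a set. S \<subseteq> (\<Union>i. U i) \<and> (\<forall>i. bounded (U i) \<and> diameter (U i) \<le> \<delta>)}.
        \<Sum>i. diam_powr s (U i))"

definition hausdorff_measure :: "real \<Rightarrow> 'a::metric_space set \<Rightarrow> ennreal" where
  "hausdorff_measure s S = (SUP \<delta> \<in> {0<..}. hausdorff_premeasure \<delta> s S)"

definition hausdorff_dim :: "'a::metric_space set \<Rightarrow> ennreal" where
  "hausdorff_dim S = (INF s \<in> {s. 0 \<le> s \<and> hausdorff_measure s S = 0}. ennreal s)"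


section \<open>Supports and Fourier transforms of measures\<close>

definition measure_support :: "'a::topological_space measure \<Rightarrow> 'a set" where
  "measure_support M = {x. \<forall>U. open U \<and> x \<in> U \<longrightarrow> emeasure M U > 0}"

definition fourier_density :: "real measure \<Rightarrow> (real \<Rightarrow> complex) \<Rightarrow> real \<Rightarrow> complex" where
  "fourier_density M f \<xi> = (CLINT x|M. exp (- 2 * pi * \<i> * x * \<xi>) * f x)"

definition fourier_measure :: "real measure \<Rightarrow> real \<Rightarrow> complex" where
  "fourier_measure M \<xi> = (CLINT x|M. exp (- 2 * pi * \<i> * x * \<xi>))"


section \<open>Fourier frames\<close>

definition square_integrable :: "'a measure \<Rightarrow> ('a \<Rightarrow> complex) \<Rightarrow> bool" where
  "square_integrable M f \<longleftrightarrow> f \<in> borel_measurable M \<and> integrable M (\<lambda>x. (norm (f x))\<^sup>2)"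

definition L2_norm_sq :: "'a measure \<Rightarrow> ('a \<Rightarrow> complex) \<Rightarrow> real" where
  "L2_norm_sq M f = (LINT x|M. (norm (f x))\<^sup>2)"

text \<open>The sum over \<open>\<Lambda>\<close> is taken in \<^typ>\<open>ennreal\<close>, where it is the supremum of the finite partial
  sums; the upper bound thus includes its convergence. The name \<open>discrete\<close> is qualified
  to distinguish it from the constructor of the type of the same name.\<close>

definition frame_spectrum :: "real measure \<Rightarrow> real set \<Rightarrow> bool" where
  "frame_spectrum M \<Lambda> \<longleftrightarrow>
     topological_space_class.discrete \<Lambda> \<and>
     (\<exists>A B :: real. 0 < A \<and> A \<le> B \<and>
       (\<forall>f. square_integrable M f \<longrightarrow>
          ennreal (A * L2_norm_sq M f) \<le> infsum (\<lambda>l. ennreal ((norm (fourier_density M f l))\<^sup>2)) \<Lambda> \<and>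
          infsum (\<lambda>l. ennreal ((norm (fourier_density M f l))\<^sup>2)) \<Lambda> \<le> ennreal (B * L2_norm_sq M f)))"

definition admits_fourier_frame :: "real measure \<Rightarrow> bool" where
  "admits_fourier_frame M \<longleftrightarrow> (\<exists>\<Lambda>. frame_spectrum M \<Lambda>)"


section \<open>Salem measures\<close>

text \<open>The Hausdorff dimension of a subset of the line is at most 1, so
  \<^const>\<open>enn2real\<close> loses nothing here.\<close>

definition salem_measure :: "real measure \<Rightarrow> bool" where
  "salem_measure M \<longleftrightarrow>
     sets M = sets borel \<and> finite_measure M \<and> emeasure M (space M) \<noteq> 0 \<and>
     compact (measure_support M) \<and>
     (\<forall>\<epsilon>>0. \<exists>C::real. \<forall>\<xi>::real. \<bar>\<xi>\<bar> \<ge> 1 \<longrightarrow>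
        norm (fourier_measure M \<xi>) \<le>
          C * \<bar>\<xi>\<bar> powr (- enn2real (hausdorff_dim (measure_support M)) / 2 + \<epsilon>))"

definition dim_salem_measure :: "real \<Rightarrow> real measure \<Rightarrow> bool" where
  "dim_salem_measure t M \<longleftrightarrow>
     salem_measure M \<and> hausdorff_dim (measure_support M) = ennreal t"


section \<open>Brownian motion\<close>

text \<open>Only the times \<open>t \<ge> 0\<close> matter; \<open>W t\<close> is arbitrary for negative \<open>t\<close>. The initial value and the
  continuity of paths are required almost surely, which covers the convention that they
  hold surely.\<close>

locale brownian_motion = prob_space M for M :: "'w measure" +
  fixes W :: "real \<Rightarrow> 'w \<Rightarrow> real"
  assumes random_variable_W: "\<And>t. 0 \<le> t \<Longrightarrow> random_variable borel (W t)"
    and start_at_0: "AE \<omega> in M. W 0 \<omega> = 0"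
    and indep_increments: "\<And>(t :: nat \<Rightarrow> real) n. 0 \<le> t 0 \<Longrightarrow> incseq t \<Longrightarrow>
          indep_vars (\<lambda>_. borel) (\<lambda>i \<omega>. W (t (Suc i)) \<omega> - W (t i) \<omega>) {..<n}"
    and normal_increments: "\<And>u t. 0 \<le> u \<Longrightarrow> u < t \<Longrightarrow>
          distributed M lborel (\<lambda>\<omega>. W t \<omega> - W u \<omega>) (normal_density 0 (sqrt (t - u)))"
    and continuous_paths: "AE \<omega> in M. continuous_on {0..} (\<lambda>t. W t \<omega>)"

text \<open>Push-forward under a path, which is meaningful on \<open>{0..}\<close> only: the restriction
  keeps values (and measurability) at negative times from playing a role.\<close>

definition path_pushforward :: "real measure \<Rightarrow> (real \<Rightarrow> real) \<Rightarrow> real measure" where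
  "path_pushforward \<mu> w = distr (restrict_space \<mu> {0..}) borel w"

end

theory Submission
  imports Defs "HOL-Combinatorics.Multiset_Permutations"
begin

text \<open>
  Write \<open>\<nu>\<close> for the push-forward of \<open>\<mu>\<close>. Independence of increments gives
  \<open>E \<bar>\<nu>-hat \<xi>\<bar>^(2q) \<le> (2q)! J^q\<close> with \<open>J = \<integral>\<integral> exp (-2 \<pi>\<^sup>2 \<xi>\<^sup>2 \<bar>x - y\<bar>) d\<mu> d\<mu>\<close>: after sorting the \<open>2q\<close> times, an odd
  number of signs lies above every point between the \<open>(2i-1)\<close>-st and the \<open>2i\<close>-th time, so each of these \<open>q\<close> gaps contributes a
  Gaussian factor. Interpolating the mass bounds yields \<open>J \<le> C \<bar>\<xi>\<bar>^(-2 \<theta> s)\<close> for every \<open>\<theta> < 1\<close>, hence almost surely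
  \<open>\<bar>\<nu>-hat \<xi>\<bar> \<le> C \<bar>\<xi>\<bar>^(-s + \<epsilon>)\<close>. The decay bounds the dimension of the support from below, Hoelder continuity of Brownian
  paths from above.

  There is no Fourier frame because \<open>\<nu>\<close> is too concentrated at 0: since the path is Hoelder continuous with exponent 1/3,
  \<open>\<nu> [-r, r] \<ge> c r^(3s/2)\<close>, so the Bessel bound leaves at most \<open>C R^(3s/2)\<close> frequencies in any interval of length \<open>2R\<close>.
  The decay exponent of \<open>\<bar>\<nu>-hat\<bar>\<^sup>2\<close> is larger than \<open>3s/2\<close>, so the lower frame bound for characters forces the spectrum to be relatively
  dense. As \<open>3s/2 < 1\<close>, this contradicts the sparsity.
\<close>

section \<open>Sums over lists of times\<close>

text \<open>Independence is available for finitely many increments at a time, so the moments are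
  computed for Riemann sums over a grid. There an even power is a finite sum over lists of grid
  indices, and Fatou's lemma carries the bound to the limit; no joint measurability in time and
  \<omega> is involved. The loss \<theta> < 1 is forced: \<theta> = 1 would require the integral of
  \<open>x powr (- s / 2)\<close> over \<mu>, and the lower bound \<open>c * r powr (s / 2)\<close>
  on the mass of \<open>{0..r}\<close> makes it diverge. High moments then turn an arbitrarily small
  surplus in the exponent into summability over countably many frequencies. A Hoelder exponent
  \<alpha> < 1/2 gives mass of order at least \<open>r powr (s / (2 * \<alpha>))\<close> near 0. The
  frame argument needs this exponent to be below 1 and below some decay exponent of the squared
  transform, which can be any number below 2 s. As s \<le> 1/2, both hold once \<alpha> > 1/4; 1/3
  is a convenient value between 1/4 and 1/2.\<close>

lemma sum_power_lists:
  fixes f :: "'a \<Rightarrow> 'b::comm_semiring_1"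
  assumes "finite A"
  shows "(\<Sum>x\<in>A. f x) ^ m = (\<Sum>xs | set xs \<subseteq> A \<and> length xs = m. prod_list (map f xs))"
proof (induction m)
  case 0
  have "{xs. set xs \<subseteq> A \<and> length xs = 0} = {[]}" by auto
  then show ?case by simp
next
  case (Suc m)
  have eq: "{xs. set xs \<subseteq> A \<and> length xs = Suc m} =
      (\<lambda>(x, xs). x # xs) ` (A \<times> {xs. set xs \<subseteq> A \<and> length xs = m})"
    by (auto simp: length_Suc_conv image_iff)
  have inj: "inj_on (\<lambda>(x, xs). x # xs) (A \<times> {xs. set xs \<subseteq> A \<and> length xs = m})"
    by (auto simp: inj_on_def)
  show ?case
    unfolding eq sum.reindex[OF inj] power_Suc Suc sum_product
    by (simp add: sum.cartesian_product case_prod_beta' comp_def)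
qed

lemma sum_lists_append:
  fixes f :: "'a list \<Rightarrow> 'b::comm_monoid_add"
  assumes "finite A"
  shows "(\<Sum>xs | set xs \<subseteq> A \<and> length xs = m. \<Sum>ys | set ys \<subseteq> A \<and> length ys = n. f (xs @ ys)) =
         (\<Sum>zs | set zs \<subseteq> A \<and> length zs = m + n. f zs)"
proof -
  let ?L = "\<lambda>m. {xs. set xs \<subseteq> A \<and> length xs = m}"
  have "(\<Sum>xs\<in>?L m. \<Sum>ys\<in>?L n. f (xs @ ys)) = (\<Sum>(xs, ys)\<in>?L m \<times> ?L n. f (xs @ ys))"
    by (rule sum.cartesian_product)
  also have "\<dots> = (\<Sum>zs\<in>?L (m + n). f zs)"
    by (rule sum.reindex_bij_witness[where i = "\<lambda>zs. (take m zs, drop m zs)" and j = "\<lambda>(xs, ys). xs @ ys"])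
       (auto dest: in_set_takeD in_set_dropD)
  finally show ?thesis .
qed

text \<open>The lists are grouped by their sorted rearrangement. Each fibre consists of arrangements
  of one multiset, so it has at most \<open>fact m\<close> members, and symmetry makes the summand
  constant on it.\<close>

lemma sum_lists_le_sorted:
  fixes f :: "'a::linorder list \<Rightarrow> real"
  assumes "finite A" and nonneg: "\<And>xs. set xs \<subseteq> A \<Longrightarrow> 0 \<le> f xs"
    and sym: "\<And>xs ys. mset xs = mset ys \<Longrightarrow> f xs = f ys"
  shows "(\<Sum>xs | set xs \<subseteq> A \<and> length xs = m. f xs) \<le>
         fact m * (\<Sum>xs | sorted xs \<and> set xs \<subseteq> A \<and> length xs = m. f xs)"
proof -
  let ?L = "{xs. set xs \<subseteq> A \<and> length xs = m}" and ?S = "{xs. sorted xs \<and> set xs \<subseteq> A \<and> length xs = m}"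
  have fin: "finite ?L" using assms(1) by (rule finite_lists_length_eq)
  have finS: "finite ?S" by (rule finite_subset[OF _ fin]) auto
  have "(\<Sum>xs\<in>?L. f xs) = (\<Sum>ys\<in>?S. \<Sum>xs\<in>{xs \<in> ?L. sort xs = ys}. f xs)"
    by (rule sum.group[symmetric]) (use fin finS in auto)
  also have "\<dots> \<le> (\<Sum>ys\<in>?S. fact m * f ys)"
  proof (rule sum_mono)
    fix ys assume ys: "ys \<in> ?S"
    have sub: "{xs \<in> ?L. sort xs = ys} \<subseteq> permutations_of_multiset (mset ys)"
      by (auto simp: permutations_of_multiset_def)
    have "card {xs \<in> ?L. sort xs = ys} \<le> card (permutations_of_multiset (mset ys))"
      by (rule card_mono[OF _ sub]) simp
    also have "\<dots> \<le> fact (size (mset ys))"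
      unfolding card_permutations_of_multiset(1) by (rule div_le_dividend)
    finally have card: "real (card {xs \<in> ?L. sort xs = ys}) \<le> fact m"
      using ys by (metis (mono_tags, lifting) mem_Collect_eq of_nat_fact of_nat_le_iff size_mset)
    have "(\<Sum>xs\<in>{xs \<in> ?L. sort xs = ys}. f xs) = (\<Sum>xs\<in>{xs \<in> ?L. sort xs = ys}. f ys)"
      by (rule sum.cong[OF refl], rule sym) auto
    also have "\<dots> = card {xs \<in> ?L. sort xs = ys} * f ys" by simp
    also have "\<dots> \<le> fact m * f ys"
      using card nonneg ys by (intro mult_right_mono) auto
    finally show "(\<Sum>xs\<in>{xs \<in> ?L. sort xs = ys}. f xs) \<le> fact m * f ys" .
  qed
  finally show ?thesis by (simp add: sum_distrib_left)
qed

text \<open>When \<open>W\<close> is evaluated at the grid times indexed by \<open>xs\<close> and a signed sum is formed, the \<open>k\<close>-th grid increment gets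
  a coefficient of the parity of \<open>num_above k xs\<close>. Odd coefficients are nonzero, so each such \<open>k\<close> costs a Gaussian
  factor in the characteristic function.\<close>

definition num_above :: "nat \<Rightarrow> nat list \<Rightarrow> nat" where
  "num_above k xs = length (filter (\<lambda>x. k < x) xs)"

definition odd_levels :: "nat \<Rightarrow> nat list \<Rightarrow> nat" where
  "odd_levels n xs = card {k. k < n \<and> odd (num_above k xs)}"

text \<open>Levels from a up to b have b and all of xs above them, an odd number. An odd level of xs
  cannot lie below b, where all of the evenly many entries count; at b or higher neither a nor b is
  counted, so its parity is unchanged. The two sets of levels are therefore disjoint.\<close>

lemma odd_levels_Cons_Cons:
  assumes "sorted (a # b # xs)" "even (length xs)" "b \<le> n"
  shows "(b - a) + odd_levels n xs \<le> odd_levels n (a # b # xs)"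
proof -
  have above: "num_above k xs = length xs" if "k < b" for k
  proof -
    have "\<forall>x\<in>set xs. k < x" using assms(1) that by auto
    then show ?thesis by (simp add: num_above_def)
  qed
  have "(b - a) + odd_levels n xs = card {a..<b} + card {k. k < n \<and> odd (num_above k xs)}"
    by (simp add: odd_levels_def)
  also have "\<dots> = card ({a..<b} \<union> {k. k < n \<and> odd (num_above k xs)})"
    by (rule card_Un_disjoint[symmetric]) (use above assms(2) in auto)
  also have "\<dots> \<le> card {k. k < n \<and> odd (num_above k (a # b # xs))}"
  proof (rule card_mono)
    show "{a..<b} \<union> {k. k < n \<and> odd (num_above k xs)} \<subseteq> {k. k < n \<and> odd (num_above k (a # b # xs))}"
    proof
      fix k assume "k \<in> {a..<b} \<union> {k. k < n \<and> odd (num_above k xs)}"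
      then consider "a \<le> k" "k < b" | "k < n" "odd (num_above k xs)" by auto
      then show "k \<in> {k. k < n \<and> odd (num_above k (a # b # xs))}"
      proof cases
        case 1
        then show ?thesis using above[of k] assms by (auto simp: num_above_def)
      next
        case 2
        then have "\<not> k < b" using above assms(2) by auto
        then show ?thesis using 2 assms(1) by (auto simp: num_above_def)
      qed
    qed
  qed simp
  finally show ?thesis by (simp add: odd_levels_def)
qed

text \<open>Splitting off the two smallest entries costs the factor \<open>\<rho> ^ (b - a)\<close>
  and leaves a shorter list of the same kind. Forgetting that this list must stay above b only adds
  nonnegative terms, and then the sum factors: a sum over 2 q times becomes the q-th power of a sum
  over pairs.\<close>

lemma sum_sorted_lists_le:
  fixes p :: "nat \<Rightarrow> real"
  assumes p: "\<And>k. 0 \<le> p k" and \<rho>: "0 \<le> \<rho>" "\<rho> \<le> 1"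
  shows "(\<Sum>xs | sorted xs \<and> set xs \<subseteq> {..n} \<and> length xs = 2 * q. prod_list (map p xs) * \<rho> ^ odd_levels n xs)
         \<le> (\<Sum>j\<le>n. \<Sum>k\<in>{j..n}. p j * p k * \<rho> ^ (k - j)) ^ q"
proof (induction q)
  case 0
  have "{xs. sorted xs \<and> set xs \<subseteq> {..n} \<and> length xs = 2 * 0} = {[]}" by auto
  then show ?case by (simp add: odd_levels_def num_above_def)
next
  case (Suc q)
  let ?S = "\<lambda>q. {xs. sorted xs \<and> set xs \<subseteq> {..n} \<and> length xs = 2 * q}"
  let ?P = "Sigma {..n} (\<lambda>j. {j..n})"
  let ?g = "\<lambda>xs. prod_list (map p xs) * \<rho> ^ odd_levels n xs"
  have fin: "finite (?S q)"
    by (rule finite_subset[OF _ finite_lists_length_eq[of "{..n}" "2 * q"]]) auto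
  have pl: "0 \<le> prod_list (map p xs)" for xs
    by (induction xs) (auto simp: p)
  have sub: "?S (Suc q) \<subseteq> (\<lambda>((a, b), xs). a # b # xs) ` (?P \<times> ?S q)"
  proof
    fix zs assume "zs \<in> ?S (Suc q)"
    then have zs: "sorted zs" "set zs \<subseteq> {..n}" "length zs = 2 * Suc q" by auto
    then obtain a b xs where eq: "zs = a # b # xs" 
      by (cases zs; cases "tl zs") auto
    then show "zs \<in> (\<lambda>((a, b), xs). a # b # xs) ` (?P \<times> ?S q)"
      using zs by (intro image_eqI[of _ _ "((a, b), xs)"]) auto
  qed
  have inj: "inj_on (\<lambda>((a, b), xs). a # b # xs) (?P \<times> ?S q)" by (auto simp: inj_on_def)
  have finP: "finite ((\<lambda>((a, b), xs). a # b # xs) ` (?P \<times> ?S q))"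
    using fin by (intro finite_imageI finite_cartesian_product finite_SigmaI) auto
  have step: "?g (a # b # xs) \<le> (p a * p b * \<rho> ^ (b - a)) * ?g xs"
    if "a # b # xs \<in> ?S (Suc q)" for a b xs
  proof -
    have "\<rho> ^ odd_levels n (a # b # xs) \<le> \<rho> ^ ((b - a) + odd_levels n xs)"
      using \<rho> that by (intro power_decreasing odd_levels_Cons_Cons) auto
    then have "p a * p b * prod_list (map p xs) * \<rho> ^ odd_levels n (a # b # xs) \<le>
       p a * p b * prod_list (map p xs) * \<rho> ^ ((b - a) + odd_levels n xs)"
      using p pl by (intro mult_left_mono) auto
    then show ?thesis by (simp add: power_add mult_ac)
  qed
  let ?h = "\<lambda>zs. (p (zs!0) * p (zs!1) * \<rho> ^ (zs!1 - zs!0)) * ?g (drop 2 zs)"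
  have "(\<Sum>zs\<in>?S (Suc q). ?g zs) \<le> (\<Sum>zs\<in>?S (Suc q). ?h zs)"
  proof (rule sum_mono)
    fix zs assume z: "zs \<in> ?S (Suc q)"
    then obtain a b xs where "zs = a # b # xs" using sub by auto
    then show "?g zs \<le> ?h zs" using step[of a b xs] z by (simp add: mult_ac)
  qed
  also have "\<dots> \<le> (\<Sum>zs\<in>(\<lambda>((a, b), xs). a # b # xs) ` (?P \<times> ?S q). ?h zs)"
    using p pl \<rho> by (intro sum_mono2[OF finP sub]) auto
  also have "\<dots> = (\<Sum>((a, b), xs)\<in>?P \<times> ?S q. (p a * p b * \<rho> ^ (b - a)) * ?g xs)"
    by (subst sum.reindex[OF inj]) (simp add: case_prod_beta' comp_def)
  also have "\<dots> = (\<Sum>(a, b)\<in>?P. p a * p b * \<rho> ^ (b - a)) * (\<Sum>xs\<in>?S q. ?g xs)"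
    by (simp add: sum_product sum.cartesian_product case_prod_beta')
  also have "\<dots> \<le> (\<Sum>(a, b)\<in>?P. p a * p b * \<rho> ^ (b - a)) * (\<Sum>j\<le>n. \<Sum>k\<in>{j..n}. p j * p k * \<rho> ^ (k - j)) ^ q"
    using p \<rho> by (intro mult_left_mono Suc sum_nonneg) auto
  also have "(\<Sum>(a, b)\<in>?P. p a * p b * \<rho> ^ (b - a)) = (\<Sum>j\<le>n. \<Sum>k\<in>{j..n}. p j * p k * \<rho> ^ (k - j))"
    by (subst sum.Sigma) auto
  finally show ?case by simp
qed

lemma sum_lists_odd_levels_le:
  fixes p :: "nat \<Rightarrow> real"
  assumes p: "\<And>k. 0 \<le> p k" and \<rho>: "0 \<le> \<rho>" "\<rho> \<le> 1"
  shows "(\<Sum>xs | set xs \<subseteq> {..n} \<and> length xs = 2 * q. prod_list (map p xs) * \<rho> ^ odd_levels n xs)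
         \<le> fact (2 * q) * (\<Sum>j\<le>n. \<Sum>k\<in>{j..n}. p j * p k * \<rho> ^ (k - j)) ^ q"
proof -
  have pl: "0 \<le> prod_list (map p xs)" for xs
    by (induction xs) (auto simp: p)
  have num: "num_above k xs = num_above k ys" if "mset xs = mset ys" for k xs ys
    using that by (metis mset_filter num_above_def size_mset)
  have sym: "prod_list (map p xs) * \<rho> ^ odd_levels n xs = prod_list (map p ys) * \<rho> ^ odd_levels n ys"
    if "mset xs = mset ys" for xs ys
    using that by (simp add: odd_levels_def num[OF that] flip: prod_mset_prod_list)
  have "(\<Sum>xs | set xs \<subseteq> {..n} \<and> length xs = 2 * q. prod_list (map p xs) * \<rho> ^ odd_levels n xs)
    \<le> fact (2 * q) * (\<Sum>xs | sorted xs \<and> set xs \<subseteq> {..n} \<and> length xs = 2 * q. prod_list (map p xs) * \<rho> ^ odd_levels n xs)"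
    by (rule sum_lists_le_sorted[OF _ _ sym]) (use pl \<rho> in auto)
  also have "\<dots> \<le> fact (2 * q) * (\<Sum>j\<le>n. \<Sum>k\<in>{j..n}. p j * p k * \<rho> ^ (k - j)) ^ q"
    using p \<rho> by (intro mult_left_mono sum_sorted_lists_le) auto
  finally show ?thesis .
qed

section \<open>Moments along a grid\<close>

lemma (in prob_space) expectation_iexp_normal:
  assumes D: "distributed M lborel X (normal_density 0 \<sigma>)" and "0 < \<sigma>"
  shows "expectation (\<lambda>\<omega>. iexp (u * X \<omega>)) = of_real (exp (- (u\<^sup>2 * \<sigma>\<^sup>2) / 2))"
proof -
  have D': "distributed M lborel (\<lambda>\<omega>. X \<omega> / \<sigma>) std_normal_density"
    using D normal_standard_normal_convert[OF \<open>0 < \<sigma>\<close>, of X 0] by simp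
  then have [measurable]: "(\<lambda>\<omega>. X \<omega> / \<sigma>) \<in> borel_measurable M"
    by (auto dest: distributed_measurable)
  have "char std_normal_distribution (u * \<sigma>) = char (distr M lborel (\<lambda>\<omega>. X \<omega> / \<sigma>)) (u * \<sigma>)"
    using distributed_distr_eq_density[OF D'] by simp
  also have "\<dots> = expectation (\<lambda>\<omega>. iexp ((u * \<sigma>) * (X \<omega> / \<sigma>)))"
    unfolding char_def by (subst integral_distr) auto
  also have "\<dots> = expectation (\<lambda>\<omega>. iexp (u * X \<omega>))"
    using \<open>0 < \<sigma>\<close> by simp
  finally show ?thesis
    unfolding char_std_normal_distribution by (simp add: power_mult_distrib)
qed

lemma prod_list_iexp: "prod_list (map (\<lambda>j. iexp (f j)) xs) = iexp (sum_list (map f xs))"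
  by (induction xs) (auto simp: exp_add distrib_left)

text \<open>The k-th increment occurs in the value at grid index j exactly when k < j, so over the
  whole list it is counted \<open>num_above k xs\<close> times.\<close>

lemma sum_list_num_above:
  fixes d :: "nat \<Rightarrow> real" and a :: real
  assumes "set xs \<subseteq> {..n}"
  shows "sum_list (map (\<lambda>j. a + (\<Sum>k<j. d k)) xs) = length xs * a + (\<Sum>k<n. num_above k xs * d k)"
  using assms
proof (induction xs)
  case (Cons x xs)
  have "(\<Sum>k<n. num_above k (x # xs) * d k) = (\<Sum>k<n. (if k < x then d k else 0) + num_above k xs * d k)"
    by (rule sum.cong) (auto simp: num_above_def algebra_simps)
  also have "\<dots> = (\<Sum>k<x. d k) + (\<Sum>k<n. num_above k xs * d k)"
  proof -
    have "(\<Sum>k<n. if k < x then d k else 0) = (\<Sum>k<x. d k)"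
      using Cons.prems by (intro sum.mono_neutral_cong_right) auto
    then show ?thesis by (simp add: sum.distrib)
  qed
  finally show ?case using Cons by (simp add: algebra_simps)
qed (simp add: num_above_def)

context brownian_motion
begin

lemma measurable_W_grid [measurable]: "0 \<le> h \<Longrightarrow> (\<lambda>\<omega>. W (h * real k) \<omega>) \<in> borel_measurable M"
  by (rule random_variable_W) simp

lemma expectation_prod_iexp_increments:
  fixes A :: "nat \<Rightarrow> real"
  assumes h: "0 < h"
  shows "expectation (\<lambda>\<omega>. \<Prod>k<n. iexp (A k * (W (h * real (Suc k)) \<omega> - W (h * real k) \<omega>))) =
         of_real (\<Prod>k<n. exp (- ((A k)\<^sup>2 * h) / 2))"
proof -
  define t where "t k = h * real k" for k
  have "indep_vars (\<lambda>_. borel) (\<lambda>i \<omega>. W (t (Suc i)) \<omega> - W (t i) \<omega>) {..<n}"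
    using h by (intro indep_increments) (auto simp: t_def incseq_def mult_left_mono)
  then have "indep_vars (\<lambda>_. borel) (\<lambda>i \<omega>. iexp (A i * (W (t (Suc i)) \<omega> - W (t i) \<omega>))) {..<n}"
    by (rule indep_vars_compose2) simp
  then have "expectation (\<lambda>\<omega>. \<Prod>k<n. iexp (A k * (W (t (Suc k)) \<omega> - W (t k) \<omega>))) =
     (\<Prod>k<n. expectation (\<lambda>\<omega>. iexp (A k * (W (t (Suc k)) \<omega> - W (t k) \<omega>))))"
  proof (rule indep_vars_lebesgue_integral[rotated 1])
    fix i
    have [measurable]: "(\<lambda>\<omega>. W (t (Suc i)) \<omega>) \<in> borel_measurable M" "(\<lambda>\<omega>. W (t i) \<omega>) \<in> borel_measurable M"
      using h by (auto simp: t_def intro!: random_variable_W)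
    show "integrable M (\<lambda>\<omega>. iexp (A i * (W (t (Suc i)) \<omega> - W (t i) \<omega>)))"
      by (rule integrable_const_bound[where B = 1]) auto
  qed simp
  also have "\<dots> = (\<Prod>k<n. of_real (exp (- ((A k)\<^sup>2 * h) / 2)))"
  proof (rule prod.cong[OF refl])
    fix k
    have "distributed M lborel (\<lambda>\<omega>. W (t (Suc k)) \<omega> - W (t k) \<omega>) (normal_density 0 (sqrt (t (Suc k) - t k)))"
      using h by (intro normal_increments) (auto simp: t_def)
    moreover have "t (Suc k) - t k = h" by (simp add: t_def algebra_simps)
    ultimately show "expectation (\<lambda>\<omega>. iexp (A k * (W (t (Suc k)) \<omega> - W (t k) \<omega>))) = of_real (exp (- ((A k)\<^sup>2 * h) / 2))"
      using expectation_iexp_normal[of "\<lambda>\<omega>. W (t (Suc k)) \<omega> - W (t k) \<omega>" "sqrt h" "A k"] h by simp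
  qed
  finally show ?thesis by (simp add: t_def)
qed

lemma norm_expectation_word_le:
  assumes h: "0 < h" and xs: "set xs \<subseteq> {..n}" and ys: "set ys \<subseteq> {..n}" and len: "length xs = length ys"
  shows "norm (expectation (\<lambda>\<omega>. prod_list (map (\<lambda>j. iexp (u * W (h * real j) \<omega>)) xs) *
            prod_list (map (\<lambda>j. iexp (- (u * W (h * real j) \<omega>))) ys)))
         \<le> exp (- (u\<^sup>2 * h) / 2) ^ odd_levels n (xs @ ys)"
proof -
  define A where "A k = u * (real (num_above k xs) - real (num_above k ys))" for k
  define D where "D \<omega> k = W (h * real (Suc k)) \<omega> - W (h * real k) \<omega>" for \<omega> k
  have tele: "W (h * real j) \<omega> = W 0 \<omega> + (\<Sum>k<j. D \<omega> k)" for j \<omega>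
    by (induction j) (auto simp: D_def)
  have word: "prod_list (map (\<lambda>j. iexp (u * W (h * real j) \<omega>)) xs) * prod_list (map (\<lambda>j. iexp (- (u * W (h * real j) \<omega>))) ys)
     = (\<Prod>k<n. iexp (A k * D \<omega> k))" for \<omega>
  proof -
    have S: "sum_list (map (\<lambda>j. c * W (h * real j) \<omega>) zs) =
       c * (length zs * W 0 \<omega> + (\<Sum>k<n. num_above k zs * D \<omega> k))" if "set zs \<subseteq> {..n}" for c zs
      using sum_list_num_above[OF that, where a = "W 0 \<omega>" and d = "D \<omega>"] tele by (simp add: sum_list_const_mult)
    have "prod_list (map (\<lambda>j. iexp (u * W (h * real j) \<omega>)) xs) * prod_list (map (\<lambda>j. iexp (- u * W (h * real j) \<omega>)) ys)
      = iexp (sum_list (map (\<lambda>j. u * W (h * real j) \<omega>) xs) + sum_list (map (\<lambda>j. - u * W (h * real j) \<omega>) ys))"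
      unfolding prod_list_iexp by (simp only: exp_add of_real_add distrib_left)
    \<comment> \<open>The two lists have equal length, so the contributions of the initial value
      \<open>W 0 \<omega>\<close> cancel and only increments remain.\<close>
    also have "sum_list (map (\<lambda>j. u * W (h * real j) \<omega>) xs) + sum_list (map (\<lambda>j. - u * W (h * real j) \<omega>) ys) = (\<Sum>k<n. A k * D \<omega> k)"
      unfolding S[OF xs] S[OF ys] len A_def
      by (simp add: algebra_simps sum_subtractf sum_negf sum_distrib_left)
    also have "iexp (\<Sum>k<n. A k * D \<omega> k) = (\<Prod>k<n. iexp (A k * D \<omega> k))"
      by (simp add: exp_sum sum_distrib_left)
    finally show ?thesis by simp
  qed
  have "norm (expectation (\<lambda>\<omega>. \<Prod>k<n. iexp (A k * D \<omega> k))) = (\<Prod>k<n. exp (- ((A k)\<^sup>2 * h) / 2))"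
    unfolding D_def expectation_prod_iexp_increments[OF h] norm_of_real by (simp add: abs_prod)
  also have "\<dots> \<le> (\<Prod>k<n. if odd (num_above k (xs @ ys)) then exp (- (u\<^sup>2 * h) / 2) else 1)"
  proof (rule prod_mono, safe)
    fix k
    show "exp (- ((A k)\<^sup>2 * h) / 2) \<le> (if odd (num_above k (xs @ ys)) then exp (- (u\<^sup>2 * h) / 2) else 1)"
    proof (cases "odd (num_above k (xs @ ys))")
      case True
      \<comment> \<open>The sum and the difference of the two counts have the same parity. An odd
        difference is a nonzero integer, so its square is at least 1.\<close>
      then have "int (num_above k xs) - int (num_above k ys) \<noteq> 0"
        by (auto simp: num_above_def)
      then have "1 \<le> (int (num_above k xs) - int (num_above k ys))\<^sup>2"
        by (meson int_one_le_iff_zero_less zero_less_power2)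
      then have "1 \<le> (real (num_above k xs) - real (num_above k ys))\<^sup>2"
        by (metis (mono_tags, opaque_lifting) of_int_1_le_iff of_int_diff of_int_of_nat_eq of_int_power)
      then have "u\<^sup>2 * 1 \<le> (A k)\<^sup>2"
        unfolding A_def power_mult_distrib by (intro mult_left_mono) auto
      then show ?thesis using True h by simp
    qed (use h in simp)
  qed simp
  also have "\<dots> = exp (- (u\<^sup>2 * h) / 2) ^ odd_levels n (xs @ ys)"
    unfolding odd_levels_def by (subst prod.If_cases) (simp_all add: Collect_conj_eq lessThan_def)
  finally show ?thesis unfolding word .
qed

text \<open>Writing the even power as \<open>X ^ q * cnj X ^ q\<close> expands it into words with q
  positive and q negative signs. The estimate for a word depends only on the combined list
  \<open>xs @ ys\<close>, so the signs can be forgotten and the sum runs over all lists of length 2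
  q.\<close>

lemma grid_moment_le:
  assumes h: "0 < h" and p: "\<And>k. 0 \<le> p k"
  shows "expectation (\<lambda>\<omega>. norm (\<Sum>j\<le>n. of_real (p j) * iexp (u * W (h * real j) \<omega>)) ^ (2 * q)) \<le>
     fact (2 * q) * (\<Sum>j\<le>n. \<Sum>k\<in>{j..n}. p j * p k * exp (- (u\<^sup>2 * h) / 2) ^ (k - j)) ^ q"
proof -
  let ?L = "{xs. set xs \<subseteq> {..n} \<and> length xs = q}"
  let ?\<rho> = "exp (- (u\<^sup>2 * h) / 2)"
  define X where "X \<omega> = (\<Sum>j\<le>n. of_real (p j) * iexp (u * W (h * real j) \<omega>))" for \<omega>
  define V where "V \<omega> xs = prod_list (map (\<lambda>j. iexp (u * W (h * real j) \<omega>)) xs)" for \<omega> xs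
  define U where "U \<omega> xs = prod_list (map (\<lambda>j. iexp (- (u * W (h * real j) \<omega>))) xs)" for \<omega> xs
  define P where "P xs = prod_list (map p xs)" for xs
  have finL: "finite ?L" by (rule finite_lists_length_eq) simp
  have P0: "0 \<le> P xs" for xs unfolding P_def by (induction xs) (auto simp: p)
  have VP: "prod_list (map (\<lambda>j. of_real (p j) * iexp (u * W (h * real j) \<omega>)) xs) = of_real (P xs) * V \<omega> xs" for xs \<omega>
    unfolding P_def V_def by (induction xs) auto
  have UP: "prod_list (map (\<lambda>j. of_real (p j) * iexp (- (u * W (h * real j) \<omega>))) xs) = of_real (P xs) * U \<omega> xs" for xs \<omega>
    unfolding P_def U_def by (induction xs) auto
  have cnj: "cnj (X \<omega>) = (\<Sum>j\<le>n. of_real (p j) * iexp (- (u * W (h * real j) \<omega>)))" for \<omega>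
    unfolding X_def by (simp add: exp_cnj)
  have eq: "of_real (norm (X \<omega>) ^ (2 * q)) = (\<Sum>xs\<in>?L. \<Sum>ys\<in>?L. of_real (P xs * P ys) * (V \<omega> xs * U \<omega> ys))" for \<omega>
  proof -
    have "complex_of_real (norm (X \<omega>) ^ (2 * q)) = (X \<omega> * cnj (X \<omega>)) ^ q"
      by (simp add: power_mult complex_norm_square[symmetric])
    also have "\<dots> = X \<omega> ^ q * cnj (X \<omega>) ^ q" by (rule power_mult_distrib)
    also have "\<dots> = (\<Sum>xs\<in>?L. of_real (P xs) * V \<omega> xs) * (\<Sum>ys\<in>?L. of_real (P ys) * U \<omega> ys)"
      unfolding cnj unfolding X_def sum_power_lists[OF finite_atMost] VP UP ..
    also have "\<dots> = (\<Sum>xs\<in>?L. \<Sum>ys\<in>?L. of_real (P xs * P ys) * (V \<omega> xs * U \<omega> ys))"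
      unfolding sum_product by (intro sum.cong refl) (simp add: mult_ac)
    finally show ?thesis .
  qed
  have mV [measurable]: "(\<lambda>\<omega>. V \<omega> xs) \<in> borel_measurable M" for xs
    unfolding V_def using h by (induction xs) auto
  have mU [measurable]: "(\<lambda>\<omega>. U \<omega> xs) \<in> borel_measurable M" for xs
    unfolding U_def using h by (induction xs) auto
  have nV: "norm (V \<omega> xs) = 1" for \<omega> xs unfolding V_def by (induction xs) (auto simp: norm_mult)
  have nU: "norm (U \<omega> xs) = 1" for \<omega> xs unfolding U_def by (induction xs) (auto simp: norm_mult)
  have int: "integrable M (\<lambda>\<omega>. V \<omega> xs * U \<omega> ys)" for xs ys
    by (rule integrable_const_bound[where B = 1]) (auto simp: norm_mult nV nU)
  have "complex_of_real (expectation (\<lambda>\<omega>. norm (X \<omega>) ^ (2 * q))) = expectation (\<lambda>\<omega>. complex_of_real (norm (X \<omega>) ^ (2 * q)))"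
    by (rule integral_complex_of_real[symmetric])
  also have "\<dots> = (\<Sum>xs\<in>?L. \<Sum>ys\<in>?L. of_real (P xs * P ys) * expectation (\<lambda>\<omega>. V \<omega> xs * U \<omega> ys))"
    unfolding eq using int by (subst Bochner_Integration.integral_sum; simp)+
  finally have E: "complex_of_real (expectation (\<lambda>\<omega>. norm (X \<omega>) ^ (2 * q))) =
    (\<Sum>xs\<in>?L. \<Sum>ys\<in>?L. of_real (P xs * P ys) * expectation (\<lambda>\<omega>. V \<omega> xs * U \<omega> ys))" .
  have "expectation (\<lambda>\<omega>. norm (X \<omega>) ^ (2 * q)) \<le> norm (complex_of_real (expectation (\<lambda>\<omega>. norm (X \<omega>) ^ (2 * q))))"
    by simp
  also have "\<dots> \<le> (\<Sum>xs\<in>?L. \<Sum>ys\<in>?L. P xs * P ys * ?\<rho> ^ odd_levels n (xs @ ys))"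
    unfolding E
  proof (rule sum_norm_le[OF sum_norm_le])
    fix xs ys assume "xs \<in> ?L" "ys \<in> ?L"
    then have "norm (expectation (\<lambda>\<omega>. V \<omega> xs * U \<omega> ys)) \<le> ?\<rho> ^ odd_levels n (xs @ ys)"
      unfolding U_def V_def by (intro norm_expectation_word_le h) auto
    then show "norm (of_real (P xs * P ys) * expectation (\<lambda>\<omega>. V \<omega> xs * U \<omega> ys)) \<le> P xs * P ys * ?\<rho> ^ odd_levels n (xs @ ys)"
      using P0 by (simp add: norm_mult abs_mult mult_left_mono)
  qed
  also have "\<dots> = (\<Sum>xs\<in>?L. \<Sum>ys\<in>?L. P (xs @ ys) * ?\<rho> ^ odd_levels n (xs @ ys))"
    by (simp add: P_def)
  also have "\<dots> = (\<Sum>zs | set zs \<subseteq> {..n} \<and> length zs = q + q. P zs * ?\<rho> ^ odd_levels n zs)"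
    by (rule sum_lists_append) simp
  also have "\<dots> \<le> fact (2 * q) * (\<Sum>j\<le>n. \<Sum>k\<in>{j..n}. p j * p k * ?\<rho> ^ (k - j)) ^ q"
    using sum_lists_odd_levels_le[of p ?\<rho> n q] p h by (simp add: P_def mult_2)
  finally show ?thesis unfolding X_def .
qed

end

section \<open>Energy of the measure\<close>

text \<open>The complement is a union of possibly uncountably many null open sets; the Lindelof
  property makes it a countable union.\<close>

lemma emeasure_Compl_measure_support:
  fixes M :: "'a::second_countable_topology measure"
  assumes "sets M = sets borel"
  shows "emeasure M (- measure_support M) = 0"
proof -
  let ?F = "{U. open U \<and> emeasure M U = 0}"
  have F: "- measure_support M = \<Union>?F"
    by (auto simp: measure_support_def)
  obtain F' where F': "F' \<subseteq> ?F" "countable F'" "\<Union>F' = \<Union>?F"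
    using Lindelof[of ?F] by auto
  have "(\<Union>U\<in>F'. U) \<in> null_sets M"
    by (rule null_sets_UN'[OF F'(2)]) (use F'(1) assms in \<open>auto simp: null_sets_def\<close>)
  then show ?thesis using F' F by (auto simp: null_sets_def)
qed

lemma closed_measure_support: "closed (measure_support M)"
proof -
  have F: "- measure_support M = \<Union>{U. open U \<and> emeasure M U = 0}"
    by (auto simp: measure_support_def)
  show ?thesis unfolding closed_def F by auto
qed

lemma sum_indicator_grid:
  fixes h :: real
  assumes "0 < h"
  shows "(\<Sum>j\<le>n. indicator {real j * h..<real (Suc j) * h} x) = (indicator {0..<real (Suc n) * h} x :: real)"
proof (induction n)
  case (Suc n)
  have "0 \<le> real (Suc n) * h" "real (Suc n) * h \<le> real (Suc (Suc n)) * h"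
    using assms by (auto simp: mult_right_mono)
  then show ?case
    using Suc by (auto simp: indicator_def)
qed (simp add: indicator_def)

text \<open>This interpolates between the trivial mass bound and the scaling bound: it trades some
  decay in T for integrability in x at 0.\<close>

lemma min_one_le_powr:
  fixes z :: real
  assumes "0 < z" "0 \<le> \<theta>" "\<theta> \<le> 1"
  shows "min 1 z \<le> z powr \<theta>"
proof (cases "1 \<le> z")
  case True
  then show ?thesis using assms ge_one_powr_ge_zero[of z \<theta>] by simp
next
  case False
  then have "z powr 1 \<le> z powr \<theta>" using assms by (intro powr_mono') auto
  then show ?thesis using assms False by simp
qed

lemma term_le_suminf_ennreal: "f k \<le> (\<Sum>i. f i)" for f :: "nat \<Rightarrow> ennreal"
  using sum_le_suminf[of f "{k}"] by (simp add: summableI)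

lemma dyadic_scale:
  fixes x :: real
  assumes "0 < x" "x \<le> 1"
  obtains k where "(1/2) ^ Suc k < x" "x \<le> (1/2) ^ k"
proof -
  define k where "k = (LEAST k. (1/2::real) ^ Suc k < x)"
  obtain m where "(1/2::real) ^ m < x" using real_arch_pow_inv[of x "1/2"] assms by auto
  then have "(1/2::real) ^ Suc m < x" by (rule le_less_trans[rotated], intro power_decreasing) auto
  then have "(1/2::real) ^ Suc k < x" unfolding k_def by (rule LeastI)
  moreover have "x \<le> (1/2) ^ k"
  proof (cases k)
    case 0 then show ?thesis using assms by simp
  next
    case (Suc j)
    then have "\<not> (1/2::real) ^ Suc j < x" using not_less_Least[of j "\<lambda>k. (1/2::real) ^ Suc k < x"] k_def by simp
    then show ?thesis using Suc by simp
  qed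
  ultimately show ?thesis by (rule that)
qed

text \<open>On the k-th dyadic shell the integrand is at most a multiple of
  \<open>2 powr (b * k)\<close>, and the mass is at most a multiple of
  \<open>2 powr (- a * k)\<close>; the products form a geometric series because b < a. It serves
  both for \<mu> near 0 and for the modulus of a Gaussian variable.\<close>

lemma nn_integral_powr_finite:
  fixes m :: "real measure"
  assumes [measurable_cong]: "sets m = sets borel" and K: "0 \<le> K"
    and mass: "\<And>r. 0 < r \<Longrightarrow> r \<le> 1 \<Longrightarrow> emeasure m {0..r} \<le> ennreal (K * r powr a)" and b: "0 < b" "b < a"
  shows "(\<integral>\<^sup>+ x. ennreal (x powr (- b)) * indicator {0<..1} x \<partial>m) < \<infinity>"
proof -
  define q where "q = (1/2::real) powr (a - b)"
  have q: "0 < q" "q < 1" using b gr_one_powr[of 2 "a - b"] by (auto simp: q_def powr_divide)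
  let ?I = "\<lambda>k. {0..(1/2::real) ^ k}"
  have "(\<integral>\<^sup>+ x. ennreal (x powr (- b)) * indicator {0<..1} x \<partial>m) \<le>
      (\<integral>\<^sup>+ x. (\<Sum>k. ennreal (2 powr b * ((1/2) ^ k) powr (- b)) * indicator (?I k) x) \<partial>m)"
  proof (rule nn_integral_mono)
    fix x :: real
    show "ennreal (x powr (- b)) * indicator {0<..1} x \<le> (\<Sum>k. ennreal (2 powr b * ((1/2) ^ k) powr (- b)) * indicator (?I k) x)"
    proof (cases "x \<in> {0<..1}")
      case True
      then obtain k where k: "(1/2) ^ Suc k < x" "x \<le> (1/2) ^ k" using dyadic_scale[of x] by auto
      have "x powr (- b) \<le> ((1/2) ^ Suc k) powr (- b)"
        using k b True by (intro powr_mono2') auto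
      also have "\<dots> = 2 powr b * ((1/2) ^ k) powr (- b)"
        by (simp add: powr_mult powr_divide powr_minus_divide)
      finally have "ennreal (x powr (- b)) * indicator {0<..1} x \<le> ennreal (2 powr b * ((1/2) ^ k) powr (- b)) * indicator (?I k) x"
        using True k by (simp add: ennreal_leI)
      also have "\<dots> \<le> (\<Sum>k. ennreal (2 powr b * ((1/2) ^ k) powr (- b)) * indicator (?I k) x)"
        by (rule term_le_suminf_ennreal)
      finally show ?thesis .
    qed simp
  qed
  also have "\<dots> = (\<Sum>k. ennreal (2 powr b * ((1/2) ^ k) powr (- b)) * emeasure m (?I k))"
    by (simp add: nn_integral_suminf nn_integral_cmult assms(1))
  also have "\<dots> \<le> (\<Sum>k. ennreal (2 powr b * K * q ^ k))"
  proof (rule suminf_le)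
    fix k
    have eq: "((1/2) ^ k) powr (- b) * ((1/2::real) ^ k) powr a = q ^ k"
      unfolding q_def by (simp add: powr_realpow[symmetric] powr_powr powr_add[symmetric] algebra_simps)
    have "ennreal (2 powr b * ((1/2) ^ k) powr (- b)) * emeasure m (?I k) \<le>
        ennreal (2 powr b * ((1/2) ^ k) powr (- b)) * ennreal (K * ((1/2) ^ k) powr a)"
      by (intro mult_left_mono mass) (auto simp: power_le_one)
    also have "\<dots> = ennreal (2 powr b * ((1/2) ^ k) powr (- b) * (K * ((1/2) ^ k) powr a))"
      using K by (simp add: ennreal_mult)
    also have "2 powr b * ((1/2) ^ k) powr (- b) * (K * ((1/2) ^ k) powr a) = 2 powr b * K * q ^ k"
      using eq by (simp add: mult_ac)
    finally show "ennreal (2 powr b * ((1/2) ^ k) powr (- b)) * emeasure m (?I k) \<le> ennreal (2 powr b * K * q ^ k)" .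
  qed auto
  also have "\<dots> = ennreal (\<Sum>k. 2 powr b * K * q ^ k)"
    using q K by (intro suminf_ennreal2 summable_mult summable_geometric) auto
  also have "\<dots> < \<infinity>" by simp
  finally show ?thesis .
qed

locale nonuniform_measure = finite_measure \<mu> for \<mu> :: "real measure" +
  fixes s c K :: real
  assumes s: "0 < s" "s \<le> 1/2"
    and sets_eq [simp, measurable_cong]: "sets \<mu> = sets borel"
    and on_unit_interval: "emeasure \<mu> (- {0..1}) = 0"
    and cK: "0 < c" "c \<le> K"
    and mass_at_0: "\<And>r. 0 < r \<Longrightarrow> r \<le> 1 \<Longrightarrow>
          c * r powr (s/2) \<le> measure \<mu> {0..r} \<and> measure \<mu> {0..r} \<le> K * r powr (s/2)"
    and mass_away_from_0: "\<And>x r. x \<in> measure_support \<mu> - {0} \<Longrightarrow> 0 < r \<Longrightarrow>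
          measure \<mu> {x..x + r} \<le> K * min 1 (x powr (- s/2) * r powr s)"
begin

lemma space_eq [simp]: "space \<mu> = UNIV"
  using sets_eq_imp_space_eq[OF sets_eq] by simp

text \<open>The bound \<open>mass_away_from_0\<close> says nothing at the point 0. That it holds at
  almost every point rests on the upper bound in \<open>mass_at_0\<close>, which excludes an atom
  there.\<close>

lemma emeasure_singleton_0: "emeasure \<mu> {0} = 0"
proof -
  have "measure \<mu> {0} \<le> \<epsilon>" if "0 < \<epsilon>" for \<epsilon>
  proof -
    define r where "r = min 1 ((\<epsilon> / K) powr (2 / s))"
    have r: "0 < r" "r \<le> 1" using that cK by (auto simp: r_def)
    have "measure \<mu> {0} \<le> measure \<mu> {0..r}"
      using r by (intro finite_measure_mono) auto
    also have "\<dots> \<le> K * r powr (s/2)" using mass_at_0 r by blast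
    also have "\<dots> \<le> K * ((\<epsilon> / K) powr (2 / s)) powr (s/2)"
      using cK r s by (intro mult_left_mono powr_mono2) (auto simp: r_def)
    also have "\<dots> = \<epsilon>" using cK s that by (simp add: powr_powr)
    finally show ?thesis .
  qed
  then have "measure \<mu> {0} \<le> 0" by (rule field_le_epsilon[of _ 0, simplified])
  then show ?thesis by (simp add: emeasure_eq_measure measure_le_0_iff)
qed

lemma AE_unit: "AE x in \<mu>. x \<in> measure_support \<mu> \<and> 0 < x \<and> x \<le> 1"
proof (rule AE_I)
  let ?N = "(- measure_support \<mu>) \<union> (- {0..1}) \<union> {0}"
  show "{x \<in> space \<mu>. \<not> (x \<in> measure_support \<mu> \<and> 0 < x \<and> x \<le> 1)} \<subseteq> ?N" by auto
  have "- measure_support \<mu> \<in> null_sets \<mu>" "- {0..1} \<in> null_sets \<mu>" "{0} \<in> null_sets \<mu>"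
    using emeasure_Compl_measure_support[OF sets_eq] closed_measure_support[of \<mu>]
      on_unit_interval emeasure_singleton_0 by (auto simp: null_sets_def)
  then have "?N \<in> null_sets \<mu>" by (intro null_sets.Un)
  then show "emeasure \<mu> ?N = 0" "?N \<in> sets \<mu>" by (auto simp: null_sets_def)
qed

lemma support_subset: "measure_support \<mu> \<subseteq> {0..1}"
proof
  fix x assume "x \<in> measure_support \<mu>"
  then have "x \<in> U \<Longrightarrow> open U \<Longrightarrow> 0 < emeasure \<mu> U" for U by (auto simp: measure_support_def)
  from this[of "- {0..1}"] show "x \<in> {0..1}" using on_unit_interval by (force simp: open_Compl)
qed

text \<open>To the right of x the kernel is cut at multiples of 1 / T: at the k-th step it is at
  most \<open>exp (-1) ^ k\<close>, while the mass of \<open>{x..x + (k + 1) / T}\<close> grows at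
  most linearly in k. Only the right half is treated because the mass bound concerns intervals that
  start at a point of the support.\<close>

lemma nn_integral_exp_right:
  assumes \<theta>: "0 < \<theta>" "\<theta> < 1"
  obtains C where "0 \<le> C" "\<And>x T. x \<in> measure_support \<mu> \<Longrightarrow> 0 < x \<Longrightarrow> 0 < T \<Longrightarrow>
    (\<integral>\<^sup>+ y. ennreal (exp (- T * \<bar>x - y\<bar>)) * indicator {x..} y \<partial>\<mu>) \<le>
    ennreal (C * T powr (- \<theta> * s) * x powr (- \<theta> * s / 2))"
proof -
  define a where "a k = exp (-1) ^ k * (real k + 1)" for k
  have a: "summable a"
  proof -
    have "a = (\<lambda>k. of_nat (Suc k) * exp (-1) ^ k)" by (auto simp: a_def fun_eq_iff)
    then show ?thesis using geometric_deriv_sums[of "exp (-1::real)"] by (simp add: sums_iff)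
  qed
  have a0: "0 \<le> a k" for k by (simp add: a_def)
  define C where "C = K * suminf a"
  have "0 \<le> C" using a a0 cK by (simp add: C_def suminf_nonneg)
  moreover have "(\<integral>\<^sup>+ y. ennreal (exp (- T * \<bar>x - y\<bar>)) * indicator {x..} y \<partial>\<mu>) \<le>
    ennreal (C * T powr (- \<theta> * s) * x powr (- \<theta> * s / 2))"
    if x: "x \<in> measure_support \<mu>" "0 < x" and T: "0 < T" for x T
  proof -
    let ?I = "\<lambda>k. {x..x + (real k + 1) / T}"
    let ?b = "K * T powr (- \<theta> * s) * x powr (- \<theta> * s / 2)"
    have mass: "measure \<mu> (?I k) \<le> ?b * (real k + 1)" for k
    proof -
      let ?r = "(real k + 1) / T" and ?z = "x powr (- s/2) * ((real k + 1) / T) powr s"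
      have r: "0 < ?r" using T by simp
      have z: "0 < ?z" using x(2) r by (metis mult_pos_pos less_irrefl powr_gt_zero)
      have "measure \<mu> (?I k) \<le> K * min 1 ?z"
        using x r by (intro mass_away_from_0) auto
      also have "\<dots> \<le> K * ?z powr \<theta>"
        using z \<theta> cK by (intro mult_left_mono min_one_le_powr) auto
      also have "?z powr \<theta> = x powr (- \<theta> * s / 2) * (real k + 1) powr (\<theta> * s) * T powr (- \<theta> * s)"
        using x r T by (simp add: powr_mult powr_divide powr_powr powr_minus_divide mult_ac)
      \<comment> \<open>As \<open>\<theta> * s \<le> 1\<close>, the power of k + 1 is at most k + 1
        itself; this produces the series \<open>a\<close>, the derivative of a geometric
        series.\<close>
      also have "K * (x powr (- \<theta> * s / 2) * (real k + 1) powr (\<theta> * s) * T powr (- \<theta> * s)) \<le>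
          K * (x powr (- \<theta> * s / 2) * (real k + 1) powr 1 * T powr (- \<theta> * s))"
        using \<theta> s cK by (intro mult_left_mono mult_right_mono powr_mono) (auto intro: mult_le_one)
      finally show ?thesis by (simp add: mult_ac)
    qed
    have "(\<integral>\<^sup>+ y. ennreal (exp (- T * \<bar>x - y\<bar>)) * indicator {x..} y \<partial>\<mu>) \<le>
      (\<integral>\<^sup>+ y. (\<Sum>k. ennreal (exp (-1) ^ k) * indicator (?I k) y) \<partial>\<mu>)"
    proof (rule nn_integral_mono)
      fix y
      show "ennreal (exp (- T * \<bar>x - y\<bar>)) * indicator {x..} y \<le> (\<Sum>k. ennreal (exp (-1) ^ k) * indicator (?I k) y)"
      proof (cases "x \<le> y")
        case True
        define k where "k = nat \<lfloor>T * (y - x)\<rfloor>"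
        have k: "real k \<le> T * (y - x)" "T * (y - x) \<le> real k + 1"
          using True T unfolding k_def by auto
        have "exp (- T * \<bar>x - y\<bar>) \<le> exp (-1) ^ k"
          using k True by (simp flip: exp_of_nat_mult)
        moreover have "y \<in> ?I k" using k True T by (auto simp: field_simps)
        ultimately have "ennreal (exp (- T * \<bar>x - y\<bar>)) * indicator {x..} y \<le> ennreal (exp (-1) ^ k) * indicator (?I k) y"
          using True by (simp add: ennreal_leI)
        also have "\<dots> \<le> (\<Sum>k. ennreal (exp (-1) ^ k) * indicator (?I k) y)"
          by (rule term_le_suminf_ennreal)
        finally show ?thesis .
      qed simp
    qed
    also have "\<dots> = (\<Sum>k. ennreal (exp (-1) ^ k) * emeasure \<mu> (?I k))"
      by (simp add: nn_integral_suminf nn_integral_cmult)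
    also have "\<dots> \<le> (\<Sum>k. ennreal (?b * a k))"
    proof (rule suminf_le)
      fix k
      have "ennreal (exp (-1) ^ k) * emeasure \<mu> (?I k) = ennreal (exp (-1) ^ k * measure \<mu> (?I k))"
        by (simp add: emeasure_eq_measure ennreal_mult)
      also have "\<dots> \<le> ennreal (exp (-1) ^ k * (?b * (real k + 1)))"
        using mass by (intro ennreal_leI mult_left_mono) auto
      finally show "ennreal (exp (-1) ^ k) * emeasure \<mu> (?I k) \<le> ennreal (?b * a k)"
        by (simp add: a_def mult_ac)
    qed auto
    also have "\<dots> = ennreal (?b * suminf a)"
      using a a0 cK by (subst suminf_ennreal2) (auto simp: suminf_mult summable_mult)
    finally show ?thesis by (simp add: C_def mult_ac)
  qed
  ultimately show ?thesis using that by blast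
qed

text \<open>Every pair has its left point first in one of the two orders, and Fubini shows that both
  orders contribute equally, so the one-sided estimate suffices. What remains is the integral of
  \<open>x powr (- \<theta> * s / 2)\<close>, which is finite because its exponent stays below the
  mass exponent s / 2 when \<theta> < 1.\<close>

lemma nn_integral_exp_distance_le:
  assumes \<theta>: "0 < \<theta>" "\<theta> < 1"
  obtains C where "0 \<le> C" "\<And>T. 0 < T \<Longrightarrow>
    (\<integral>\<^sup>+ x. \<integral>\<^sup>+ y. ennreal (exp (- T * \<bar>x - y\<bar>)) \<partial>\<mu> \<partial>\<mu>) \<le> ennreal (C * T powr (- \<theta> * s))"
proof -
  obtain C1 where C1: "0 \<le> C1" "\<And>x T. x \<in> measure_support \<mu> \<Longrightarrow> 0 < x \<Longrightarrow> 0 < T \<Longrightarrow>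
    (\<integral>\<^sup>+ y. ennreal (exp (- T * \<bar>x - y\<bar>)) * indicator {x..} y \<partial>\<mu>) \<le>
    ennreal (C1 * T powr (- \<theta> * s) * x powr (- \<theta> * s / 2))"
    using nn_integral_exp_right[OF \<theta>] by blast
  let ?J = "\<integral>\<^sup>+ x. ennreal (x powr (- (\<theta> * s / 2))) * indicator {0<..1} x \<partial>\<mu>"
  have "?J < \<infinity>"
    using \<theta> s cK mass_at_0
    by (intro nn_integral_powr_finite[where K = K and a = "s / 2"]) (auto simp: emeasure_eq_measure ennreal_leI)
  then obtain C2 where C2: "0 \<le> C2" "?J = ennreal C2" by (cases ?J) auto
  interpret P: pair_sigma_finite \<mu> \<mu> by standard
  have "(\<integral>\<^sup>+ x. \<integral>\<^sup>+ y. ennreal (exp (- T * \<bar>x - y\<bar>)) \<partial>\<mu> \<partial>\<mu>) \<le> ennreal (2 * C1 * C2 * T powr (- \<theta> * s))"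
    if T: "0 < T" for T
  proof -
    let ?e = "\<lambda>x y. ennreal (exp (- T * \<bar>x - y\<bar>))"
    have half: "(\<integral>\<^sup>+ x. \<integral>\<^sup>+ y. ?e x y * indicator {x..} y \<partial>\<mu> \<partial>\<mu>) \<le> ennreal (C1 * C2 * T powr (- \<theta> * s))"
    proof -
      have "(\<integral>\<^sup>+ x. \<integral>\<^sup>+ y. ?e x y * indicator {x..} y \<partial>\<mu> \<partial>\<mu>) \<le>
        (\<integral>\<^sup>+ x. ennreal (C1 * T powr (- \<theta> * s)) * (ennreal (x powr (- (\<theta> * s / 2))) * indicator {0<..1} x) \<partial>\<mu>)"
        using AE_unit
      proof (intro nn_integral_mono_AE, eventually_elim)
        fix x assume "x \<in> measure_support \<mu> \<and> 0 < x \<and> x \<le> 1"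
        then show "(\<integral>\<^sup>+ y. ?e x y * indicator {x..} y \<partial>\<mu>) \<le>
           ennreal (C1 * T powr (- \<theta> * s)) * (ennreal (x powr (- (\<theta> * s / 2))) * indicator {0<..1} x)"
          using C1(2)[of x T] T C1(1) by (simp add: ennreal_mult[symmetric])
      qed
      also have "\<dots> = ennreal (C1 * T powr (- \<theta> * s)) * ennreal C2"
        by (subst nn_integral_cmult) (auto simp: C2(2))
      finally show ?thesis using C1(1) C2(1) by (simp add: ennreal_mult[symmetric] mult_ac)
    qed
    have meas: "(\<lambda>(x, y). ?e x y * indicator {x..} y) \<in> borel_measurable (\<mu> \<Otimes>\<^sub>M \<mu>)"
    proof -
      have "(\<lambda>(x, y). ?e x y * indicator {x..} y) = (\<lambda>(x, y). ?e x y * (if x \<le> y then 1 else 0))"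
        by (auto simp: fun_eq_iff indicator_def)
      then show ?thesis by simp
    qed
    \<comment> \<open>The diagonal lies in both halves, hence an inequality only.\<close>
    have "(\<integral>\<^sup>+ x. \<integral>\<^sup>+ y. ?e x y \<partial>\<mu> \<partial>\<mu>) \<le> (\<integral>\<^sup>+ x. \<integral>\<^sup>+ y. ?e x y * indicator {x..} y + ?e y x * indicator {y..} x \<partial>\<mu> \<partial>\<mu>)"
      by (intro nn_integral_mono) (auto simp: indicator_def abs_minus_commute)
    also have "\<dots> = (\<integral>\<^sup>+ x. \<integral>\<^sup>+ y. ?e x y * indicator {x..} y \<partial>\<mu> \<partial>\<mu>) + (\<integral>\<^sup>+ x. \<integral>\<^sup>+ y. ?e y x * indicator {y..} x \<partial>\<mu> \<partial>\<mu>)"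
    proof -
      have 1: "(\<lambda>y. ?e x y * indicator {x..} y) \<in> borel_measurable \<mu>" for x by simp
      have 2: "(\<lambda>y. ?e y x * indicator {y..} x) \<in> borel_measurable \<mu>" for x
      proof -
        have "(\<lambda>y. ?e y x * indicator {y..} x) = (\<lambda>y. ?e y x * indicator {..x} y)" by (auto simp: fun_eq_iff indicator_def)
        then show ?thesis by simp
      qed
      have 3: "(\<lambda>x. \<integral>\<^sup>+ y. ?e x y * indicator {x..} y \<partial>\<mu>) \<in> borel_measurable \<mu>"
        by (rule sigma_finite_measure.borel_measurable_nn_integral[OF _ meas]) (rule sigma_finite_measure_axioms)
      have m: "(\<lambda>(x, y). ?e y x * indicator {y..} x) \<in> borel_measurable (\<mu> \<Otimes>\<^sub>M \<mu>)"
      proof -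
        have "(\<lambda>(x, y). ?e y x * indicator {y..} x) = (\<lambda>(x, y). ?e y x * (if y \<le> x then 1 else 0))"
          by (auto simp: fun_eq_iff indicator_def)
        then show ?thesis by simp
      qed
      have 4: "(\<lambda>x. \<integral>\<^sup>+ y. ?e y x * indicator {y..} x \<partial>\<mu>) \<in> borel_measurable \<mu>"
        by (rule sigma_finite_measure.borel_measurable_nn_integral[OF _ m]) (rule sigma_finite_measure_axioms)
      show ?thesis
        by (simp only: nn_integral_add[OF 1 2] nn_integral_add[OF 3 4])
    qed
    also have "(\<integral>\<^sup>+ x. \<integral>\<^sup>+ y. ?e y x * indicator {y..} x \<partial>\<mu> \<partial>\<mu>) = (\<integral>\<^sup>+ x. \<integral>\<^sup>+ y. ?e x y * indicator {x..} y \<partial>\<mu> \<partial>\<mu>)"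
      using P.Fubini'[OF meas] .
    also have "\<dots> + \<dots> \<le> ennreal (C1 * C2 * T powr (- \<theta> * s)) + ennreal (C1 * C2 * T powr (- \<theta> * s))"
      by (intro add_mono half)
    also have "\<dots> = ennreal (2 * C1 * C2 * T powr (- \<theta> * s))"
      using C1(1) C2(1) by (simp flip: ennreal_plus)
    finally show ?thesis .
  qed
  then show ?thesis using C1(1) C2(1) that[of "2 * C1 * C2"] by simp
qed

text \<open>For x in cell j and y in cell k with j \<le> k the distance is at most
  \<open>(k - j) * h + h\<close>, so the discrete kernel exceeds the continuous one by at most the
  factor \<open>exp (T * h)\<close>. This factor is harmless once the mesh is small compared with 1
  / T.\<close>

lemma grid_energy_le:
  assumes h: "0 < h" and T: "0 < T"
    and p: "\<And>k. p k = measure \<mu> {real k * h..<real (Suc k) * h}"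
  shows "ennreal (\<Sum>j\<le>n. \<Sum>k\<in>{j..n}. p j * p k * exp (- T * h) ^ (k - j)) \<le>
    ennreal (exp (T * h)) * (\<integral>\<^sup>+ x. \<integral>\<^sup>+ y. ennreal (exp (- T * \<bar>x - y\<bar>)) \<partial>\<mu> \<partial>\<mu>)"
proof -
  let ?I = "\<lambda>k. {real k * h..<real (Suc k) * h}"
  let ?S = "\<lambda>x y. \<Sum>j\<le>n. \<Sum>k\<in>{j..n}. indicator (?I j) x * (indicator (?I k) y * exp (- T * h) ^ (k - j)) :: real"
  have point: "?S x y \<le> exp (T * h) * exp (- T * \<bar>x - y\<bar>)" for x y
  proof -
    have "?S x y \<le> (\<Sum>j\<le>n. \<Sum>k\<in>{j..n}. (indicator (?I j) x * indicator (?I k) y) * (exp (T * h) * exp (- T * \<bar>x - y\<bar>)))"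
    proof (intro sum_mono)
      fix j k assume jk: "j \<in> {..n}" "k \<in> {j..n}"
      show "indicator (?I j) x * (indicator (?I k) y * exp (- T * h) ^ (k - j)) \<le>
        (indicator (?I j) x * indicator (?I k) y) * (exp (T * h) * exp (- T * \<bar>x - y\<bar>))"
      proof (cases "x \<in> ?I j \<and> y \<in> ?I k")
        case True
        have "real j * h \<le> real k * h" using jk h by (intro mult_right_mono) auto
        moreover have "real (k - j) * h = real k * h - real j * h"
          using jk by (simp add: of_nat_diff left_diff_distrib)
        ultimately have "\<bar>x - y\<bar> \<le> real (k - j) * h + h"
          using True h unfolding abs_le_iff distrib_right of_nat_Suc atLeastLessThan_iff by linarith
        then have "T * \<bar>x - y\<bar> \<le> T * (real (k - j) * h + h)" using T by (intro mult_left_mono) auto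
        then have "real (k - j) * (- T * h) \<le> T * h + - T * \<bar>x - y\<bar>" by (simp add: algebra_simps)
        then have "exp (- T * h) ^ (k - j) \<le> exp (T * h) * exp (- T * \<bar>x - y\<bar>)"
          by (simp only: exp_of_nat_mult[symmetric] exp_add[symmetric] exp_le_cancel_iff)
        then show ?thesis using True by simp
      qed (auto simp: indicator_def)
    qed
    also have "\<dots> \<le> (\<Sum>j\<le>n. \<Sum>k\<le>n. (indicator (?I j) x * indicator (?I k) y) * (exp (T * h) * exp (- T * \<bar>x - y\<bar>)))"
      by (intro sum_mono sum_mono2) auto
    also have "\<dots> = ((\<Sum>j\<le>n. indicator (?I j) x) * (\<Sum>k\<le>n. indicator (?I k) y)) * (exp (T * h) * exp (- T * \<bar>x - y\<bar>))"
      unfolding sum_product unfolding sum_distrib_right ..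
    also have "\<dots> \<le> 1 * (exp (T * h) * exp (- T * \<bar>x - y\<bar>))"
      unfolding sum_indicator_grid[OF h] by (intro mult_right_mono) (auto simp: indicator_def)
    finally show ?thesis by simp
  qed
  have int: "ennreal (\<Sum>j\<le>n. \<Sum>k\<in>{j..n}. p j * p k * exp (- T * h) ^ (k - j)) = (\<integral>\<^sup>+ x. \<integral>\<^sup>+ y. ennreal (?S x y) \<partial>\<mu> \<partial>\<mu>)"
  proof -
    have inner: "(\<integral>\<^sup>+ y. ennreal (?S x y) \<partial>\<mu>) = ennreal (\<Sum>j\<le>n. \<Sum>k\<in>{j..n}. indicator (?I j) x * (p k * exp (- T * h) ^ (k - j)))" for x
    proof -
      have "integrable \<mu> (\<lambda>y. ?S x y)"
        by (intro Bochner_Integration.integrable_sum integrable_mult_right integrable_mult_left integrable_real_indicator)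
           (auto simp: emeasure_eq_measure)
      then have "(\<integral>\<^sup>+ y. ennreal (?S x y) \<partial>\<mu>) = ennreal (\<integral>y. ?S x y \<partial>\<mu>)"
        by (intro nn_integral_eq_integral) (auto intro!: sum_nonneg)
      also have "(\<integral>y. ?S x y \<partial>\<mu>) = (\<Sum>j\<le>n. \<Sum>k\<in>{j..n}. indicator (?I j) x * (p k * exp (- T * h) ^ (k - j)))"
      proof -
        have i: "integrable \<mu> (\<lambda>y. indicator (?I j) x * (indicator (?I k) y * exp (- T * h) ^ (k - j)) :: real)" for j k
          by (intro integrable_mult_right integrable_mult_left integrable_real_indicator) (auto simp: emeasure_eq_measure)
        have "(\<integral>y. ?S x y \<partial>\<mu>) = (\<Sum>j\<le>n. \<Sum>k\<in>{j..n}. \<integral>y. indicator (?I j) x * (indicator (?I k) y * exp (- T * h) ^ (k - j)) \<partial>\<mu>)"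
          by (simp only: Bochner_Integration.integral_sum Bochner_Integration.integrable_sum i)
        also have "\<dots> = (\<Sum>j\<le>n. \<Sum>k\<in>{j..n}. indicator (?I j) x * (p k * exp (- T * h) ^ (k - j)))"
          by (intro sum.cong refl) (simp add: p del: of_nat_Suc)
        finally show ?thesis .
      qed
      finally show ?thesis .
    qed
    let ?R = "\<lambda>x. \<Sum>j\<le>n. \<Sum>k\<in>{j..n}. indicator (?I j) x * (p k * exp (- T * h) ^ (k - j))"
    have p0: "0 \<le> p k" for k by (simp add: p)
    have iR: "integrable \<mu> ?R"
      by (intro Bochner_Integration.integrable_sum integrable_mult_right integrable_mult_left integrable_real_indicator)
           (auto simp: emeasure_eq_measure)
    have "(\<integral>\<^sup>+ x. ennreal (?R x) \<partial>\<mu>) = ennreal (\<integral>x. ?R x \<partial>\<mu>)"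
      using iR p0 by (intro nn_integral_eq_integral) (auto intro!: sum_nonneg)
    also have "(\<integral>x. ?R x \<partial>\<mu>) = (\<Sum>j\<le>n. \<Sum>k\<in>{j..n}. p j * p k * exp (- T * h) ^ (k - j))"
    proof -
      have i: "integrable \<mu> (\<lambda>x. indicator (?I j) x * (p k * exp (- T * h) ^ (k - j)))" for j k
        by (intro integrable_mult_left integrable_real_indicator) (auto simp: emeasure_eq_measure)
      have "(\<integral>x. ?R x \<partial>\<mu>) = (\<Sum>j\<le>n. \<Sum>k\<in>{j..n}. \<integral>x. indicator (?I j) x * (p k * exp (- T * h) ^ (k - j)) \<partial>\<mu>)"
        by (simp only: Bochner_Integration.integral_sum Bochner_Integration.integrable_sum i)
      also have "\<dots> = (\<Sum>j\<le>n. \<Sum>k\<in>{j..n}. p j * p k * exp (- T * h) ^ (k - j))"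
        by (intro sum.cong refl) (simp add: p del: of_nat_Suc)
      finally show ?thesis .
    qed
    finally show ?thesis by (simp only: inner)
  qed
  also have "\<dots> \<le> (\<integral>\<^sup>+ x. \<integral>\<^sup>+ y. ennreal (exp (T * h)) * ennreal (exp (- T * \<bar>x - y\<bar>)) \<partial>\<mu> \<partial>\<mu>)"
    using point by (intro nn_integral_mono) (auto simp: ennreal_mult[symmetric] ennreal_leI)
  also have "\<dots> = ennreal (exp (T * h)) * (\<integral>\<^sup>+ x. \<integral>\<^sup>+ y. ennreal (exp (- T * \<bar>x - y\<bar>)) \<partial>\<mu> \<partial>\<mu>)"
  proof -
    have "(\<lambda>x. \<integral>\<^sup>+ y. ennreal (exp (- T * \<bar>x - y\<bar>)) \<partial>\<mu>) \<in> borel_measurable \<mu>"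
      by (rule sigma_finite_measure.borel_measurable_nn_integral) (auto intro: sigma_finite_measure_axioms)
    then show ?thesis by (simp add: nn_integral_cmult)
  qed
  finally show ?thesis .
qed

end

section \<open>Almost sure Fourier decay\<close>

lemma sets_path_pushforward [simp, measurable_cong]: "sets (path_pushforward \<mu> w) = sets borel"
  and space_path_pushforward [simp]: "space (path_pushforward \<mu> w) = UNIV"
  by (simp_all add: path_pushforward_def)

lemma measurable_path:
  fixes w :: "real \<Rightarrow> real"
  assumes "continuous_on {0..} w" "sets \<mu> = sets borel"
  shows "w \<in> borel_measurable (restrict_space \<mu> {0..})"
  using borel_measurable_continuous_on_restrict[OF assms(1)]
    measurable_cong_sets[OF sets_restrict_space_cong[OF assms(2)] refl] by blast

lemma finite_measure_path_pushforward:
  assumes "finite_measure \<mu>" "continuous_on {0..} w" "sets \<mu> = sets borel"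
  shows "finite_measure (path_pushforward \<mu> w)"
  unfolding path_pushforward_def using assms
  by (intro finite_measure.finite_measure_distr finite_measure_restrict_space measurable_path) auto

lemma integral_path_pushforward:
  fixes g :: "real \<Rightarrow> 'b::{banach, second_countable_topology}"
  assumes w: "continuous_on {0..} w" "sets \<mu> = sets borel" and g: "g \<in> borel_measurable borel"
  shows "(\<integral>x. g x \<partial>path_pushforward \<mu> w) = (\<integral>x. indicator {0..} x *\<^sub>R g (w x) \<partial>\<mu>)"
  unfolding path_pushforward_def using assms
  by (subst integral_distr[OF measurable_path[OF w] g]) (simp add: integral_restrict_space)

lemma emeasure_path_pushforward:
  assumes w: "continuous_on {0..} w" "sets \<mu> = sets borel" and B: "B \<in> sets borel"
  shows "emeasure (path_pushforward \<mu> w) B = emeasure \<mu> ({0..} \<inter> w -` B)"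
proof -
  have sp: "space (restrict_space \<mu> {0..}) = {0..}" 
    using sets_eq_imp_space_eq[OF w(2)] by (simp add: space_restrict_space)
  have "emeasure (path_pushforward \<mu> w) B = emeasure (restrict_space \<mu> {0..}) (w -` B \<inter> {0..})"
    unfolding path_pushforward_def by (subst emeasure_distr[OF measurable_path[OF w] B]) (simp add: sp)
  also have "\<dots> = emeasure \<mu> (w -` B \<inter> {0..})"
    using w(2) by (intro emeasure_restrict_space) auto
  finally show ?thesis by (simp add: Int_commute)
qed

lemma exp_fourier_eq: "exp (- 2 * pi * \<i> * x * \<xi>) = iexp ((- 2 * pi * \<xi>) * x)" for x \<xi> :: real
  by (simp add: mult_ac)

lemma norm_iexp_diff_le: "norm (iexp a - iexp b) \<le> \<bar>a - b\<bar>"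
proof -
  have "iexp a - iexp b = iexp b * (iexp (a - b) - 1)"
    by (simp add: algebra_simps flip: exp_add)
  then have "norm (iexp a - iexp b) = norm (iexp (a - b) - 1)"
    by (simp add: norm_mult)
  also have "\<dots> \<le> \<bar>a - b\<bar>"
    using iexp_approx1[of "a - b" 0] by simp
  finally show ?thesis .
qed

lemma fourier_measure_grid_limit:
  assumes "finite_measure \<mu>" and sets: "sets \<mu> = sets borel" and unit: "AE x in \<mu>. 0 \<le> x \<and> x \<le> 1"
    and w: "continuous_on {0..} w"
  shows "(\<lambda>N. \<Sum>j\<le>Suc N. of_real (measure \<mu> {real j * (1 / real (Suc N))..<real (Suc j) * (1 / real (Suc N))}) *
            iexp ((- 2 * pi * \<xi>) * w ((1 / real (Suc N)) * real j)))
         \<longlonglongrightarrow> fourier_measure (path_pushforward \<mu> w) \<xi>"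
proof -
  interpret finite_measure \<mu> by fact
  note [measurable_cong] = sets
  define h where "h N = 1 / real (Suc N)" for N
  have h: "0 < h N" for N by (simp add: h_def)
  let ?u = "- 2 * pi * \<xi>"
  let ?I = "\<lambda>N j. {real j * h N..<real (Suc j) * h N}"
  \<comment> \<open>The index runs up to \<open>Suc N\<close> because the cells are half-open: the
    point 1 is the left end of one further cell.\<close>
  define f where "f N x = (\<Sum>j\<le>Suc N. indicator (?I N j) x * iexp (?u * w (h N * real j)))" for N x
  have f_eq: "f N x = iexp (?u * w (h N * real j))" if "x \<in> ?I N j" "0 \<le> x" "x \<le> 1" for N x j
  proof -
    have "real j * h N \<le> 1" using that by simp
    then have "j \<le> Suc N" by (simp add: h_def field_simps)
    have "f N x = (\<Sum>i\<le>Suc N. if i = j then iexp (?u * w (h N * real j)) else 0)"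
      unfolding f_def
    proof (rule sum.cong[OF refl])
      fix i
      have "x \<notin> ?I N i" if "i \<noteq> j"
      proof
        assume "x \<in> ?I N i"
        then have "real i * h N < real (Suc j) * h N" "real j * h N < real (Suc i) * h N"
          using \<open>x \<in> ?I N j\<close> by auto
        then have "real i < real (Suc j)" "real j < real (Suc i)"
          using h[of N] by (auto simp: mult_less_cancel_right)
        then show False using that by simp
      qed
      then show "indicator (?I N i) x * iexp (?u * w (h N * real i)) = (if i = j then iexp (?u * w (h N * real j)) else 0)"
        using \<open>x \<in> ?I N j\<close> by (auto simp: indicator_def)
    qed
    then show ?thesis using \<open>j \<le> Suc N\<close> by simp
  qed
  have cell: "x \<in> ?I N (nat \<lfloor>x / h N\<rfloor>)" if "0 \<le> x" for x N
    using that h[of N] floor_divide_lower[of "h N" x] floor_divide_upper[of "h N" x] by (simp add: add.commute)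
  have lim: "(\<lambda>N. f N x) \<longlonglongrightarrow> indicator {0..} x *\<^sub>R iexp (?u * w x)" if x: "0 \<le> x" "x \<le> 1" for x
  proof -
    define t where "t N = h N * real (nat \<lfloor>x / h N\<rfloor>)" for N
    have t: "t N \<le> x" "x - h N \<le> t N" for N
      using cell[OF x(1), of N] by (auto simp: t_def algebra_simps)
    have h0: "h \<longlonglongrightarrow> 0" using LIMSEQ_inverse_real_of_nat by (simp add: h_def[abs_def] inverse_eq_divide)
    have "t \<longlonglongrightarrow> x"
    proof (rule tendsto_sandwich)
      show "(\<lambda>N. x - h N) \<longlonglongrightarrow> x" using tendsto_diff[OF tendsto_const h0] by simp
    qed (use t in auto)
    moreover have "t N \<in> {0..}" for N using h[of N] by (simp add: t_def)
    ultimately have "(\<lambda>N. w (t N)) \<longlonglongrightarrow> w x"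
      using w x by (intro continuous_on_tendsto_compose[OF w]) auto
    then have "(\<lambda>N. iexp (?u * w (t N))) \<longlonglongrightarrow> iexp (?u * w x)" by (intro tendsto_intros)
    moreover have "f N x = iexp (?u * w (t N))" for N
      using f_eq[OF cell[OF x(1)] x] by (simp add: t_def)
    ultimately show ?thesis using x by simp
  qed
  have bound: "norm (f N x) \<le> 1" for N x
  proof -
    have "norm (f N x) \<le> (\<Sum>j\<le>Suc N. norm (indicator (?I N j) x * iexp (?u * w (h N * real j))))"
      unfolding f_def by (rule norm_sum)
    also have "\<dots> = (\<Sum>j\<le>Suc N. indicator (?I N j) x)"
      by (intro sum.cong refl) (auto simp: norm_mult indicator_def)
    also have "\<dots> \<le> 1" unfolding sum_indicator_grid[OF h] by (auto simp: indicator_def)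
    finally show ?thesis .
  qed
  have fm: "f N \<in> borel_measurable \<mu>" for N
    unfolding f_def[abs_def] by measurable
  have wm: "(\<lambda>x. indicator {0..} x *\<^sub>R iexp (?u * w x)) \<in> borel_measurable \<mu>"
  proof -
    have "(\<lambda>x. indicator {0..} x *\<^sub>R iexp (?u * w x)) \<in> borel_measurable borel"
      using w by (intro borel_measurable_continuous_on_indicator continuous_intros) auto
    then show ?thesis by (simp add: measurable_cong_sets[OF sets refl])
  qed
  have "(\<lambda>N. \<integral>x. f N x \<partial>\<mu>) \<longlonglongrightarrow> (\<integral>x. indicator {0..} x *\<^sub>R iexp (?u * w x) \<partial>\<mu>)"
  proof (rule integral_dominated_convergence[where w = "\<lambda>_. 1"])
    show "AE x in \<mu>. (\<lambda>N. f N x) \<longlonglongrightarrow> indicator {0..} x *\<^sub>R iexp (?u * w x)"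
      using unit by eventually_elim (use lim in auto)
  qed (use bound wm fm in auto)
  moreover have "(\<integral>x. f N x \<partial>\<mu>) = (\<Sum>j\<le>Suc N. of_real (measure \<mu> (?I N j)) * iexp (?u * w (h N * real j)))" for N
  proof -
    have i: "integrable \<mu> (\<lambda>x. indicator (?I N j) x * iexp (?u * w (h N * real j)))" for j
      by (rule integrable_const_bound[where B = 1]) (auto simp: norm_mult indicator_def)
    have c: "(indicator (?I N j) x :: complex) = of_real (indicator (?I N j) x)" for j x
      by (simp add: indicator_def)
    have "(\<integral>x. f N x \<partial>\<mu>) = (\<Sum>j\<le>Suc N. \<integral>x. indicator (?I N j) x * iexp (?u * w (h N * real j)) \<partial>\<mu>)"
      unfolding f_def by (simp only: Bochner_Integration.integral_sum i)
    also have "\<dots> = (\<Sum>j\<le>Suc N. of_real (measure \<mu> (?I N j)) * iexp (?u * w (h N * real j)))"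
      by (intro sum.cong refl) (simp add: c sets del: of_nat_Suc)
    finally show ?thesis .
  qed
  moreover have "fourier_measure (path_pushforward \<mu> w) \<xi> = (\<integral>x. indicator {0..} x *\<^sub>R iexp (?u * w x) \<partial>\<mu>)"
    unfolding fourier_measure_def exp_fourier_eq by (rule integral_path_pushforward[OF w sets]) simp
  ultimately show ?thesis by (simp only: h_def)
qed

text \<open>Taking Z as the pointwise \<open>lim\<close> of the grid sums makes it a random variable
  for each \<xi>. On every continuous path it equals the transform for all \<xi> at once, so the
  exceptional null set does not depend on \<xi>.\<close>

lemma (in brownian_motion) fourier_moment_le:
  assumes N: "nonuniform_measure \<mu> s c K" and \<theta>: "0 < \<theta>" "\<theta> < 1"
  obtains Z :: "real \<Rightarrow> 'w \<Rightarrow> complex" and C where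
    "0 \<le> C" "\<And>\<xi>. Z \<xi> \<in> borel_measurable M"
    "AE \<omega> in M. \<forall>\<xi>. Z \<xi> \<omega> = fourier_measure (path_pushforward \<mu> (\<lambda>t. W t \<omega>)) \<xi>"
    "\<And>\<xi> q. \<xi> \<noteq> 0 \<Longrightarrow> (\<integral>\<^sup>+ \<omega>. ennreal (norm (Z \<xi> \<omega>) ^ (2 * q)) \<partial>M) \<le>
       ennreal (fact (2 * q) * (C * \<bar>\<xi>\<bar> powr (- 2 * \<theta> * s)) ^ q)"
proof -
  interpret N: nonuniform_measure \<mu> s c K by fact
  obtain C0 where C0: "0 \<le> C0" "\<And>T. 0 < T \<Longrightarrow>
    (\<integral>\<^sup>+ x. \<integral>\<^sup>+ y. ennreal (exp (- T * \<bar>x - y\<bar>)) \<partial>\<mu> \<partial>\<mu>) \<le> ennreal (C0 * T powr (- \<theta> * s))"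
    using N.nn_integral_exp_distance_le[OF \<theta>] by blast
  define h where "h n = 1 / real (Suc n)" for n
  have h: "0 < h n" for n by (simp add: h_def)
  define p where "p n j = measure \<mu> {real j * h n..<real (Suc j) * h n}" for n j
  define X where "X \<xi> n \<omega> = (\<Sum>j\<le>Suc n. of_real (p n j) * iexp ((- 2 * pi * \<xi>) * W (h n * real j) \<omega>))" for \<xi> n \<omega>
  define Z where "Z \<xi> \<omega> = lim (\<lambda>n. X \<xi> n \<omega>)" for \<xi> \<omega>
  have X_meas [measurable]: "X \<xi> n \<in> borel_measurable M" for \<xi> n
    unfolding X_def[abs_def] by measurable (simp add: less_imp_le[OF h])
  have Z_meas: "Z \<xi> \<in> borel_measurable M" for \<xi>
    unfolding Z_def[abs_def] by (rule borel_measurable_lim_metric) simp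
  have lim: "AE \<omega> in M. \<forall>\<xi>. (\<lambda>n. X \<xi> n \<omega>) \<longlonglongrightarrow> fourier_measure (path_pushforward \<mu> (\<lambda>t. W t \<omega>)) \<xi>"
    using continuous_paths
  proof eventually_elim
    fix \<omega> assume w: "continuous_on {0..} (\<lambda>t. W t \<omega>)"
    have "AE x in \<mu>. 0 \<le> x \<and> x \<le> 1" using N.AE_unit by eventually_elim auto
    from fourier_measure_grid_limit[OF N.finite_measure_axioms N.sets_eq this w]
    show "\<forall>\<xi>. (\<lambda>n. X \<xi> n \<omega>) \<longlonglongrightarrow> fourier_measure (path_pushforward \<mu> (\<lambda>t. W t \<omega>)) \<xi>"
      by (simp only: X_def p_def h_def) blast
  qed
  then have Z: "AE \<omega> in M. \<forall>\<xi>. Z \<xi> \<omega> = fourier_measure (path_pushforward \<mu> (\<lambda>t. W t \<omega>)) \<xi>"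
    by eventually_elim (simp add: Z_def limI)
  define C where "C = exp 1 * C0"
  have moment: "(\<integral>\<^sup>+ \<omega>. ennreal (norm (Z \<xi> \<omega>) ^ (2 * q)) \<partial>M) \<le>
       ennreal (fact (2 * q) * (C * \<bar>\<xi>\<bar> powr (- 2 * \<theta> * s)) ^ q)" if \<xi>: "\<xi> \<noteq> 0" for \<xi> q
  proof -
    \<comment> \<open>T is half the square of the angular frequency \<open>- 2 * pi * \<xi>\<close>,
      so that one grid increment with coefficient of modulus 1 contributes
      \<open>exp (- T * h n)\<close>.\<close>
    define T where "T = (- 2 * pi * \<xi>)\<^sup>2 / 2"
    have T: "0 < T" using \<xi> by (simp add: T_def)
    let ?B = "ennreal (fact (2 * q) * (C * \<bar>\<xi>\<bar> powr (- 2 * \<theta> * s)) ^ q)"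
    \<comment> \<open>From n \<ge> T on, \<open>T * h n \<le> 1\<close> and the discretisation loss
      is at most \<open>exp 1\<close>, the factor in C. Bounds for large n are enough for the limit
      inferior.\<close>
    have XB: "(\<integral>\<^sup>+ \<omega>. ennreal (norm (X \<xi> n \<omega>) ^ (2 * q)) \<partial>M) \<le> ?B" if n: "T \<le> real n" for n
    proof -
      define J where "J = (\<Sum>j\<le>Suc n. \<Sum>k\<in>{j..Suc n}. p n j * p n k * exp (- T * h n) ^ (k - j))"
      have p0: "0 \<le> p n k" for k by (simp add: p_def)
      have J0: "0 \<le> J" unfolding J_def by (intro sum_nonneg mult_nonneg_nonneg p0) simp_all
      have "ennreal J \<le> ennreal (exp (T * h n)) * (\<integral>\<^sup>+ x. \<integral>\<^sup>+ y. ennreal (exp (- T * \<bar>x - y\<bar>)) \<partial>\<mu> \<partial>\<mu>)"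
        unfolding J_def by (rule N.grid_energy_le[OF h T]) (rule p_def)
      also have "\<dots> \<le> ennreal (exp 1) * ennreal (C0 * T powr (- \<theta> * s))"
      proof (intro mult_mono C0(2)[OF T] ennreal_leI)
        show "exp (T * h n) \<le> exp 1" using n T by (simp add: h_def field_simps)
      qed auto
      also have "\<dots> = ennreal (C * T powr (- \<theta> * s))"
        using C0 by (simp add: C_def ennreal_mult[symmetric] mult_ac)
      finally have J1: "J \<le> C * T powr (- \<theta> * s)" using C0 by (simp add: C_def ennreal_le_iff)
      have "T powr (- \<theta> * s) \<le> (\<xi>\<^sup>2) powr (- \<theta> * s)"
      proof (rule powr_mono2')
        have "1 \<le> pi\<^sup>2" using pi_ge_two by (simp add: abs_le_square_iff[of 1, simplified])
        then show "\<xi>\<^sup>2 \<le> T" using mult_right_mono[of 1 "2 * pi\<^sup>2" "\<xi>\<^sup>2"] by (simp add: T_def power_mult_distrib)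
      qed (use \<xi> \<theta> N.s in auto)
      also have "(\<xi>\<^sup>2) powr (- \<theta> * s) = \<bar>\<xi>\<bar> powr (- 2 * \<theta> * s)"
      proof -
        have "\<xi>\<^sup>2 = \<bar>\<xi>\<bar> powr 2" using \<xi> by simp
        then show ?thesis by (simp only: powr_powr) (simp add: mult_ac)
      qed
      finally have J2: "J \<le> C * \<bar>\<xi>\<bar> powr (- 2 * \<theta> * s)"
        using J1 C0 by (smt (verit) C_def mult_left_mono exp_ge_zero mult_nonneg_nonneg)
      have "integrable M (\<lambda>\<omega>. norm (X \<xi> n \<omega>) ^ (2 * q))"
      proof (rule integrable_const_bound[where B = "(\<Sum>j\<le>Suc n. p n j) ^ (2 * q)"])
        have "norm (X \<xi> n \<omega>) \<le> (\<Sum>j\<le>Suc n. p n j)" for \<omega>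
          unfolding X_def by (rule sum_norm_le) (simp add: norm_mult p0)
        then show "AE \<omega> in M. norm (norm (X \<xi> n \<omega>) ^ (2 * q)) \<le> (\<Sum>j\<le>Suc n. p n j) ^ (2 * q)"
          by (intro AE_I2) (simp add: power_mono)
      qed simp
      then have "(\<integral>\<^sup>+ \<omega>. ennreal (norm (X \<xi> n \<omega>) ^ (2 * q)) \<partial>M) = ennreal (expectation (\<lambda>\<omega>. norm (X \<xi> n \<omega>) ^ (2 * q)))"
        by (rule nn_integral_eq_integral) simp
      also have "expectation (\<lambda>\<omega>. norm (X \<xi> n \<omega>) ^ (2 * q)) \<le> fact (2 * q) * J ^ q"
        using grid_moment_le[OF h, where p = "p n" and n = "Suc n" and u = "- 2 * pi * \<xi>" and q = q] p0
        by (simp add: X_def J_def T_def)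
      also have "\<dots> \<le> fact (2 * q) * (C * \<bar>\<xi>\<bar> powr (- 2 * \<theta> * s)) ^ q"
        using J0 J2 by (intro mult_left_mono power_mono) auto
      finally show ?thesis by (simp add: ennreal_leI)
    qed
    have "(\<integral>\<^sup>+ \<omega>. ennreal (norm (Z \<xi> \<omega>) ^ (2 * q)) \<partial>M) = (\<integral>\<^sup>+ \<omega>. liminf (\<lambda>n. ennreal (norm (X \<xi> n \<omega>) ^ (2 * q))) \<partial>M)"
    proof (rule nn_integral_cong_AE)
      show "AE \<omega> in M. ennreal (norm (Z \<xi> \<omega>) ^ (2 * q)) = liminf (\<lambda>n. ennreal (norm (X \<xi> n \<omega>) ^ (2 * q)))"
        using lim Z
      proof eventually_elim
        case (elim \<omega>)
        then have "(\<lambda>n. X \<xi> n \<omega>) \<longlonglongrightarrow> Z \<xi> \<omega>" by simp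
        then have "(\<lambda>n. ennreal (norm (X \<xi> n \<omega>) ^ (2 * q))) \<longlonglongrightarrow> ennreal (norm (Z \<xi> \<omega>) ^ (2 * q))"
          by (intro tendsto_ennrealI tendsto_intros)
        then show ?case by (rule lim_imp_Liminf[OF sequentially_bot, symmetric])
      qed
    qed
    also have "\<dots> \<le> liminf (\<lambda>n. \<integral>\<^sup>+ \<omega>. ennreal (norm (X \<xi> n \<omega>) ^ (2 * q)) \<partial>M)"
      by (rule nn_integral_liminf) simp
    also have "\<dots> \<le> liminf (\<lambda>n::nat. ?B)"
    proof (rule Liminf_mono)
      obtain m :: nat where m: "T \<le> real m" using real_arch_simple by blast
      then show "\<forall>\<^sub>F n in sequentially. (\<integral>\<^sup>+ \<omega>. ennreal (norm (X \<xi> n \<omega>) ^ (2 * q)) \<partial>M) \<le> ?B"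
        unfolding eventually_sequentially by (intro exI[of _ m] allI impI XB order_trans[OF m]) simp
    qed
    also have "\<dots> = ?B" by (rule Liminf_const) simp
    finally show ?thesis .
  qed
  show ?thesis
    by (rule that[of C Z]) (use C0 Z_meas Z moment in \<open>auto simp: C_def\<close>)
qed

lemma fourier_measure_uminus: "norm (fourier_measure \<nu> (- \<xi>)) = norm (fourier_measure \<nu> \<xi>)"
proof -
  have "fourier_measure \<nu> (- \<xi>) = (CLINT x|\<nu>. cnj (exp (- 2 * pi * \<i> * x * \<xi>)))"
    unfolding fourier_measure_def by (simp add: exp_cnj)
  also have "\<dots> = cnj (fourier_measure \<nu> \<xi>)"
    unfolding fourier_measure_def by (rule integral_bounded_linear'[OF bounded_linear_cnj bounded_linear_cnj]) simp
  finally show ?thesis by simp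
qed

text \<open>A continuous path is bounded on \<open>{0..1}\<close>, which bounds the dependence of
  the characters on the frequency. This lets countably many frequencies control all of them.\<close>

lemma fourier_measure_lipschitz:
  fixes \<mu> :: "real measure"
  assumes "finite_measure \<mu>" and sets: "sets \<mu> = sets borel" and unit: "AE x in \<mu>. 0 \<le> x \<and> x \<le> 1"
    and w: "continuous_on {0..} w"
  obtains L where "0 \<le> L" "\<And>\<xi> \<eta>. norm (fourier_measure (path_pushforward \<mu> w) \<xi> - fourier_measure (path_pushforward \<mu> w) \<eta>) \<le> L * \<bar>\<xi> - \<eta>\<bar>"
proof -
  interpret finite_measure \<mu> by fact
  have "compact (w ` {0..1})"
    by (intro compact_continuous_image continuous_on_subset[OF w]) auto
  then obtain R where R: "\<And>x. 0 \<le> x \<Longrightarrow> x \<le> 1 \<Longrightarrow> \<bar>w x\<bar> \<le> R"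
    by (force dest!: compact_imp_bounded simp: bounded_iff)
  have R0: "0 \<le> R" using R[of 0] by linarith
  let ?f = "\<lambda>\<xi> x. indicator {0..} x *\<^sub>R iexp ((- 2 * pi * \<xi>) * w x)"
  have F: "fourier_measure (path_pushforward \<mu> w) \<xi> = (\<integral>x. ?f \<xi> x \<partial>\<mu>)" for \<xi>
    unfolding fourier_measure_def exp_fourier_eq by (rule integral_path_pushforward[OF w sets]) simp
  have int: "integrable \<mu> (?f \<xi>)" for \<xi>
  proof (rule integrable_const_bound[where B = 1])
    have "(?f \<xi>) \<in> borel_measurable borel"
      using w by (intro borel_measurable_continuous_on_indicator continuous_intros) auto
    then show "?f \<xi> \<in> borel_measurable \<mu>" by (simp add: measurable_cong_sets[OF sets refl])
  qed (auto simp: indicator_def)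
  have "norm (fourier_measure (path_pushforward \<mu> w) \<xi> - fourier_measure (path_pushforward \<mu> w) \<eta>) \<le> (2 * pi * R * measure \<mu> (space \<mu>)) * \<bar>\<xi> - \<eta>\<bar>" for \<xi> \<eta>
  proof -
    have "norm (fourier_measure (path_pushforward \<mu> w) \<xi> - fourier_measure (path_pushforward \<mu> w) \<eta>) = norm (\<integral>x. ?f \<xi> x - ?f \<eta> x \<partial>\<mu>)"
      unfolding F by (subst Bochner_Integration.integral_diff[OF int int]) simp
    also have "\<dots> \<le> (\<integral>x. norm (?f \<xi> x - ?f \<eta> x) \<partial>\<mu>)" by (rule integral_norm_bound)
    also have "\<dots> \<le> (\<integral>x. 2 * pi * R * \<bar>\<xi> - \<eta>\<bar> \<partial>\<mu>)"
    proof (rule integral_mono_AE)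
      show "AE x in \<mu>. norm (?f \<xi> x - ?f \<eta> x) \<le> 2 * pi * R * \<bar>\<xi> - \<eta>\<bar>"
        using unit
      proof eventually_elim
        fix x :: real assume x: "0 \<le> x \<and> x \<le> 1"
        then have "norm (?f \<xi> x - ?f \<eta> x) \<le> \<bar>(- 2 * pi * \<xi>) * w x - (- 2 * pi * \<eta>) * w x\<bar>"
          using norm_iexp_diff_le[of "(- 2 * pi * \<xi>) * w x" "(- 2 * pi * \<eta>) * w x"] by simp
        also have "(- 2 * pi * \<xi>) * w x - (- 2 * pi * \<eta>) * w x = (2 * pi * w x) * (\<eta> - \<xi>)"
          by (simp add: algebra_simps)
        also have "\<bar>(2 * pi * w x) * (\<eta> - \<xi>)\<bar> = 2 * pi * \<bar>w x\<bar> * \<bar>\<xi> - \<eta>\<bar>"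
          by (simp add: abs_mult abs_minus_commute)
        also have "\<dots> \<le> 2 * pi * R * \<bar>\<xi> - \<eta>\<bar>"
          using R x by (intro mult_right_mono mult_left_mono) auto
        finally show "norm (?f \<xi> x - ?f \<eta> x) \<le> 2 * pi * R * \<bar>\<xi> - \<eta>\<bar>" .
      qed
    qed (use int in \<open>auto intro!: integrable_norm Bochner_Integration.integrable_diff\<close>)
    finally show ?thesis by (simp add: mult_ac)
  qed
  then show ?thesis using that[of "2 * pi * R * measure \<mu> (space \<mu>)"] R0 by simp
qed

text \<open>The points \<open>sqrt n\<close> have gaps of order \<open>1 / sqrt n\<close>, which a Lipschitz function does not
  notice at decay rates up to 1.\<close>

lemma decay_of_decay_at_sqrt:
  fixes F :: "real \<Rightarrow> complex"
  assumes L: "0 \<le> L" "\<And>\<xi> \<eta>. norm (F \<xi> - F \<eta>) \<le> L * \<bar>\<xi> - \<eta>\<bar>"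
    and even: "\<And>\<xi>. norm (F (- \<xi>)) = norm (F \<xi>)"
    and D: "0 \<le> D" "\<And>n. norm (F (sqrt (real (Suc n)))) \<le> D * sqrt (real (Suc n)) powr (- \<sigma>)"
    and \<sigma>: "0 \<le> \<sigma>" "\<sigma> \<le> 1" and \<xi>: "1 \<le> \<bar>\<xi>\<bar>"
  shows "norm (F \<xi>) \<le> (2 * D + L) * \<bar>\<xi>\<bar> powr (- \<sigma>)"
proof -
  define x where "x = \<bar>\<xi>\<bar>"
  have x: "1 \<le> x" using \<xi> by (simp add: x_def)
  have Fx: "norm (F \<xi>) = norm (F x)" using even[of \<xi>] by (auto simp: x_def abs_if)
  define m where "m = nat \<lfloor>x\<^sup>2\<rfloor> - 1"
  have x2: "1 \<le> x\<^sup>2" using x by simp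
  then have "1 \<le> \<lfloor>x\<^sup>2\<rfloor>" by linarith
  then have Sm: "real (Suc m) = of_int \<lfloor>x\<^sup>2\<rfloor>" by (simp add: m_def)
  define r where "r = sqrt (real (Suc m))"
  have r2: "r\<^sup>2 = real (Suc m)" by (simp add: r_def)
  have r1: "1 \<le> r" by (simp add: r_def)
  have r2x: "r\<^sup>2 \<le> x\<^sup>2" "x\<^sup>2 \<le> r\<^sup>2 + 1" unfolding r2 Sm by linarith+
  have rx: "r \<le> x" by (rule power2_le_imp_le[OF r2x(1)]) (use x in simp)
  \<comment> \<open>From \<open>x^2 - r^2 \<le> 1\<close> and x + r \<ge> x the gap is at most 1 /
    x, which is at most \<open>x powr (- \<sigma>)\<close> as \<sigma> \<le> 1.\<close>
  have "(x - r) * x \<le> (x - r) * (x + r)" using rx r1 by (intro mult_left_mono) auto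
  also have "\<dots> \<le> 1" using r2x by (simp add: power2_eq_square algebra_simps)
  finally have gap: "x - r \<le> 1 / x" using x by (simp add: field_simps)
  moreover have "1 / x \<le> 1" using x by simp
  ultimately have "x / 2 \<le> r" using r1 by linarith
  then have "r powr (- \<sigma>) \<le> (x / 2) powr (- \<sigma>)" using \<sigma> x by (intro powr_mono2') auto
  also have "\<dots> = 2 powr \<sigma> * x powr (- \<sigma>)" by (simp add: powr_divide powr_minus_divide)
  also have "\<dots> \<le> 2 powr 1 * x powr (- \<sigma>)" using \<sigma> by (intro mult_right_mono powr_mono) auto
  finally have rp: "r powr (- \<sigma>) \<le> 2 * x powr (- \<sigma>)" by simp
  have "1 / x = x powr (-1)" using x by (simp add: powr_minus_divide)
  also have "\<dots> \<le> x powr (- \<sigma>)" using x \<sigma> by (intro powr_mono) auto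
  finally have gp: "x - r \<le> x powr (- \<sigma>)" using gap by simp
  have "norm (F x) \<le> norm (F r) + norm (F x - F r)"
    by (metis add.commute diff_add_cancel norm_triangle_ineq)
  also have "\<dots> \<le> D * (2 * x powr (- \<sigma>)) + L * x powr (- \<sigma>)"
  proof (rule add_mono)
    have "norm (F r) \<le> D * r powr (- \<sigma>)" using D(2)[of m] by (simp add: r_def)
    also have "\<dots> \<le> D * (2 * x powr (- \<sigma>))" using rp D(1) by (intro mult_left_mono)
    finally show "norm (F r) \<le> D * (2 * x powr (- \<sigma>))" .
    have "norm (F x - F r) \<le> L * \<bar>x - r\<bar>" by (rule L(2))
    also have "\<dots> \<le> L * x powr (- \<sigma>)" using gp rx L(1) by (intro mult_left_mono) auto
    finally show "norm (F x - F r) \<le> L * x powr (- \<sigma>)" .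
  qed
  finally show ?thesis unfolding Fx by (simp add: x_def[symmetric] algebra_simps)
qed

text \<open>The moments at the frequencies \<open>sqrt (Suc n)\<close>, normalised by the desired
  decay, have a finite sum of expectations. Hence almost surely the series of normalised powers
  converges, and all its terms are bounded by its sum; this does the work of Chebyshev and
  Borel-Cantelli together.\<close>

lemma (in brownian_motion) fourier_decay_AE:
  assumes N: "nonuniform_measure \<mu> s c K" and \<sigma>: "0 < \<sigma>" "\<sigma> < s"
  shows "AE \<omega> in M. \<exists>C. \<forall>\<xi>. 1 \<le> \<bar>\<xi>\<bar> \<longrightarrow>
           norm (fourier_measure (path_pushforward \<mu> (\<lambda>t. W t \<omega>)) \<xi>) \<le> C * \<bar>\<xi>\<bar> powr (- \<sigma>)"
proof -
  interpret N: nonuniform_measure \<mu> s c K by fact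
  \<comment> \<open>\<open>\<theta> * s\<close> is the midpoint of \<sigma> and s. The surplus (s -
    \<sigma>) / 2 over the required decay, multiplied by q, is made at least 2, so the expectations
    are summable like \<open>1 / n^2\<close>.\<close>
  define \<theta> where "\<theta> = (\<sigma> + s) / (2 * s)"
  have \<theta>: "0 < \<theta>" "\<theta> < 1" using \<sigma> by (auto simp: \<theta>_def field_simps)
  have \<theta>s: "\<theta> * s = (\<sigma> + s) / 2" using N.s by (simp add: \<theta>_def)
  obtain Z C where C: "0 \<le> C" and Z_meas [measurable]: "\<And>\<xi>. Z \<xi> \<in> borel_measurable M"
    and Z: "AE \<omega> in M. \<forall>\<xi>. Z \<xi> \<omega> = fourier_measure (path_pushforward \<mu> (\<lambda>t. W t \<omega>)) \<xi>"
    and moment: "\<And>\<xi> q. \<xi> \<noteq> 0 \<Longrightarrow> (\<integral>\<^sup>+ \<omega>. ennreal (norm (Z \<xi> \<omega>) ^ (2 * q)) \<partial>M) \<le>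
       ennreal (fact (2 * q) * (C * \<bar>\<xi>\<bar> powr (- 2 * \<theta> * s)) ^ q)"
    by (rule fourier_moment_le[OF N \<theta>], rule that)
  define q where "q = Suc (nat \<lceil>4 / (s - \<sigma>)\<rceil>)"
  have "4 / (s - \<sigma>) \<le> real q" unfolding q_def by linarith
  then have q: "2 \<le> real q * ((s - \<sigma>) / 2)" using \<sigma> by (simp add: field_simps)
  let ?n = "\<lambda>n. real (Suc n)"
  define g where "g n \<omega> = norm (Z (sqrt (?n n)) \<omega>) ^ (2 * q) * ?n n powr (q * \<sigma>)" for n \<omega>
  define B where "B = fact (2 * q) * C ^ q"
  have B0: "0 \<le> B" using C by (simp add: B_def)
  have g_int: "(\<integral>\<^sup>+ \<omega>. ennreal (g n \<omega>) \<partial>M) \<le> ennreal (B * (1 / (?n n)\<^sup>2))" for n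
  proof -
    have "(\<integral>\<^sup>+ \<omega>. ennreal (g n \<omega>) \<partial>M) = (\<integral>\<^sup>+ \<omega>. ennreal (norm (Z (sqrt (?n n)) \<omega>) ^ (2 * q)) \<partial>M) * ennreal (?n n powr (q * \<sigma>))"
      unfolding g_def by (simp add: ennreal_mult nn_integral_multc)
    also have "\<dots> \<le> ennreal (fact (2 * q) * (C * \<bar>sqrt (?n n)\<bar> powr (- 2 * \<theta> * s)) ^ q) * ennreal (?n n powr (q * \<sigma>))"
      by (intro mult_right_mono moment) auto
    also have "\<dots> = ennreal (B * (?n n powr (- (\<theta> * s) * q) * ?n n powr (q * \<sigma>)))"
    proof -
      have "\<bar>sqrt (?n n)\<bar> powr (- 2 * \<theta> * s) = ?n n powr (- (\<theta> * s))"
        by (simp add: powr_half_sqrt[symmetric] powr_powr del: of_nat_Suc)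
      moreover have "(?n n powr (- (\<theta> * s))) ^ q = ?n n powr (- (\<theta> * s) * q)"
        by (simp add: powr_realpow[symmetric] powr_powr del: of_nat_Suc)
      ultimately show ?thesis using C
        by (simp add: B_def power_mult_distrib ennreal_mult[symmetric] mult_ac del: of_nat_Suc)
    qed
    also have "\<dots> \<le> ennreal (B * (1 / (?n n)\<^sup>2))"
    proof (intro ennreal_leI mult_left_mono B0)
      have "?n n powr (- (\<theta> * s) * q) * ?n n powr (q * \<sigma>) = ?n n powr (- (real q * ((s - \<sigma>) / 2)))"
        unfolding \<theta>s powr_add[symmetric] by (intro arg_cong2[where f = "(powr)"]) (auto simp: field_simps)
      also have "\<dots> \<le> ?n n powr (- 2)" using q by (intro powr_mono) auto
      also have "\<dots> = 1 / (?n n)\<^sup>2" by (simp add: powr_minus_divide del: of_nat_Suc)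
      finally show "?n n powr (- (\<theta> * s) * q) * ?n n powr (q * \<sigma>) \<le> 1 / (?n n)\<^sup>2" .
    qed
    finally show ?thesis .
  qed
  have g_meas: "(\<lambda>\<omega>. ennreal (g n \<omega>)) \<in> borel_measurable M" for n unfolding g_def by measurable
  have "(\<integral>\<^sup>+ \<omega>. (\<Sum>n. ennreal (g n \<omega>)) \<partial>M) = (\<Sum>n. \<integral>\<^sup>+ \<omega>. ennreal (g n \<omega>) \<partial>M)"
    by (rule nn_integral_suminf[OF g_meas])
  also have "\<dots> \<le> (\<Sum>n. ennreal (B * (1 / (?n n)\<^sup>2)))" by (intro suminf_le g_int) auto
  also have "\<dots> = ennreal (\<Sum>n. B * (1 / (?n n)\<^sup>2))"
  proof (intro suminf_ennreal2 summable_mult)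
    have "summable (\<lambda>n. 1 / (real n)\<^sup>2)" using inverse_power_summable[of 2, where ?'a = real] by (simp add: inverse_eq_divide)
    then show "summable (\<lambda>n. 1 / (?n n)\<^sup>2)" by (subst (asm) summable_Suc_iff[symmetric])
  qed (use B0 in auto)
  finally have "(\<integral>\<^sup>+ \<omega>. (\<Sum>n. ennreal (g n \<omega>)) \<partial>M) \<noteq> \<infinity>" by (auto simp: top_unique)
  then have fin: "AE \<omega> in M. (\<Sum>n. ennreal (g n \<omega>)) \<noteq> \<infinity>"
    by (intro nn_integral_PInf_AE) (use g_meas in auto)
  show ?thesis
    using fin Z continuous_paths
  proof eventually_elim
    case (elim \<omega>)
    let ?F = "fourier_measure (path_pushforward \<mu> (\<lambda>t. W t \<omega>))"
    have unit: "AE x in \<mu>. 0 \<le> x \<and> x \<le> 1" using N.AE_unit by eventually_elim auto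
    obtain L where L: "0 \<le> L" "\<And>\<xi> \<eta>. norm (?F \<xi> - ?F \<eta>) \<le> L * \<bar>\<xi> - \<eta>\<bar>"
      using fourier_measure_lipschitz[OF N.finite_measure_axioms N.sets_eq unit elim(3)] by blast
    define S where "S = enn2real (\<Sum>n. ennreal (g n \<omega>))"
    have S: "(\<Sum>n. ennreal (g n \<omega>)) = ennreal S" "0 \<le> S" using elim(1) by (auto simp: S_def less_top)
    \<comment> \<open>The maximum with 1 ensures \<open>D \<le> D ^ (2 * q)\<close>, so that powers
      can be compared and no root has to be extracted.\<close>
    define D where "D = max 1 S"
    have D: "norm (?F (sqrt (?n n))) \<le> D * sqrt (?n n) powr (- \<sigma>)" for n
    proof -
      have "ennreal (g n \<omega>) \<le> ennreal S" using term_le_suminf_ennreal[of "\<lambda>n. ennreal (g n \<omega>)" n] S by simp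
      then have gS: "g n \<omega> \<le> S" using S(2) by (simp add: ennreal_le_iff)
      have "(norm (?F (sqrt (?n n))) * sqrt (?n n) powr \<sigma>) ^ (2 * q) = g n \<omega>"
      proof -
        have "(sqrt (?n n) powr \<sigma>) ^ (2 * q) = ?n n powr (q * \<sigma>)"
          by (simp add: powr_half_sqrt[symmetric] powr_powr powr_realpow[symmetric] mult_ac del: of_nat_Suc)
        then show ?thesis using elim(2) by (simp add: g_def power_mult_distrib del: of_nat_Suc)
      qed
      also have "\<dots> \<le> D" using gS by (simp add: D_def)
      also have "\<dots> \<le> D ^ (2 * q)" by (intro self_le_power) (auto simp: D_def q_def)
      finally have "norm (?F (sqrt (?n n))) * sqrt (?n n) powr \<sigma> \<le> D"
        by (subst (asm) power_mono_iff) (auto simp: D_def q_def)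
      then show ?thesis by (simp add: powr_minus_divide field_simps del: of_nat_Suc)
    qed
    have D0: "0 \<le> D" by (simp add: D_def)
    have s1: "0 \<le> \<sigma>" "\<sigma> \<le> 1" using \<sigma> N.s by auto
    show ?case
      using decay_of_decay_at_sqrt[OF L fourier_measure_uminus D0 D s1] by blast
  qed
qed

section \<open>Hoelder continuity of the paths\<close>

text \<open>Chaining: each point is approximated by its left dyadic neighbours \<open>t n x\<close>,
  whose values change by at most one increment per generation, so the errors form a geometric
  series. Two points at distance about \<open>(1/2) ^ n\<close> have equal or adjacent neighbours of
  generation n. Continuity carries the estimate from dyadic to arbitrary times.\<close>

lemma holder_of_dyadic_increments:
  fixes w :: "real \<Rightarrow> real"
  assumes w: "continuous_on {0..} w" and C: "0 \<le> C" and \<alpha>: "0 < \<alpha>"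
    and incr: "\<And>n k. k < 2 ^ n \<Longrightarrow> \<bar>w (real (Suc k) / 2 ^ n) - w (real k / 2 ^ n)\<bar> \<le> C * (2 powr (- \<alpha>)) ^ n"
  obtains D where "0 \<le> D" "\<And>x y. 0 \<le> x \<Longrightarrow> x \<le> 1 \<Longrightarrow> 0 \<le> y \<Longrightarrow> y \<le> 1 \<Longrightarrow> \<bar>w x - w y\<bar> \<le> D * \<bar>x - y\<bar> powr \<alpha>"
proof -
  define r where "r = (2::real) powr (- \<alpha>)"
  have r: "0 < r" "r < 1" using \<alpha> by (auto simp: r_def powr_minus_divide)
  define t where "t n x = real (nat \<lfloor>2 ^ n * x\<rfloor>) / 2 ^ n" for n and x :: real
  have t_le: "t n x \<le> x" "x - (1/2) ^ n \<le> t n x" "0 \<le> t n x" if "0 \<le> x" for n x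
  proof -
    have "real (nat \<lfloor>2 ^ n * x\<rfloor>) \<le> 2 ^ n * x" "2 ^ n * x - 1 \<le> real (nat \<lfloor>2 ^ n * x\<rfloor>)" using that by auto
    moreover have "a / 2 ^ n \<le> x \<and> x - (1/2) ^ n \<le> a / 2 ^ n" if "a \<le> 2 ^ n * x" "2 ^ n * x - 1 \<le> a" for a :: real
    proof
      show "a / 2 ^ n \<le> x" using that by (simp add: field_simps)
      have "x - (1/2) ^ n = (2 ^ n * x - 1) / 2 ^ n" by (simp add: power_one_over diff_divide_distrib)
      then show "x - (1/2) ^ n \<le> a / 2 ^ n" using divide_right_mono[OF that(2), of "2 ^ n"] by simp
    qed
    ultimately show "t n x \<le> x" "x - (1/2) ^ n \<le> t n x" "0 \<le> t n x" unfolding t_def by simp_all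
  qed
  have t_lim: "(\<lambda>n. w (t n x)) \<longlonglongrightarrow> w x" if x: "0 \<le> x" for x
  proof (rule continuous_on_tendsto_compose[OF w])
    show "(\<lambda>n. t n x) \<longlonglongrightarrow> x"
    proof (rule tendsto_sandwich)
      have "(\<lambda>n. (1/2::real) ^ n) \<longlonglongrightarrow> 0" by (rule LIMSEQ_power_zero) simp
      then show "(\<lambda>n. x - (1/2) ^ n) \<longlonglongrightarrow> x" using tendsto_diff[OF tendsto_const] by fastforce
    qed (use t_le[OF x] in auto)
  qed (use x t_le[OF x] in auto)
  have refine: "\<bar>w (t (Suc n) x) - w (t n x)\<bar> \<le> C * r ^ Suc n" if x: "0 \<le> x" "x \<le> 1" for n x
  proof -
    define k where "k = nat \<lfloor>2 ^ n * x\<rfloor>"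
    define l where "l = nat \<lfloor>2 ^ Suc n * x\<rfloor>"
    have "real k \<le> 2 ^ n * x" "2 ^ n * x < real k + 1" "real l \<le> 2 ^ Suc n * x" "2 ^ Suc n * x < real l + 1"
      using x by (auto simp: k_def l_def)
    then have "real l < real (2 * k + 2)" "real (2 * k) < real l + 1" by auto
    \<comment> \<open>Halving the mesh leaves the left neighbour in place or moves it by exactly one
      cell of the new generation.\<close>
    then have l: "l = 2 * k \<or> l = Suc (2 * k)" by linarith
    have tk: "t n x = real (2 * k) / 2 ^ Suc n" by (simp add: t_def k_def)
    have tl: "t (Suc n) x = real l / 2 ^ Suc n" by (simp only: t_def l_def)
    from l show ?thesis
    proof
      assume "l = 2 * k"
      then show ?thesis unfolding tk tl using C r by simp
    next
      assume l: "l = Suc (2 * k)"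
      have "real l \<le> 2 ^ Suc n * x" by fact
      also have "\<dots> \<le> 2 ^ Suc n" using x by simp
      finally have "l \<le> 2 ^ Suc n" by (metis of_nat_le_iff of_nat_numeral of_nat_power)
      then show ?thesis unfolding tk tl l using incr[of "2 * k" "Suc n"] l by (simp only: r_def)
    qed
  qed
  have chain: "\<bar>w (t (n + m) x) - w (t n x)\<bar> \<le> C * r ^ n / (1 - r)" if x: "0 \<le> x" "x \<le> 1" for n m x
  proof -
    have "\<bar>w (t (n + m) x) - w (t n x)\<bar> \<le> (\<Sum>i<m. C * r ^ Suc (n + i))"
    proof (induction m)
      case (Suc m)
      then show ?case using refine[OF x, of "n + m"] by simp
    qed simp
    also have "\<dots> = C * r ^ Suc n * (\<Sum>i<m. r ^ i)" by (simp add: sum_distrib_left power_add mult_ac)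
    also have "(\<Sum>i<m. r ^ i) \<le> (\<Sum>i. r ^ i)" using r by (intro sum_le_suminf summable_geometric) auto
    also have "(\<Sum>i. r ^ i) = 1 / (1 - r)" using r by (intro suminf_geometric) auto
    finally have "\<bar>w (t (n + m) x) - w (t n x)\<bar> \<le> C * r ^ Suc n * (1 / (1 - r))"
      using C r by (simp add: mult_left_mono)
    also have "\<dots> \<le> C * r ^ n * (1 / (1 - r))"
      using C r by (intro mult_right_mono mult_left_mono power_decreasing) auto
    finally show ?thesis by simp
  qed
  have approx: "\<bar>w x - w (t n x)\<bar> \<le> C * r ^ n / (1 - r)" if x: "0 \<le> x" "x \<le> 1" for n x
  proof (rule LIMSEQ_le_const2)
    show "(\<lambda>m. \<bar>w (t (m + n) x) - w (t n x)\<bar>) \<longlonglongrightarrow> \<bar>w x - w (t n x)\<bar>"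
      by (intro tendsto_intros LIMSEQ_ignore_initial_segment t_lim x)
    show "\<exists>N. \<forall>m\<ge>N. \<bar>w (t (m + n) x) - w (t n x)\<bar> \<le> C * r ^ n / (1 - r)"
      using chain[OF x, of n] by (auto simp: add.commute)
  qed
  \<comment> \<open>Two chains and one increment between the neighbours; the factor 1 / r passes
    from \<open>r ^ n\<close> to \<open>r ^ Suc n\<close>, since the distance is known to exceed
    only \<open>(1/2) ^ Suc n\<close>.\<close>
  define D where "D = (2 * C / (1 - r) + C) * (1 / r)"
  have D0: "0 \<le> D" using C r by (simp add: D_def)
  have main: "\<bar>w x - w y\<bar> \<le> D * \<bar>x - y\<bar> powr \<alpha>" if xy: "0 \<le> x" "x < y" "y \<le> 1" for x y
  proof -
    obtain n where n1: "(1/2) ^ Suc n < y - x" and n2: "y - x \<le> (1/2) ^ n"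
      using dyadic_scale[of "y - x"] xy by auto
    define k where "k = nat \<lfloor>2 ^ n * x\<rfloor>"
    define l where "l = nat \<lfloor>2 ^ n * y\<rfloor>"
    have k: "real k \<le> 2 ^ n * x" "2 ^ n * x < real k + 1" "real l \<le> 2 ^ n * y" "2 ^ n * y < real l + 1"
      using xy by (auto simp: k_def l_def)
    have "2 ^ n * y \<le> 2 ^ n * x + 1" using n2 by (simp add: field_simps)
    then have "real l < real k + 2" using k by linarith
    moreover have "2 ^ n * x < 2 ^ n * y" using xy by simp
    then have "real k < real l + 1" using k by linarith
    ultimately have kl: "l = k \<or> l = Suc k" by linarith
    have tt: "t n x = real k / 2 ^ n" "t n y = real l / 2 ^ n" by (simp_all only: t_def k_def l_def)
    have mid: "\<bar>w (t n x) - w (t n y)\<bar> \<le> C * r ^ n"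
      using kl
    proof
      assume "l = k" then show ?thesis unfolding tt using C r by simp
    next
      assume l: "l = Suc k"
      have "real l \<le> 2 ^ n * y" by fact
      also have "\<dots> \<le> 2 ^ n" using xy by simp
      finally have "l \<le> 2 ^ n" by (metis of_nat_le_iff of_nat_numeral of_nat_power)
      then show ?thesis unfolding tt l using incr[of k n] l by (simp only: r_def abs_minus_commute)
    qed
    have "\<bar>w x - w y\<bar> \<le> \<bar>w x - w (t n x)\<bar> + \<bar>w (t n x) - w (t n y)\<bar> + \<bar>w y - w (t n y)\<bar>" by linarith
    also have "\<dots> \<le> C * r ^ n / (1 - r) + C * r ^ n + C * r ^ n / (1 - r)"
      using xy by (intro add_mono mid approx) auto
    also have "\<dots> = (2 * C / (1 - r) + C) * r ^ n" by (simp add: distrib_right mult.assoc)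
    also have "\<dots> = D * r ^ Suc n" using r by (simp add: D_def)
    also have "r ^ Suc n = ((1/2) ^ Suc n) powr \<alpha>"
    proof -
      have rr: "r = (1/2) powr \<alpha>" by (simp add: r_def powr_minus_divide powr_divide)
      have "r ^ Suc n = r powr real (Suc n)" using r(1) by (rule powr_realpow[symmetric])
      also have "\<dots> = ((1/2) powr real (Suc n)) powr \<alpha>" unfolding rr powr_powr by (simp only: mult.commute)
      also have "(1/2::real) powr real (Suc n) = (1/2) ^ Suc n" by (rule powr_realpow) simp
      finally show ?thesis .
    qed
    also have "D * ((1/2) ^ Suc n) powr \<alpha> \<le> D * \<bar>x - y\<bar> powr \<alpha>"
      using n1 xy \<alpha> D0 by (intro mult_left_mono powr_mono2) auto
    finally show ?thesis .
  qed
  show ?thesis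
  proof (rule that[OF D0])
    fix x y :: real assume "0 \<le> x" "x \<le> 1" "0 \<le> y" "y \<le> 1"
    then show "\<bar>w x - w y\<bar> \<le> D * \<bar>x - y\<bar> powr \<alpha>"
      using main[of x y] main[of y x] by (cases x y rule: linorder_cases) (auto simp: abs_minus_commute)
  qed
qed

lemma (in brownian_motion) increment_moment:
  assumes ut: "0 \<le> u" "u < t"
  shows "(\<integral>\<^sup>+ \<omega>. ennreal (\<bar>W t \<omega> - W u \<omega>\<bar> ^ (2 * q)) \<partial>M) = ennreal (fact (2 * q) / (2 ^ q * fact q) * (t - u) ^ q)"
proof -
  let ?\<sigma> = "sqrt (t - u)"
  have \<sigma>: "0 < ?\<sigma>" using ut by simp
  have D: "distributed M lborel (\<lambda>\<omega>. W t \<omega> - W u \<omega>) (normal_density 0 ?\<sigma>)"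
    using ut by (rule normal_increments)
  have "(\<integral>\<^sup>+ \<omega>. ennreal (\<bar>W t \<omega> - W u \<omega>\<bar> ^ (2 * q)) \<partial>M) = (\<integral>\<^sup>+ x. ennreal (normal_density 0 ?\<sigma> x) * ennreal (\<bar>x\<bar> ^ (2 * q)) \<partial>lborel)"
    by (rule distributed_nn_integral[OF D, symmetric]) simp
  also have "\<dots> = (\<integral>\<^sup>+ x. ennreal (normal_density 0 ?\<sigma> x * (x - 0) ^ (2 * q)) \<partial>lborel)"
    by (simp add: ennreal_mult power_even_abs)
  also have "\<dots> = ennreal (fact (2 * q) / ((2 / ?\<sigma>\<^sup>2) ^ q * fact q))"
    using normal_moment_even[OF \<sigma>, of 0 q]
    by (subst nn_integral_eq_integral) (auto simp: has_bochner_integral_iff)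
  also have "(2 / ?\<sigma>\<^sup>2) ^ q = 2 ^ q / (t - u) ^ q" using ut by (simp add: power_divide)
  finally show ?thesis by simp
qed

text \<open>Kolmogorov--Chentsov: the exponent \<open>q\<close> is chosen with \<open>q (1 - 2 \<alpha>) \<ge> 2\<close>, so that the expected
  normalised moments over the \<open>2^n\<close> dyadic increments of generation \<open>n\<close> sum to at most a multiple of \<open>2^-n\<close>.\<close>

lemma (in brownian_motion) holder_AE:
  assumes \<alpha>: "0 < \<alpha>" "\<alpha> < 1/2"
  shows "AE \<omega> in M. \<exists>D\<ge>0. \<forall>x\<in>{0..1}. \<forall>y\<in>{0..1}. \<bar>W x \<omega> - W y \<omega>\<bar> \<le> D * \<bar>x - y\<bar> powr \<alpha>"
proof -
  define q where "q = Suc (nat \<lceil>2 / (1 - 2 * \<alpha>)\<rceil>)"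
  have "2 / (1 - 2 * \<alpha>) \<le> real q" unfolding q_def by linarith
  then have q: "2 \<le> real q * (1 - 2 * \<alpha>)" using \<alpha> by (simp add: field_simps)
  define B :: real where "B = fact (2 * q) / (2 ^ q * fact q)"
  have B0: "0 \<le> B" by (simp add: B_def)
  define R where "R = (2::real) powr \<alpha>"
  have R0: "0 < R" by (simp add: R_def)
  define g where "g n \<omega> = (\<Sum>k<2^n. \<bar>W (real (Suc k) / 2 ^ n) \<omega> - W (real k / 2 ^ n) \<omega>\<bar> ^ (2 * q)) * (R ^ n) ^ (2 * q)" for n :: nat and \<omega>
  have W_meas [measurable]: "(\<lambda>\<omega>. W (real k / 2 ^ n) \<omega>) \<in> borel_measurable M" for k n :: nat
    by (rule random_variable_W) simp
  have g_meas: "(\<lambda>\<omega>. ennreal (g n \<omega>)) \<in> borel_measurable M" for n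
    unfolding g_def by measurable
  have g_int: "(\<integral>\<^sup>+ \<omega>. ennreal (g n \<omega>) \<partial>M) \<le> ennreal (B * (1/2) ^ n)" for n
  proof -
    have "(\<integral>\<^sup>+ \<omega>. ennreal (g n \<omega>) \<partial>M) = (\<Sum>k<2^n. \<integral>\<^sup>+ \<omega>. ennreal (\<bar>W (real (Suc k) / 2 ^ n) \<omega> - W (real k / 2 ^ n) \<omega>\<bar> ^ (2 * q)) \<partial>M) * ennreal ((R ^ n) ^ (2 * q))"
      unfolding g_def using R0
      by (simp add: ennreal_mult sum_nonneg nn_integral_multc nn_integral_sum flip: sum_ennreal del: of_nat_Suc)
    also have "\<dots> = (\<Sum>k<(2::nat)^n. ennreal (B * (1 / 2 ^ n) ^ q)) * ennreal ((R ^ n) ^ (2 * q))"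
    proof (rule arg_cong2[where f = "(*)", OF sum.cong[OF refl] refl])
      fix k
      have eq: "real (Suc k) / 2 ^ n - real k / 2 ^ n = 1 / 2 ^ n" by (simp add: field_simps)
      have "(\<integral>\<^sup>+ \<omega>. ennreal (\<bar>W (real (Suc k) / 2 ^ n) \<omega> - W (real k / 2 ^ n) \<omega>\<bar> ^ (2 * q)) \<partial>M) = ennreal (B * (real (Suc k) / 2 ^ n - real k / 2 ^ n) ^ q)"
        unfolding B_def by (rule increment_moment) (auto simp: divide_strict_right_mono)
      then show "(\<integral>\<^sup>+ \<omega>. ennreal (\<bar>W (real (Suc k) / 2 ^ n) \<omega> - W (real k / 2 ^ n) \<omega>\<bar> ^ (2 * q)) \<partial>M) = ennreal (B * (1 / 2 ^ n) ^ q)"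
        unfolding eq .
    qed
    also have "\<dots> = ennreal (2 ^ n * (B * (1 / 2 ^ n) ^ q) * (R ^ n) ^ (2 * q))"
    proof -
      have "(\<Sum>k<(2::nat)^n. ennreal (B * (1 / 2 ^ n) ^ q)) = ennreal (\<Sum>k<(2::nat)^n. B * (1 / 2 ^ n) ^ q)"
        using B0 by (intro sum_ennreal) auto
      then show ?thesis using B0 R0 by (simp add: ennreal_mult)
    qed
    also have "2 ^ n * (B * (1 / 2 ^ n) ^ q) * (R ^ n) ^ (2 * q) = B * (2 * (1/2) ^ q * R ^ (2 * q)) ^ n"
      by (simp add: power_mult_distrib power_divide mult_ac flip: power_mult)
    \<comment> \<open>The exponent collects 1 from the number of increments, - q from their variance
      and \<open>2 * \<alpha> * q\<close> from the normalisation; the choice of q makes it at most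
      -1.\<close>
    also have "2 * (1/2) ^ q * R ^ (2 * q) = 2 powr (1 - real q * (1 - 2 * \<alpha>))"
    proof -
      have "(1/2::real) ^ q = 2 powr (- real q)" by (simp add: powr_minus_divide powr_realpow power_divide)
      moreover have "R ^ (2 * q) = 2 powr (\<alpha> * real (2 * q))"
        unfolding R_def by (subst powr_realpow[symmetric]) (simp_all add: powr_powr)
      ultimately have "2 * (1/2) ^ q * R ^ (2 * q) = 2 powr 1 * 2 powr (- real q) * 2 powr (\<alpha> * real (2 * q))" by simp
      also have "\<dots> = 2 powr (1 + - real q + \<alpha> * real (2 * q))" by (simp only: powr_add)
      finally show ?thesis by (simp add: algebra_simps)
    qed
    also have "ennreal (B * (2 powr (1 - real q * (1 - 2 * \<alpha>))) ^ n) \<le> ennreal (B * (2 powr (-1)) ^ n)"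
      using q B0 by (intro ennreal_leI mult_left_mono power_mono powr_mono) auto
    finally show ?thesis by (simp add: powr_minus_divide)
  qed
  have "(\<integral>\<^sup>+ \<omega>. (\<Sum>n. ennreal (g n \<omega>)) \<partial>M) = (\<Sum>n. \<integral>\<^sup>+ \<omega>. ennreal (g n \<omega>) \<partial>M)"
    by (rule nn_integral_suminf[OF g_meas])
  also have "\<dots> \<le> (\<Sum>n. ennreal (B * (1/2) ^ n))" by (intro suminf_le g_int) auto
  also have "\<dots> = ennreal (\<Sum>n. B * (1/2) ^ n)"
    using B0 by (intro suminf_ennreal2 summable_mult summable_geometric) auto
  finally have "(\<integral>\<^sup>+ \<omega>. (\<Sum>n. ennreal (g n \<omega>)) \<partial>M) \<noteq> \<infinity>" by (auto simp: top_unique)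
  then have fin: "AE \<omega> in M. (\<Sum>n. ennreal (g n \<omega>)) \<noteq> \<infinity>"
    by (intro nn_integral_PInf_AE) (use g_meas in auto)
  show ?thesis
    using fin continuous_paths
  proof eventually_elim
    case (elim \<omega>)
    define S where "S = enn2real (\<Sum>n. ennreal (g n \<omega>))"
    have S: "(\<Sum>n. ennreal (g n \<omega>)) = ennreal S" "0 \<le> S" using elim(1) by (auto simp: S_def less_top)
    define D where "D = max 1 S"
    have incr: "\<bar>W (real (Suc k) / 2 ^ n) \<omega> - W (real k / 2 ^ n) \<omega>\<bar> \<le> D * (2 powr (- \<alpha>)) ^ n" if k: "k < 2 ^ n" for n k
    proof -
      let ?d = "\<lambda>k. \<bar>W (real (Suc k) / 2 ^ n) \<omega> - W (real k / 2 ^ n) \<omega>\<bar>"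
      have "ennreal (g n \<omega>) \<le> ennreal S" using term_le_suminf_ennreal[of "\<lambda>n. ennreal (g n \<omega>)" n] S by simp
      then have gS: "g n \<omega> \<le> S" using S(2) by (simp add: ennreal_le_iff)
      have "(?d k * R ^ n) ^ (2 * q) = ?d k ^ (2 * q) * (R ^ n) ^ (2 * q)" by (rule power_mult_distrib)
      also have "\<dots> \<le> g n \<omega>" unfolding g_def
        using R0 k by (intro mult_right_mono member_le_sum) auto
      also have "\<dots> \<le> D" using gS by (simp add: D_def)
      also have "\<dots> \<le> D ^ (2 * q)" by (intro self_le_power) (auto simp: D_def q_def)
      finally have "?d k * R ^ n \<le> D"
        using R0 by (subst (asm) power_mono_iff) (auto simp: D_def q_def)
      then show ?thesis using R0 unfolding powr_minus R_def[symmetric] power_inverse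
        by (simp add: field_simps del: of_nat_Suc)
    qed
    have "0 \<le> D" by (simp add: D_def)
    from holder_of_dyadic_increments[OF elim(2) this \<alpha>(1) incr]
    obtain D' where "0 \<le> D'" "\<And>x y. 0 \<le> x \<Longrightarrow> x \<le> 1 \<Longrightarrow> 0 \<le> y \<Longrightarrow> y \<le> 1 \<Longrightarrow> \<bar>W x \<omega> - W y \<omega>\<bar> \<le> D' * \<bar>x - y\<bar> powr \<alpha>"
      by metis
    then show ?case by (intro exI[of _ D']) auto
  qed
qed

section \<open>Hausdorff dimension\<close>

lemma hausdorff_premeasure_le_measure: "0 < \<delta> \<Longrightarrow> hausdorff_premeasure \<delta> t S \<le> hausdorff_measure t S"
  unfolding hausdorff_measure_def by (rule SUP_upper) simp

lemma diam_powr_holder_image: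
  fixes f :: "'a::metric_space \<Rightarrow> 'b::metric_space"
  assumes holder: "\<And>x y. x \<in> U \<Longrightarrow> y \<in> U \<Longrightarrow> dist (f x) (f y) \<le> C * dist x y powr \<alpha>"
    and C: "0 \<le> C" and \<alpha>: "0 < \<alpha>" and t: "0 < t" and U: "bounded U"
  shows "bounded (f ` U)" "diameter (f ` U) \<le> C * diameter U powr \<alpha>"
    "diam_powr (t / \<alpha>) (f ` U) \<le> ennreal (C powr (t / \<alpha>)) * diam_powr t U"
proof -
  have le: "dist (f x) (f y) \<le> C * diameter U powr \<alpha>" if "x \<in> U" "y \<in> U" for x y
  proof -
    have "dist x y powr \<alpha> \<le> diameter U powr \<alpha>"
      using diameter_bounded_bound[OF U that] \<alpha> by (intro powr_mono2) auto
    then show ?thesis using holder[OF that] C by (meson mult_left_mono order_trans)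
  qed
  show "bounded (f ` U)"
    unfolding bounded_two_points using le by (intro exI[of _ "C * diameter U powr \<alpha>"]) auto
  show diam: "diameter (f ` U) \<le> C * diameter U powr \<alpha>"
  proof (cases "U = {}")
    case False
    then show ?thesis unfolding diameter_def[of "f ` U"] using le by (auto intro!: cSUP_least)
  qed (use C in simp)
  have "diameter (f ` U) powr (t / \<alpha>) \<le> (C * diameter U powr \<alpha>) powr (t / \<alpha>)"
    using diam \<alpha> t \<open>bounded (f ` U)\<close> by (intro powr_mono2) (auto intro: diameter_ge_0)
  also have "\<dots> = C powr (t / \<alpha>) * diameter U powr t"
    using C \<alpha> diameter_ge_0[OF U] by (simp add: powr_mult powr_powr)
  finally show "diam_powr (t / \<alpha>) (f ` U) \<le> ennreal (C powr (t / \<alpha>)) * diam_powr t U"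
    using t \<alpha> by (auto simp: diam_powr_def ennreal_mult[symmetric] ennreal_leI)
qed

lemma hausdorff_measure_holder_image:
  fixes f :: "'a::metric_space \<Rightarrow> 'b::metric_space"
  assumes holder: "\<And>x y. x \<in> S \<Longrightarrow> y \<in> S \<Longrightarrow> dist (f x) (f y) \<le> C * dist x y powr \<alpha>"
    and C: "0 \<le> C" and \<alpha>: "0 < \<alpha>" and t: "0 < t" and null: "hausdorff_measure t S = 0"
  shows "hausdorff_measure (t / \<alpha>) (f ` S) = 0"
proof -
  have "hausdorff_premeasure \<delta> (t / \<alpha>) (f ` S) \<le> 0" if \<delta>: "0 < \<delta>" for \<delta>
  proof (rule ennreal_le_epsilon)
    fix e :: real assume e: "0 < e"
    \<comment> \<open>Chosen so that \<open>C * \<delta>' powr \<alpha> \<le> \<delta>\<close>.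
      Using C + 1 avoids a division by 0; \<eta> adds 1 for the same reason.\<close>
    define \<delta>' where "\<delta>' = (\<delta> / (C + 1)) powr (1 / \<alpha>)"
    have \<delta>': "0 < \<delta>'" using \<delta> C by (simp add: \<delta>'_def)
    define \<eta> where "\<eta> = e / (C powr (t / \<alpha>) + 1)"
    have \<eta>: "0 < \<eta>" using e by (auto simp: \<eta>_def intro!: divide_pos_pos add_nonneg_pos)
    have "hausdorff_premeasure \<delta>' t S = 0"
      using hausdorff_premeasure_le_measure[OF \<delta>', of t S] null by simp
    then have "hausdorff_premeasure \<delta>' t S < ennreal \<eta>" using \<eta> by simp
    then obtain U where U: "S \<subseteq> (\<Union>i. U i)" "\<And>i. bounded (U i)" "\<And>i. diameter (U i) \<le> \<delta>'"
      and sum: "(\<Sum>i. diam_powr t (U i)) < ennreal \<eta>"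
      unfolding hausdorff_premeasure_def INF_less_iff by (auto simp: image_iff)
    \<comment> \<open>The covering sets are cut down to S because f is controlled only
      there.\<close>
    define V where "V i = f ` (U i \<inter> S)" for i
    have bU: "bounded (U i \<inter> S)" for i using U(2) by (rule bounded_subset) auto
    have h: "\<And>x y. x \<in> U i \<inter> S \<Longrightarrow> y \<in> U i \<inter> S \<Longrightarrow> dist (f x) (f y) \<le> C * dist x y powr \<alpha>" for i
      using holder by auto
    have dU: "diameter (U i \<inter> S) \<le> diameter (U i)" for i using U(2) by (intro diameter_subset) auto
    have "bounded (V i)" for i unfolding V_def using diam_powr_holder_image(1)[OF h C \<alpha> t bU] .
    moreover have "diameter (V i) \<le> \<delta>" for i
    proof -
      have "diameter (V i) \<le> C * diameter (U i \<inter> S) powr \<alpha>"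
        unfolding V_def using diam_powr_holder_image(2)[OF h C \<alpha> t bU] .
      also have "\<dots> \<le> C * \<delta>' powr \<alpha>"
        using C \<alpha> dU[of i] U(3)[of i] diameter_ge_0[OF bU] by (intro mult_left_mono powr_mono2) auto
      also have "\<dots> = C * (\<delta> / (C + 1))" using \<alpha> \<delta> C by (simp add: \<delta>'_def powr_powr)
      also have "\<dots> \<le> \<delta>" using C \<delta> by (simp add: field_simps)
      finally show ?thesis .
    qed
    moreover have "f ` S \<subseteq> (\<Union>i. V i)" using U(1) unfolding V_def by blast
    ultimately have "hausdorff_premeasure \<delta> (t / \<alpha>) (f ` S) \<le> (\<Sum>i. diam_powr (t / \<alpha>) (V i))"
      unfolding hausdorff_premeasure_def by (intro INF_lower) auto
    also have "\<dots> \<le> (\<Sum>i. ennreal (C powr (t / \<alpha>)) * diam_powr t (U i))"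
    proof (rule suminf_le)
      fix i
      have "diam_powr (t / \<alpha>) (V i) \<le> ennreal (C powr (t / \<alpha>)) * diam_powr t (U i \<inter> S)"
        unfolding V_def using diam_powr_holder_image(3)[OF h C \<alpha> t bU] .
      also have "diam_powr t (U i \<inter> S) \<le> diam_powr t (U i)"
        using t dU[of i] diameter_ge_0[OF bU[of i]] by (auto simp: diam_powr_def intro!: ennreal_leI powr_mono2)
      finally show "diam_powr (t / \<alpha>) (V i) \<le> ennreal (C powr (t / \<alpha>)) * diam_powr t (U i)"
        by (simp add: mult_left_mono)
    qed auto
    also have "\<dots> = ennreal (C powr (t / \<alpha>)) * (\<Sum>i. diam_powr t (U i))" by simp
    also have "\<dots> \<le> ennreal (C powr (t / \<alpha>)) * ennreal \<eta>" using sum by (intro mult_left_mono) auto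
    also have "\<dots> = ennreal (C powr (t / \<alpha>) * \<eta>)" using \<eta> by (simp add: ennreal_mult)
    also have "\<dots> \<le> ennreal e"
    proof (rule ennreal_leI)
      have "C powr (t / \<alpha>) * \<eta> = e * (C powr (t / \<alpha>) / (C powr (t / \<alpha>) + 1))" by (simp add: \<eta>_def)
      also have "\<dots> \<le> e * 1" using e by (intro mult_left_mono) (auto simp: divide_le_eq_1 add_nonneg_pos)
      finally show "C powr (t / \<alpha>) * \<eta> \<le> e" by simp
    qed
    finally show "hausdorff_premeasure \<delta> (t / \<alpha>) (f ` S) \<le> 0 + ennreal e" by simp
  qed
  then show ?thesis unfolding hausdorff_measure_def by (simp add: SUP_eq_const bot_ennreal[symmetric] le_bot)
qed

lemma hausdorff_dim_holder_image_le:
  fixes f :: "'a::metric_space \<Rightarrow> 'b::metric_space"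
  assumes holder: "\<And>x y. x \<in> S \<Longrightarrow> y \<in> S \<Longrightarrow> dist (f x) (f y) \<le> C * dist x y powr \<alpha>"
    and C: "0 \<le> C" and \<alpha>: "0 < \<alpha>" and dim: "hausdorff_dim S = ennreal s" and s: "0 \<le> s" "s < r"
  shows "hausdorff_dim (f ` S) \<le> ennreal (r / \<alpha>)"
proof -
  have "hausdorff_dim S < ennreal r" using dim s by (simp add: ennreal_less_iff)
  then obtain t where t: "0 \<le> t" "hausdorff_measure t S = 0" "ennreal t < ennreal r"
    unfolding hausdorff_dim_def INF_less_iff by auto
  have "t < r" using t by (simp add: ennreal_less_iff)
  show ?thesis
  proof (cases "t = 0")
    case False
    then have "hausdorff_measure (t / \<alpha>) (f ` S) = 0"
      using t by (intro hausdorff_measure_holder_image[OF holder C \<alpha>]) auto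
    then have "hausdorff_dim (f ` S) \<le> ennreal (t / \<alpha>)"
      unfolding hausdorff_dim_def using t(1) \<alpha> by (intro INF_lower) auto
    also have "\<dots> \<le> ennreal (r / \<alpha>)" using \<open>t < r\<close> \<alpha> by (intro ennreal_leI divide_right_mono) auto
    finally show ?thesis .
  next
    case True
    \<comment> \<open>The image estimate requires t > 0. At t = 0 every nonempty covering set counts
      1, so a vanishing measure leaves only the empty set.\<close>
    have "S = {}"
    proof (rule ccontr)
      assume "S \<noteq> {}"
      have "1 \<le> hausdorff_premeasure 1 0 S"
        unfolding hausdorff_premeasure_def
      proof (rule INF_greatest)
        fix U :: "nat \<Rightarrow> 'a set" assume "U \<in> {U. S \<subseteq> (\<Union>i. U i) \<and> (\<forall>i. bounded (U i) \<and> diameter (U i) \<le> 1)}"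
        then obtain i where "U i \<noteq> {}" using \<open>S \<noteq> {}\<close> by blast
        then have "1 \<le> diam_powr 0 (U i)" by (simp add: diam_powr_def)
        also have "\<dots> \<le> (\<Sum>i. diam_powr 0 (U i))"
          using sum_le_suminf[of "\<lambda>i. diam_powr 0 (U i)" "{i}"] by (simp add: summableI)
        finally show "1 \<le> (\<Sum>i. diam_powr 0 (U i))" .
      qed
      then show False using hausdorff_premeasure_le_measure[of 1 0 S] t(2) True by simp
    qed
    have E: "hausdorff_measure u ({} :: 'b set) = 0" for u
    proof -
      have "hausdorff_premeasure \<delta> u ({} :: 'b set) \<le> (\<Sum>i. diam_powr u ((\<lambda>_. {} :: 'b set) (i::nat)))" if "0 < \<delta>" for \<delta>
        unfolding hausdorff_premeasure_def using that by (intro INF_lower) auto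
      then show ?thesis unfolding hausdorff_measure_def by (simp add: diam_powr_def)
    qed
    have "hausdorff_dim ({} :: 'b set) \<le> ennreal 0"
      unfolding hausdorff_dim_def using E by (intro INF_lower) auto
    then show ?thesis using \<open>S = {}\<close> by (simp add: le_zero_eq)
  qed
qed

text \<open>Mass distribution principle. Its ball condition is imposed only on a part A of positive
  mass, because the energy method yields a uniform constant only on such a part. If the
  u-dimensional measure vanished for some u < t, fine covers would give A arbitrarily small
  mass.\<close>

lemma hausdorff_dim_ge_of_mass:
  fixes \<nu> :: "'a::metric_space measure"
  assumes sets: "sets \<nu> = sets borel" and A: "A \<in> sets borel" "A \<subseteq> S" and pos: "emeasure \<nu> A > 0"
    and t: "0 < t" and C: "0 < C" and r0: "0 < r0"
    and ball: "\<And>x r. x \<in> A \<Longrightarrow> 0 < r \<Longrightarrow> r \<le> r0 \<Longrightarrow> emeasure \<nu> (cball x r) \<le> ennreal (C * r powr t)"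
  shows "ennreal t \<le> hausdorff_dim S"
  unfolding hausdorff_dim_def
proof (rule INF_greatest)
  fix u assume u: "u \<in> {s. 0 \<le> s \<and> hausdorff_measure s S = 0}"
  show "ennreal t \<le> ennreal u"
  proof (rule ccontr)
    assume "\<not> ennreal t \<le> ennreal u"
    then have ut: "u < t" using u by (simp add: ennreal_le_iff not_le ennreal_less_iff)
    define \<delta> where "\<delta> = min 1 r0"
    have \<delta>: "0 < \<delta>" "\<delta> \<le> 1" "\<delta> \<le> r0" using r0 by (auto simp: \<delta>_def)
    \<comment> \<open>Covering sets of diameter 0 contribute 0 to the sum when u > 0, so the balls
      of radius 0 that replace them must be null.\<close>
    have point: "emeasure \<nu> (cball x 0) \<le> 0" if "x \<in> A" for x
    proof (rule ennreal_le_epsilon)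
      fix e :: real assume e: "0 < e"
      define r where "r = min r0 ((e / C) powr (1 / t))"
      have r: "0 < r" "r \<le> r0" using e C r0 by (auto simp: r_def)
      have "emeasure \<nu> (cball x 0) \<le> emeasure \<nu> (cball x r)"
        using r by (intro emeasure_mono) (auto simp: sets)
      also have "\<dots> \<le> ennreal (C * r powr t)" by (rule ball[OF that r])
      also have "\<dots> \<le> ennreal (C * ((e / C) powr (1 / t)) powr t)"
        using r t C by (intro ennreal_leI mult_left_mono powr_mono2) (auto simp: r_def)
      also have "\<dots> = ennreal e" using e t C by (simp add: powr_powr)
      finally show "emeasure \<nu> (cball x 0) \<le> 0 + ennreal e" by simp
    qed
    have "emeasure \<nu> A \<le> 0"
    proof (rule ennreal_le_epsilon)
      fix e :: real assume e: "0 < e"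
      have "hausdorff_premeasure \<delta> u S = 0"
        using hausdorff_premeasure_le_measure[OF \<delta>(1), of u S] u by simp
      then have "hausdorff_premeasure \<delta> u S < ennreal (e / C)" using e C by simp
      then obtain U where U: "S \<subseteq> (\<Union>i. U i)" "\<And>i. bounded (U i)" "\<And>i. diameter (U i) \<le> \<delta>"
        and sum: "(\<Sum>i. diam_powr u (U i)) < ennreal (e / C)"
        unfolding hausdorff_premeasure_def INF_less_iff by (auto simp: image_iff)
        \<comment> \<open>Covering sets need not be measurable. They are replaced by closed balls
          centred in A whose radius is the full diameter, which still contain
          \<open>U i \<inter> A\<close>.\<close>
        define B where "B i = (if U i \<inter> A = {} then {} else cball (SOME x. x \<in> U i \<inter> A) (diameter (U i)))" for i
        have B: "emeasure \<nu> (B i) \<le> ennreal C * diam_powr u (U i)" and UB: "U i \<inter> A \<subseteq> B i" for i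
        proof -
          have "emeasure \<nu> (B i) \<le> ennreal C * diam_powr u (U i) \<and> U i \<inter> A \<subseteq> B i"
          proof (cases "U i \<inter> A = {}")
            case False
            define x where "x = (SOME x. x \<in> U i \<inter> A)"
            have x: "x \<in> U i" "x \<in> A" using someI_ex[of "\<lambda>x. x \<in> U i \<inter> A"] False by (auto simp: x_def)
            have Bx: "B i = cball x (diameter (U i))" using False by (simp add: B_def x_def)
            have "U i \<inter> A \<subseteq> B i" unfolding Bx using diameter_bounded_bound[OF U(2) x(1)] by auto
            moreover have "emeasure \<nu> (B i) \<le> ennreal C * diam_powr u (U i)"
            proof (cases "diameter (U i) = 0")
              case True
              then show ?thesis using point[OF x(2)] by (simp add: Bx)
            next
              case False
              then have d: "0 < diameter (U i)" using diameter_ge_0[OF U(2), of i] by simp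
              have "emeasure \<nu> (B i) \<le> ennreal (C * diameter (U i) powr t)"
                unfolding Bx using d \<delta> U(3)[of i] by (intro ball x) auto
              also have "\<dots> \<le> ennreal (C * diameter (U i) powr u)"
                using C d ut \<delta> U(3)[of i] by (intro ennreal_leI mult_left_mono powr_mono') auto
              also have "\<dots> = ennreal C * diam_powr u (U i)"
                using C x d by (auto simp: diam_powr_def ennreal_mult)
              finally show ?thesis .
            qed
            ultimately show ?thesis by simp
          qed (simp add: B_def)
          then show "emeasure \<nu> (B i) \<le> ennreal C * diam_powr u (U i)" "U i \<inter> A \<subseteq> B i" by auto
        qed
        have Bm: "B i \<in> sets \<nu>" for i by (simp add: B_def sets)
        have "A \<subseteq> (\<Union>i. B i)"
        proof
          fix x assume x: "x \<in> A"
          then obtain i where "x \<in> U i" using U(1) A(2) by auto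
          then show "x \<in> (\<Union>i. B i)" using UB[of i] x by auto
        qed
        then have "emeasure \<nu> A \<le> emeasure \<nu> (\<Union>i. B i)"
          using Bm by (intro emeasure_mono) auto
        also have "\<dots> \<le> (\<Sum>i. emeasure \<nu> (B i))"
          using Bm by (intro emeasure_subadditive_countably) auto
        also have "\<dots> \<le> (\<Sum>i. ennreal C * diam_powr u (U i))" by (intro suminf_le B) auto
        also have "\<dots> = ennreal C * (\<Sum>i. diam_powr u (U i))" by simp
        also have "\<dots> \<le> ennreal C * ennreal (e / C)" using sum by (intro mult_left_mono) auto
        also have "\<dots> = ennreal e" using C e by (simp flip: ennreal_mult)
        finally show "emeasure \<nu> A \<le> 0 + ennreal e" by simp
    qed
    then show False using pos by simp
  qed
qed

section \<open>Dimension of the support from Fourier decay\<close>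

lemma nn_integral_std_normal_powr_finite:
  assumes "0 < \<tau>" "\<tau> < 1"
  shows "(\<integral>\<^sup>+ z. ennreal (\<bar>z\<bar> powr (- \<tau>)) \<partial>std_normal_distribution) < \<infinity>"
proof -
  let ?G = "std_normal_distribution"
  interpret G: prob_space ?G by (rule prob_space_normal_density) simp
  \<comment> \<open>The Gaussian density is at most 1, so the law of the modulus gives
    \<open>{0..r}\<close> mass at most 2 r; the dyadic estimate then applies with the exponents 1
    and \<tau> < 1.\<close>
  define m where "m = distr ?G borel abs"
  have mass: "emeasure m {0..r} \<le> ennreal (2 * r powr 1)" if "0 < r" for r
  proof -
    have "emeasure m {0..r} = emeasure ?G {-r..r}"
      unfolding m_def by (subst emeasure_distr) (auto intro!: arg_cong[where f = "emeasure ?G"])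
    also have "\<dots> = (\<integral>\<^sup>+ z. ennreal (std_normal_density z) * indicator {-r..r} z \<partial>lborel)"
      by (simp add: emeasure_density)
    also have "\<dots> \<le> (\<integral>\<^sup>+ z. indicator {-r..r} z \<partial>lborel)"
    proof (rule nn_integral_mono)
      fix z :: real
      have "1 \<le> sqrt (2 * pi)" using pi_ge_two by simp
      then have "std_normal_density z \<le> 1"
        unfolding std_normal_density_def by (intro mult_le_one) (auto simp: divide_le_eq)
      then show "ennreal (std_normal_density z) * indicator {-r..r} z \<le> indicator {-r..r} z"
        by (auto simp: indicator_def ennreal_le_1)
    qed
    also have "\<dots> = ennreal (2 * r powr 1)" using that by simp
    finally show ?thesis .
  qed
  have "(\<integral>\<^sup>+ z. ennreal (\<bar>z\<bar> powr (- \<tau>)) \<partial>?G) \<le> (\<integral>\<^sup>+ z. ennreal (\<bar>z\<bar> powr (- \<tau>)) * indicator {0<..1} \<bar>z\<bar> + 1 \<partial>?G)"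
  proof (rule nn_integral_mono)
    fix z :: real
    show "ennreal (\<bar>z\<bar> powr (- \<tau>)) \<le> ennreal (\<bar>z\<bar> powr (- \<tau>)) * indicator {0<..1} \<bar>z\<bar> + 1"
    \<comment> \<open>At z = 0 the left side is 0 because
      \<open>0 powr (- \<tau>) = 0\<close>.\<close>
    proof (cases "1 < \<bar>z\<bar>")
      case True
      then have "\<bar>z\<bar> powr (- \<tau>) \<le> \<bar>z\<bar> powr 0" using assms by (intro powr_mono) auto
      moreover have "\<bar>z\<bar> powr 0 = 1" using True by auto
      ultimately show ?thesis using True by (simp only: indicator_def) (simp add: ennreal_le_1)
    qed (cases "z = 0"; simp)
  qed
  also have "\<dots> = (\<integral>\<^sup>+ z. ennreal (\<bar>z\<bar> powr (- \<tau>)) * indicator {0<..1} \<bar>z\<bar> \<partial>?G) + 1"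
    by (subst nn_integral_add) (auto simp: G.emeasure_space_1[simplified])
  also have "(\<integral>\<^sup>+ z. ennreal (\<bar>z\<bar> powr (- \<tau>)) * indicator {0<..1} \<bar>z\<bar> \<partial>?G) = (\<integral>\<^sup>+ x. ennreal (x powr (- \<tau>)) * indicator {0<..1} x \<partial>m)"
    unfolding m_def by (subst nn_integral_distr) auto
  also have "\<dots> + 1 < \<infinity>"
    using nn_integral_powr_finite[of m 2 1 \<tau>] mass assms by (simp add: m_def ennreal_add_eq_top less_top)
  finally show ?thesis .
qed

lemma norm_sq_integral_eq:
  fixes M :: "real measure" and f :: "real \<Rightarrow> complex"
  assumes fin: "finite_measure M" and sets: "sets M = sets borel" and f: "f \<in> borel_measurable borel" and bound: "\<And>x. norm (f x) \<le> B"
  shows "of_real ((norm (\<integral>x. f x \<partial>M))\<^sup>2) = (\<integral>p. f (fst p) * cnj (f (snd p)) \<partial>(M \<Otimes>\<^sub>M M))"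
proof -
  interpret finite_measure M by fact
  note [measurable_cong] = sets
  note [measurable] = f
  interpret P: pair_sigma_finite M M by standard
  interpret P2: finite_measure "M \<Otimes>\<^sub>M M" by (intro finite_measure_pair_measure finite_measure_axioms)
  have int: "integrable (M \<Otimes>\<^sub>M M) (\<lambda>(x, y). f x * cnj (f y))"
  proof (rule P2.integrable_const_bound[where B = "B * B"])
    have "0 \<le> B" using norm_ge_zero bound by (rule order_trans)
    then show "AE p in M \<Otimes>\<^sub>M M. norm (case p of (x, y) \<Rightarrow> f x * cnj (f y)) \<le> B * B"
      using bound by (intro AE_I2) (auto simp: norm_mult intro!: mult_mono)
    have [measurable]: "cnj \<in> borel_measurable borel"
      by (intro borel_measurable_continuous_onI continuous_intros)
    show "(\<lambda>(x, y). f x * cnj (f y)) \<in> borel_measurable (M \<Otimes>\<^sub>M M)" by measurable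
  qed
  have "(\<integral>p. f (fst p) * cnj (f (snd p)) \<partial>(M \<Otimes>\<^sub>M M)) = (\<integral>x. \<integral>y. f x * cnj (f y) \<partial>M \<partial>M)"
    using P.integral_fst'[OF int] by (simp add: case_prod_beta')
  also have "\<dots> = (\<integral>x. f x \<partial>M) * (\<integral>y. cnj (f y) \<partial>M)"
    by simp
  also have "(\<integral>y. cnj (f y) \<partial>M) = cnj (\<integral>y. f y \<partial>M)"
    by (rule integral_bounded_linear'[OF bounded_linear_cnj bounded_linear_cnj]) simp
  finally show ?thesis by (simp only: complex_norm_square)
qed

lemma norm_fourier_measure_le:
  assumes "finite_measure \<nu>" "sets \<nu> = sets borel"
  shows "norm (fourier_measure \<nu> \<xi>) \<le> measure \<nu> UNIV"
proof -
  interpret finite_measure \<nu> by fact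
  have sp: "space \<nu> = UNIV" using sets_eq_imp_space_eq[OF assms(2)] by simp
  have "norm (fourier_measure \<nu> \<xi>) \<le> (\<integral>x. norm (iexp ((- 2 * pi * \<xi>) * x)) \<partial>\<nu>)"
    unfolding fourier_measure_def exp_fourier_eq by (rule integral_norm_bound)
  then show ?thesis by (simp add: sp)
qed

text \<open>Gaussian smoothing: the indicator of \<open>\<bar>x - y\<bar> \<le> r\<close> is dominated by a multiple of the
  characteristic function of the normal law at \<open>(x - y) / r\<close>, whose double integral is
  an average of \<open>\<bar>\<nu>-hat\<bar>\<^sup>2\<close>.\<close>

lemma nn_integral_ball_le_of_decay:
  fixes \<nu> :: "real measure"
  assumes fin: "finite_measure \<nu>" and sets: "sets \<nu> = sets borel" and \<tau>: "0 < \<tau>" "\<tau> < 1"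
    and decay: "\<And>\<xi>. 1 \<le> \<bar>\<xi>\<bar> \<Longrightarrow> (norm (fourier_measure \<nu> \<xi>))\<^sup>2 \<le> C * \<bar>\<xi>\<bar> powr (- \<tau>)"
  obtains C' where "0 \<le> C'" "\<And>r. 0 < r \<Longrightarrow> (\<integral>\<^sup>+ x. emeasure \<nu> (cball x r) \<partial>\<nu>) \<le> ennreal (C' * r powr \<tau>)"
proof -
  interpret finite_measure \<nu> by fact
  note [measurable_cong] = sets
  have sp: "space \<nu> = UNIV" using sets_eq_imp_space_eq[OF sets] by simp
  let ?G = "std_normal_distribution"
  let ?P = "\<nu> \<Otimes>\<^sub>M \<nu>"
  interpret G: prob_space ?G by (rule prob_space_normal_density) simp
  interpret P: finite_measure ?P by (intro finite_measure_pair_measure fin)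
  interpret GP: pair_sigma_finite ?G ?P by standard
  interpret GPf: finite_measure "?G \<Otimes>\<^sub>M ?P" by (intro finite_measure_pair_measure G.finite_measure_axioms P.finite_measure_axioms)
  \<comment> \<open>Frequencies below 1 are covered by the total mass, since
    \<open>\<bar>\<xi>\<bar> powr (- \<tau>)\<close> is at least 1 there.\<close>
  define C1 where "C1 = max C ((measure \<nu> UNIV)\<^sup>2)"
  have C10: "0 \<le> C1" by (simp add: C1_def le_max_iff_disj)
  have decay1: "(norm (fourier_measure \<nu> \<xi>))\<^sup>2 \<le> C1 * \<bar>\<xi>\<bar> powr (- \<tau>)" if "\<xi> \<noteq> 0" for \<xi>
  proof (cases "1 \<le> \<bar>\<xi>\<bar>")
    case True
    have "(norm (fourier_measure \<nu> \<xi>))\<^sup>2 \<le> C * \<bar>\<xi>\<bar> powr (- \<tau>)" by (rule decay[OF True])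
    also have "\<dots> \<le> C1 * \<bar>\<xi>\<bar> powr (- \<tau>)" by (intro mult_right_mono) (auto simp: C1_def)
    finally show ?thesis .
  next
    case False
    have "(norm (fourier_measure \<nu> \<xi>))\<^sup>2 \<le> (measure \<nu> UNIV)\<^sup>2"
      by (intro power_mono norm_fourier_measure_le fin sets) auto
    also have "\<dots> \<le> C1 * 1" by (simp add: C1_def)
    also have "\<dots> \<le> C1 * \<bar>\<xi>\<bar> powr (- \<tau>)"
    proof (intro mult_left_mono C10)
      have "1 powr (- \<tau>) \<le> \<bar>\<xi>\<bar> powr (- \<tau>)" using False that \<tau> by (intro powr_mono2') auto
      then show "1 \<le> \<bar>\<xi>\<bar> powr (- \<tau>)" by simp
    qed
    finally show ?thesis .
  qed
  obtain I where I: "0 \<le> I" "(\<integral>\<^sup>+ z. ennreal (\<bar>z\<bar> powr (- \<tau>)) \<partial>?G) = ennreal I"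
    using nn_integral_std_normal_powr_finite[OF \<tau>] by (cases "\<integral>\<^sup>+ z. ennreal (\<bar>z\<bar> powr (- \<tau>)) \<partial>?G") auto
  \<comment> \<open>\<open>exp (1/2)\<close> is the cost of dominating the indicator by the
    Gaussian, and \<open>(2 * pi) powr \<tau>\<close> comes from evaluating the transform at
    \<open>- z / (2 * pi * r)\<close>; I is the Gaussian average of
    \<open>\<bar>z\<bar> powr (- \<tau>)\<close>.\<close>
  define C' where "C' = exp (1/2) * (C1 * (2 * pi) powr \<tau> * I)"
  have C'0: "0 \<le> C'" using C10 I by (simp add: C'_def)
  have "(\<integral>\<^sup>+ x. emeasure \<nu> (cball x r) \<partial>\<nu>) \<le> ennreal (C' * r powr \<tau>)" if r: "0 < r" for r
  proof -
    define F where "F z = (\<integral>x. iexp (z * (x / r)) \<partial>\<nu>)" for z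
    have F_eq: "F z = fourier_measure \<nu> (- z / (2 * pi * r))" for z
      unfolding F_def fourier_measure_def exp_fourier_eq using r by (intro Bochner_Integration.integral_cong) (auto simp: field_simps)
    have F_bound: "(norm (F z))\<^sup>2 \<le> C1 * (2 * pi) powr \<tau> * r powr \<tau> * \<bar>z\<bar> powr (- \<tau>)" if "z \<noteq> 0" for z
    proof -
      have "(norm (F z))\<^sup>2 \<le> C1 * \<bar>- z / (2 * pi * r)\<bar> powr (- \<tau>)"
        unfolding F_eq using that r by (intro decay1) auto
      also have "\<bar>- z / (2 * pi * r)\<bar> powr (- \<tau>) = (2 * pi) powr \<tau> * r powr \<tau> * \<bar>z\<bar> powr (- \<tau>)"
        using r that by (simp add: abs_mult powr_divide powr_mult powr_minus_divide)
      finally show ?thesis by (simp add: mult_ac)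
    qed
    have F_sq: "of_real ((norm (F z))\<^sup>2) = (\<integral>p. iexp (z * ((fst p - snd p) / r)) \<partial>?P)" for z
    proof -
      have "of_real ((norm (F z))\<^sup>2) = (\<integral>p. iexp (z * (fst p / r)) * cnj (iexp (z * (snd p / r))) \<partial>?P)"
        unfolding F_def by (rule norm_sq_integral_eq[OF fin sets, where B = 1]) simp_all
      also have "\<dots> = (\<integral>p. iexp (z * ((fst p - snd p) / r)) \<partial>?P)"
        by (intro Bochner_Integration.integral_cong refl) (simp add: exp_cnj exp_add[symmetric] diff_divide_distrib algebra_simps)
      finally show ?thesis .
    qed
    let ?h = "\<lambda>z p. iexp (z * ((fst p - snd p) / r))"
    have int: "integrable (?G \<Otimes>\<^sub>M ?P) (\<lambda>(z, p). ?h z p)"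
    proof (rule GPf.integrable_const_bound[where B = 1])
      show "(\<lambda>(z, p). ?h z p) \<in> borel_measurable (?G \<Otimes>\<^sub>M ?P)" by measurable
    qed auto
    have gauss: "(\<integral>z. ?h z p \<partial>?G) = of_real (exp (- (((fst p - snd p) / r)\<^sup>2) / 2))" for p
      using fun_cong[OF char_std_normal_distribution, of "(fst p - snd p) / r"]
      unfolding char_def by (simp add: mult.commute)
    have "complex_of_real (\<integral>z. (norm (F z))\<^sup>2 \<partial>?G) = (\<integral>z. \<integral>p. ?h z p \<partial>?P \<partial>?G)"
      unfolding F_sq[symmetric] by (rule integral_complex_of_real[symmetric])
    also have "\<dots> = (\<integral>p. \<integral>z. ?h z p \<partial>?G \<partial>?P)"
      by (rule GP.Fubini_integral[OF int, symmetric])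
    also have "\<dots> = complex_of_real (\<integral>p. exp (- (((fst p - snd p) / r)\<^sup>2) / 2) \<partial>?P)"
      unfolding gauss by (rule integral_complex_of_real)
    finally have key: "(\<integral>z. (norm (F z))\<^sup>2 \<partial>?G) = (\<integral>p. exp (- (((fst p - snd p) / r)\<^sup>2) / 2) \<partial>?P)"
      by (simp only: of_real_eq_iff)
    define Q where "Q = {p :: real \<times> real. \<bar>fst p - snd p\<bar> \<le> r}"
    have Qm: "Q \<in> sets ?P"
    proof -
      have "Q = {p \<in> space ?P. \<bar>fst p - snd p\<bar> \<le> r}" by (auto simp: Q_def space_pair_measure sp)
      then show ?thesis by simp
    qed
    have "(\<integral>\<^sup>+ x. emeasure \<nu> (cball x r) \<partial>\<nu>) = emeasure ?P Q"
    proof -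
      have "Pair x -` Q = cball x r" for x by (auto simp: Q_def dist_real_def)
      then show ?thesis using emeasure_pair_measure_alt[OF Qm] by simp
    qed
    also have "\<dots> \<le> (\<integral>\<^sup>+ p. ennreal (exp (1/2) * exp (- (((fst p - snd p) / r)\<^sup>2) / 2)) \<partial>?P)"
    proof -
      have "emeasure ?P Q = (\<integral>\<^sup>+ p. indicator Q p \<partial>?P)" using Qm by simp
      also have "\<dots> \<le> (\<integral>\<^sup>+ p. ennreal (exp (1/2) * exp (- (((fst p - snd p) / r)\<^sup>2) / 2)) \<partial>?P)"
      proof (rule nn_integral_mono)
        fix p :: "real \<times> real"
        show "indicator Q p \<le> ennreal (exp (1/2) * exp (- (((fst p - snd p) / r)\<^sup>2) / 2))"
        proof (cases "p \<in> Q")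
          case True
          then have "\<bar>(fst p - snd p) / r\<bar> \<le> 1" using r by (simp add: Q_def)
          then have "((fst p - snd p) / r)\<^sup>2 \<le> 1" by (simp add: abs_square_le_1)
          then have "exp 0 \<le> exp (1/2 + - (((fst p - snd p) / r)\<^sup>2) / 2)" by (subst exp_le_cancel_iff) simp
          then show ?thesis using True unfolding exp_add by (simp add: ennreal_ge_1)
        qed simp
      qed
      finally show ?thesis .
    qed
    also have "\<dots> = ennreal (\<integral>p. exp (1/2) * exp (- (((fst p - snd p) / r)\<^sup>2) / 2) \<partial>?P)"
      by (intro nn_integral_eq_integral P.integrable_const_bound[where B = "exp (1/2)"]) (auto intro!: AE_I2)
    also have "(\<integral>p. exp (1/2) * exp (- (((fst p - snd p) / r)\<^sup>2) / 2) \<partial>?P) = exp (1/2) * (\<integral>z. (norm (F z))\<^sup>2 \<partial>?G)"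
      unfolding key by simp
    also have "ennreal \<dots> \<le> ennreal (exp (1/2)) * (\<integral>\<^sup>+ z. ennreal ((norm (F z))\<^sup>2) \<partial>?G)"
    proof -
      \<comment> \<open>Without integrability the Bochner integral is 0 by default, so this
        direction holds in either case.\<close>
      have "ennreal (\<integral>z. (norm (F z))\<^sup>2 \<partial>?G) \<le> (\<integral>\<^sup>+ z. ennreal ((norm (F z))\<^sup>2) \<partial>?G)"
        by (cases "integrable ?G (\<lambda>z. (norm (F z))\<^sup>2)") (auto simp: nn_integral_eq_integral not_integrable_integral_eq)
      then show ?thesis by (simp add: ennreal_mult mult_left_mono)
    qed
    also have "(\<integral>\<^sup>+ z. ennreal ((norm (F z))\<^sup>2) \<partial>?G) \<le> (\<integral>\<^sup>+ z. ennreal (C1 * (2 * pi) powr \<tau> * r powr \<tau>) * ennreal (\<bar>z\<bar> powr (- \<tau>)) \<partial>?G)"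
    proof (rule nn_integral_mono_AE)
      \<comment> \<open>At z = 0 the right-hand side is 0 by the convention for \<open>powr\<close>
        while F may be positive; the bound is claimed off this null set.\<close>
      have "AE z in lborel. (z::real) \<noteq> 0" by (rule AE_lborel_singleton)
      then have "AE z in ?G. z \<noteq> 0" by (subst AE_density) auto
      then show "AE z in ?G. ennreal ((norm (F z))\<^sup>2) \<le> ennreal (C1 * (2 * pi) powr \<tau> * r powr \<tau>) * ennreal (\<bar>z\<bar> powr (- \<tau>))"
        by eventually_elim (use F_bound C10 in \<open>simp add: ennreal_mult[symmetric] ennreal_leI\<close>)
    qed
    also have "\<dots> = ennreal (C1 * (2 * pi) powr \<tau> * r powr \<tau>) * ennreal I"
      by (subst nn_integral_cmult) (auto simp: I(2))
    also have "ennreal (exp (1/2)) * \<dots> = ennreal (C' * r powr \<tau>)"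
      using C10 I(1) by (simp add: C'_def ennreal_mult[symmetric] mult_ac)
    finally show ?thesis by (simp add: mult_left_mono)
  qed
  then show ?thesis using that C'0 by blast
qed

text \<open>Integrating the ball masses weighted by \<open>\<rho> k powr (- t)\<close> gives a
  geometric series because t < \<tau>, so at almost every x the weighted masses are bounded in k.
  The bound depends on x; the sets \<open>A m\<close> on which it is at most m exhaust almost all of
  the space, and one of them has positive mass.\<close>

lemma hausdorff_dim_support_ge_of_decay:
  fixes \<nu> :: "real measure"
  assumes fin: "finite_measure \<nu>" and sets: "sets \<nu> = sets borel" and nz: "emeasure \<nu> (space \<nu>) \<noteq> 0"
    and t: "0 < t" "t < \<tau>" and \<tau>: "\<tau> < 1"
    and decay: "\<And>\<xi>. 1 \<le> \<bar>\<xi>\<bar> \<Longrightarrow> (norm (fourier_measure \<nu> \<xi>))\<^sup>2 \<le> C * \<bar>\<xi>\<bar> powr (- \<tau>)"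
  shows "ennreal t \<le> hausdorff_dim (measure_support \<nu>)"
proof -
  interpret finite_measure \<nu> by fact
  note [measurable_cong] = sets
  have sp: "space \<nu> = UNIV" using sets_eq_imp_space_eq[OF sets] by simp
  have "0 < \<tau>" using t by simp
  then obtain C' where C': "0 \<le> C'" "\<And>r. 0 < r \<Longrightarrow> (\<integral>\<^sup>+ x. emeasure \<nu> (cball x r) \<partial>\<nu>) \<le> ennreal (C' * r powr \<tau>)"
    by (rule nn_integral_ball_le_of_decay[OF fin sets _ \<tau>]) (erule decay, rule that)
  have meas: "(\<lambda>x. emeasure \<nu> (cball x r)) \<in> borel_measurable \<nu>" for r
  proof -
    define Q where "Q = {p :: real \<times> real. \<bar>fst p - snd p\<bar> \<le> r}"
    have "Q = {p \<in> space (\<nu> \<Otimes>\<^sub>M \<nu>). \<bar>fst p - snd p\<bar> \<le> r}" by (auto simp: Q_def space_pair_measure sp)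
    then have "Q \<in> sets (\<nu> \<Otimes>\<^sub>M \<nu>)" by simp
    then have "(\<lambda>x. emeasure \<nu> (Pair x -` Q)) \<in> borel_measurable \<nu>" by (rule measurable_emeasure_Pair)
    moreover have "Pair x -` Q = cball x r" for x by (auto simp: Q_def dist_real_def)
    ultimately show ?thesis by simp
  qed
  define q where "q = (1/2::real) powr (\<tau> - t)"
  have q: "0 < q" "q < 1" using t gr_one_powr[of 2 "\<tau> - t"] by (auto simp: q_def powr_divide)
  define \<rho> where "\<rho> k = (1/2::real) ^ k" for k :: nat
  have \<rho>: "0 < \<rho> k" for k by (simp add: \<rho>_def)
  define g where "g x k = ennreal (\<rho> k powr (- t)) * emeasure \<nu> (cball x (\<rho> k))" for x k
  have gm: "(\<lambda>x. g x k) \<in> borel_measurable \<nu>" for k unfolding g_def using meas by simp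
  have "(\<integral>\<^sup>+ x. (\<Sum>k. g x k) \<partial>\<nu>) = (\<Sum>k. \<integral>\<^sup>+ x. g x k \<partial>\<nu>)" by (rule nn_integral_suminf[OF gm])
  also have "\<dots> \<le> (\<Sum>k. ennreal (C' * q ^ k))"
  proof (rule suminf_le)
    fix k
    have "(\<integral>\<^sup>+ x. g x k \<partial>\<nu>) = ennreal (\<rho> k powr (- t)) * (\<integral>\<^sup>+ x. emeasure \<nu> (cball x (\<rho> k)) \<partial>\<nu>)"
      unfolding g_def by (rule nn_integral_cmult[OF meas])
    also have "\<dots> \<le> ennreal (\<rho> k powr (- t)) * ennreal (C' * \<rho> k powr \<tau>)" by (intro mult_left_mono C'(2) \<rho>) auto
    also have "\<dots> = ennreal (C' * (\<rho> k powr (- t) * \<rho> k powr \<tau>))" using C'(1) by (simp add: ennreal_mult mult_ac)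
    also have "\<rho> k powr (- t) * \<rho> k powr \<tau> = q ^ k"
      unfolding q_def \<rho>_def by (simp add: powr_realpow[symmetric] powr_powr powr_add[symmetric] algebra_simps)
    finally show "(\<integral>\<^sup>+ x. g x k \<partial>\<nu>) \<le> ennreal (C' * q ^ k)" .
  qed auto
  also have "\<dots> = ennreal (\<Sum>k. C' * q ^ k)"
    using q C' by (intro suminf_ennreal2 summable_mult summable_geometric) auto
  finally have "(\<integral>\<^sup>+ x. (\<Sum>k. g x k) \<partial>\<nu>) \<noteq> \<infinity>" by (auto simp: top_unique)
  then have fin_sum: "AE x in \<nu>. (\<Sum>k. g x k) \<noteq> \<infinity>"
    by (intro nn_integral_PInf_AE) (use gm in auto)
  define A where "A m = {x. \<forall>k. g x k \<le> ennreal (real m)} \<inter> measure_support \<nu>" for m :: nat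
  have A_meas: "A m \<in> sets borel" for m
  proof -
    have "{x \<in> space \<nu>. \<forall>k. g x k \<le> ennreal (real m)} \<in> sets \<nu>" using gm by measurable
    then show ?thesis using closed_measure_support[of \<nu>] by (simp add: A_def sp sets borel_closed)
  qed
  have "AE x in \<nu>. x \<in> measure_support \<nu>"
    using emeasure_Compl_measure_support[OF sets] closed_measure_support[of \<nu>]
    by (intro AE_I[where N = "- measure_support \<nu>"]) (auto simp: sets borel_closed)
  then have cover: "AE x in \<nu>. \<exists>m. x \<in> A m"
    using fin_sum
  proof eventually_elim
    case (elim x)
    obtain m :: nat where m: "enn2real (\<Sum>k. g x k) \<le> real m" using real_arch_simple by blast
    have "(\<Sum>k. g x k) = ennreal (enn2real (\<Sum>k. g x k))" using elim(2) by (simp add: less_top)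
    also have "\<dots> \<le> ennreal (real m)" using m by (rule ennreal_leI)
    finally have "(\<Sum>k. g x k) \<le> ennreal (real m)" .
    then have "g x k \<le> ennreal (real m)" for k using term_le_suminf_ennreal[of "g x" k] by (rule order_trans[rotated])
    then show ?case using elim(1) by (auto simp: A_def)
  qed
  obtain m where pos: "emeasure \<nu> (A m) > 0"
  proof (rule ccontr)
    assume "\<not> thesis"
    then have "A m \<in> null_sets \<nu>" for m using that A_meas by (auto simp: null_sets_def sets zero_less_iff_neq_zero)
    then have "(\<Union>m. A m) \<in> null_sets \<nu>" by (intro null_sets_UN) auto
    then have "AE x in \<nu>. x \<notin> (\<Union>m. A m)" by (rule AE_not_in)
    then have "AE x in \<nu>. False" using cover by eventually_elim auto
    then have "emeasure \<nu> (space \<nu>) = 0" by (subst (asm) AE_iff_measurable[of "space \<nu>"]) auto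
    then show False using nz by simp
  qed
  show ?thesis
  proof (rule hausdorff_dim_ge_of_mass[OF sets A_meas _ pos t(1), where ?r0.0 = 1])
    show "A m \<subseteq> measure_support \<nu>" by (auto simp: A_def)
    \<comment> \<open>m + 1 keeps the constant positive even for m = 0, and \<open>2 powr t\<close>
      pays for rounding r up to a dyadic radius.\<close>
    show "0 < (real m + 1) * 2 powr t" by (simp add: add_nonneg_pos)
    fix x r :: real assume x: "x \<in> A m" and r: "0 < r" "r \<le> 1"
    obtain k where k: "(1/2) ^ Suc k < r" "r \<le> (1/2) ^ k" using dyadic_scale[OF r] by blast
    have "emeasure \<nu> (cball x r) \<le> emeasure \<nu> (cball x (\<rho> k))"
      using k by (intro emeasure_mono) (auto simp: \<rho>_def sets)
    also have "\<dots> = ennreal (\<rho> k powr t) * g x k"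
    proof -
      have "\<rho> k powr t * \<rho> k powr (- t) = 1" using \<rho>[of k] by (simp add: powr_minus_divide)
      then show ?thesis by (simp add: g_def mult.assoc[symmetric] ennreal_mult[symmetric])
    qed
    also have "\<dots> \<le> ennreal (\<rho> k powr t) * ennreal (real m)"
      using x by (intro mult_left_mono) (auto simp: A_def)
    also have "\<dots> = ennreal (real m * \<rho> k powr t)" by (simp add: ennreal_mult mult.commute)
    also have "\<dots> \<le> ennreal ((real m + 1) * (2 * r) powr t)"
      using k t \<rho>[of k] by (intro ennreal_leI mult_mono powr_mono2) (auto simp: \<rho>_def)
    finally show "emeasure \<nu> (cball x r) \<le> ennreal ((real m + 1) * 2 powr t * r powr t)"
      using r by (simp add: powr_mult mult_ac)
  qed simp
qed

text \<open>The image of the compact support is closed, so its complement is an open set whose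
  preimage is null. Conversely, a neighbourhood of an image point pulls back to a relatively open
  set of times, which has positive mass.\<close>

lemma measure_support_path_pushforward:
  assumes sets: "sets \<mu> = sets borel" and w: "continuous_on {0..} w" and sub: "measure_support \<mu> \<subseteq> {0..1}"
  shows "measure_support (path_pushforward \<mu> w) = w ` measure_support \<mu>"
    and "compact (w ` measure_support \<mu>)"
proof -
  have "compact (measure_support \<mu>)"
    using compact_Int_closed[OF compact_Icc closed_measure_support[of \<mu>], of 0 1] sub by (simp add: Int_absorb1)
  then show comp: "compact (w ` measure_support \<mu>)"
    using sub by (intro compact_continuous_image continuous_on_subset[OF w]) auto
  note em = emeasure_path_pushforward[OF w sets]
  show "measure_support (path_pushforward \<mu> w) = w ` measure_support \<mu>"
  proof (intro equalityI subsetI)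
    fix y assume y: "y \<in> measure_support (path_pushforward \<mu> w)"
    show "y \<in> w ` measure_support \<mu>"
    proof (rule ccontr)
      assume ny: "y \<notin> w ` measure_support \<mu>"
      let ?U = "- (w ` measure_support \<mu>)"
      have "open ?U" using comp by (simp add: compact_imp_closed open_Compl)
      then have "0 < emeasure (path_pushforward \<mu> w) ?U" using y ny by (simp add: measure_support_def)
      also have "\<dots> = emeasure \<mu> ({0..} \<inter> w -` ?U)"
        using \<open>open ?U\<close> by (intro em) (rule borel_open)
      also have "\<dots> \<le> emeasure \<mu> (- measure_support \<mu>)"
        using closed_measure_support[of \<mu>] by (intro emeasure_mono) (auto simp: sets borel_closed)
      also have "\<dots> = 0" by (rule emeasure_Compl_measure_support[OF sets])
      finally show False by simp
    qed
  next
    fix y assume "y \<in> w ` measure_support \<mu>"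
    then obtain x where x: "x \<in> measure_support \<mu>" "y = w x" by auto
    have x01: "0 \<le> x" "x \<le> 1" using x sub by auto
    show "y \<in> measure_support (path_pushforward \<mu> w)"
      unfolding measure_support_def
    proof (intro CollectI allI impI)
      fix U assume U: "open U \<and> y \<in> U"
      then obtain V where V: "open V" "V \<inter> {0..} = w -` U \<inter> {0..}"
        using w unfolding continuous_on_open_invariant by blast
      have "x \<in> V" using V(2) U x x01 by auto
      then have "0 < emeasure \<mu> V" using x(1) V(1) by (auto simp: measure_support_def)
      \<comment> \<open>V may contain negative times, where the path is uncontrolled; restricting to
        the support removes them without losing mass.\<close>
      also have "\<dots> = emeasure \<mu> (V \<inter> measure_support \<mu>)"
      proof (rule emeasure_eq_AE)
        show "AE x in \<mu>. (x \<in> V) = (x \<in> V \<inter> measure_support \<mu>)"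
          using emeasure_Compl_measure_support[OF sets] closed_measure_support[of \<mu>]
          by (intro AE_I[where N = "- measure_support \<mu>"]) (auto simp: sets borel_closed)
      qed (use V(1) closed_measure_support[of \<mu>] in \<open>auto simp: sets borel_closed\<close>)
      also have "\<dots> \<le> emeasure \<mu> ({0..} \<inter> w -` U)"
      proof (rule emeasure_mono)
        show "V \<inter> measure_support \<mu> \<subseteq> {0..} \<inter> w -` U" using V(2) sub by fastforce
        have "{0..} \<inter> w -` U = V \<inter> {0..}" using V(2) by auto
        then show "{0..} \<inter> w -` U \<in> sets \<mu>" using V(1) by (simp add: sets)
      qed
      also have "\<dots> = emeasure (path_pushforward \<mu> w) U"
        using U by (intro em[symmetric]) (simp add: borel_open)
      finally show "0 < emeasure (path_pushforward \<mu> w) U" .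
    qed
  qed
qed

section \<open>Frame spectra\<close>

lemma infsum_ennreal_eq_SUP:
  fixes f :: "'a \<Rightarrow> ennreal"
  shows "infsum f A = (SUP F\<in>{F. finite F \<and> F \<subseteq> A}. sum f F)"
  by (rule nonneg_infsum_complete) simp

text \<open>Tests the Bessel bound on a modulated indicator of the interval of radius \<open>1 / (16 R)\<close> around 0, whose transform
  has modulus at least half its mass on all of \<open>[y - R, y + R]\<close>.\<close>

lemma card_spectrum_le:
  fixes \<nu> :: "real measure"
  assumes fin: "finite_measure \<nu>" and sets: "sets \<nu> = sets borel" and B: "0 \<le> B"
    and bessel: "\<And>f. square_integrable \<nu> f \<Longrightarrow>
        infsum (\<lambda>l. ennreal ((norm (fourier_density \<nu> f l))\<^sup>2)) \<Lambda> \<le> ennreal (B * L2_norm_sq \<nu> f)"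
    and c0: "0 < c0" and mass: "\<And>r. 0 < r \<Longrightarrow> r \<le> 1 \<Longrightarrow> c0 * r powr \<beta> \<le> measure \<nu> {-r..r}"
    and R: "1 \<le> R" and F: "finite F" "F \<subseteq> \<Lambda>" "\<And>l. l \<in> F \<Longrightarrow> \<bar>l - y\<bar> \<le> R"
  shows "real (card F) \<le> 4 * B * 16 powr \<beta> / c0 * R powr \<beta>"
proof -
  interpret finite_measure \<nu> by fact
  note [measurable_cong] = sets
  have sp: "space \<nu> = UNIV" using sets_eq_imp_space_eq[OF sets] by simp
  \<comment> \<open>Since \<open>pi < 4\<close>, on the interval of radius r the phase
    \<open>2 * pi * (y - l) * x\<close> is at most \<open>8 * R * r = 1/2\<close> in
    modulus.\<close>
  define r where "r = 1 / (16 * R)"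
  have r: "0 < r" "r \<le> 1" using R by (auto simp: r_def)
  define m where "m = measure \<nu> {-r..r}"
  have m: "c0 * r powr \<beta> \<le> m" unfolding m_def by (rule mass[OF r])
  then have m0: "0 < m" using c0 r by (smt (verit) mult_pos_pos powr_gt_zero)
  define f where "f x = indicator {-r..r} x * iexp (2 * pi * y * x)" for x :: real
  have fm [measurable]: "f \<in> borel_measurable borel" unfolding f_def[abs_def] by measurable
  have nf: "(norm (f x))\<^sup>2 = indicator {-r..r} x" for x by (simp add: f_def norm_mult indicator_def)
  have sq: "square_integrable \<nu> f"
    unfolding square_integrable_def nf by (auto simp: sets emeasure_eq_measure)
  have L2: "L2_norm_sq \<nu> f = m" unfolding L2_norm_sq_def nf by (simp add: m_def sets sp)
  have big: "m / 2 \<le> norm (fourier_density \<nu> f l)" if "l \<in> F" for l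
  proof -
    define g where "g x = indicator {-r..r} x *\<^sub>R iexp (2 * pi * (y - l) * x)" for x
    have fd: "fourier_density \<nu> f l = (\<integral>x. g x \<partial>\<nu>)"
      unfolding fourier_density_def
      by (intro Bochner_Integration.integral_cong refl)
         (auto simp: f_def g_def indicator_def algebra_simps simp flip: exp_add)
    have gm: "g \<in> borel_measurable \<nu>" unfolding g_def[abs_def] by measurable
    have gi: "integrable \<nu> g" by (rule integrable_const_bound[where B = 1]) (auto simp: gm g_def indicator_def)
    have ii: "integrable \<nu> (\<lambda>x. complex_of_real (indicator {-r..r} x))"
      by (rule integrable_const_bound[where B = 1]) (auto simp: indicator_def)
    have "norm ((\<integral>x. g x \<partial>\<nu>) - of_real m) = norm (\<integral>x. g x - of_real (indicator {-r..r} x) \<partial>\<nu>)"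
      using ii by (subst Bochner_Integration.integral_diff[OF gi ii]) (simp add: m_def sets sp)
    also have "\<dots> \<le> (\<integral>x. norm (g x - of_real (indicator {-r..r} x)) \<partial>\<nu>)" by (rule integral_norm_bound)
    also have "\<dots> \<le> (\<integral>x. indicator {-r..r} x * (1/2) \<partial>\<nu>)"
    proof (rule integral_mono)
      show "integrable \<nu> (\<lambda>x. indicator {-r..r} x * (1/2::real))"
        by (rule integrable_const_bound[where B = 1]) (auto simp: indicator_def)
      fix x
      show "norm (g x - of_real (indicator {-r..r} x)) \<le> indicator {-r..r} x * (1/2)"
      proof (cases "x \<in> {-r..r}")
        case True
        have "norm (g x - of_real (indicator {-r..r} x)) = norm (iexp (2 * pi * (y - l) * x) - iexp 0)"
          using True by (simp add: g_def)
        also have "\<dots> \<le> \<bar>2 * pi * (y - l) * x\<bar>" using norm_iexp_diff_le[of "2 * pi * (y - l) * x" 0] by simp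
        also have "\<dots> = 2 * pi * \<bar>l - y\<bar> * \<bar>x\<bar>" by (simp add: abs_mult abs_minus_commute)
        also have "\<dots> \<le> 2 * 4 * R * r"
          using pi_less_4 F(3)[OF that] True R by (intro mult_mono) auto
        also have "\<dots> = 1/2" using R by (simp add: r_def)
        finally show ?thesis using True by simp
      qed (simp add: g_def)
    qed (use gi ii in auto)
    also have "\<dots> = m / 2" by (simp add: m_def sets sp)
    finally have "norm (fourier_density \<nu> f l - of_real m) \<le> m / 2" unfolding fd .
    moreover have "norm (complex_of_real m) \<le> norm (fourier_density \<nu> f l) + norm (fourier_density \<nu> f l - of_real m)"
      by (metis norm_minus_commute norm_triangle_sub)
    ultimately show ?thesis using m0 by simp
  qed
  have "ennreal (card F * (m / 2)\<^sup>2) = (\<Sum>l\<in>F. ennreal ((m / 2)\<^sup>2))"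
    by (simp add: ennreal_mult ennreal_of_nat_eq_real_of_nat)
  also have "\<dots> \<le> (\<Sum>l\<in>F. ennreal ((norm (fourier_density \<nu> f l))\<^sup>2))"
    using m0 big by (intro sum_mono ennreal_leI power_mono) auto
  also have "\<dots> \<le> infsum (\<lambda>l. ennreal ((norm (fourier_density \<nu> f l))\<^sup>2)) \<Lambda>"
    unfolding infsum_ennreal_eq_SUP using F by (intro SUP_upper) auto
  also have "\<dots> \<le> ennreal (B * m)" using bessel[OF sq] L2 by simp
  finally have "card F * (m / 2)\<^sup>2 \<le> B * m" using B m0 by (simp add: ennreal_le_iff)
  then have "card F * m * m \<le> 4 * B * m" by (simp add: power2_eq_square field_simps)
  then have cm: "card F * m \<le> 4 * B" using m0 by simp
  have "card F * (c0 * r powr \<beta>) \<le> 4 * B" using m cm by (meson mult_left_mono of_nat_0_le_iff order_trans)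
  moreover have "r powr \<beta> = 1 / (16 powr \<beta> * R powr \<beta>)"
    using R by (simp add: r_def powr_divide powr_mult)
  ultimately show ?thesis using R c0 by (simp add: field_simps)
qed

text \<open>Tests the lower frame bound on the character of frequency \<open>y\<close>: if the spectrum had a large gap around \<open>y\<close>, the
  dyadic blocks of \<open>\<Sum> \<bar>\<nu>-hat (l - y)\<bar>\<^sup>2\<close> would form a geometric series with a small first term.\<close>

lemma spectrum_relatively_dense:
  fixes \<nu> :: "real measure"
  assumes fin: "finite_measure \<nu>" and sets: "sets \<nu> = sets borel" and A: "0 < A" and nz: "0 < measure \<nu> UNIV"
    and lower: "\<And>f. square_integrable \<nu> f \<Longrightarrow>
        ennreal (A * L2_norm_sq \<nu> f) \<le> infsum (\<lambda>l. ennreal ((norm (fourier_density \<nu> f l))\<^sup>2)) \<Lambda>"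
    and D: "0 \<le> D" and count: "\<And>F R y. finite F \<Longrightarrow> F \<subseteq> \<Lambda> \<Longrightarrow> 1 \<le> R \<Longrightarrow> (\<And>l. l \<in> F \<Longrightarrow> \<bar>l - y\<bar> \<le> R) \<Longrightarrow>
        real (card F) \<le> D * R powr \<beta>"
    and \<beta>: "0 < \<beta>" "\<beta> < \<tau>"
    and decay: "\<And>\<xi>. 1 \<le> \<bar>\<xi>\<bar> \<Longrightarrow> (norm (fourier_measure \<nu> \<xi>))\<^sup>2 \<le> C * \<bar>\<xi>\<bar> powr (- \<tau>)"
  obtains R where "1 \<le> R" "\<And>y. \<exists>l\<in>\<Lambda>. \<bar>l - y\<bar> < R"
proof -
  interpret finite_measure \<nu> by fact
  note [measurable_cong] = sets
  have sp: "space \<nu> = UNIV" using sets_eq_imp_space_eq[OF sets] by simp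
  have "0 \<le> (norm (fourier_measure \<nu> 1))\<^sup>2" by simp
  also have "\<dots> \<le> C" using decay[of 1] by simp
  finally have C: "0 \<le> C" .
  define q where "q = (2::real) powr (\<beta> - \<tau>)"
  have q: "0 < q" "q < 1" using \<beta> gr_one_powr[of 2 "\<tau> - \<beta>"] powr_minus_divide[of 2 "\<tau> - \<beta>"] by (auto simp: q_def)
  \<comment> \<open>Block k contributes at most \<open>C * (2 ^ k) powr (- \<tau>)\<close> times the
    count \<open>D * (2 ^ Suc k) powr \<beta>\<close>, which is
    \<open>C * D * 2 powr \<beta> * q ^ k\<close>; so \<open>E * q ^ m\<close> bounds the tail from
    block m on.\<close>
  define E where "E = C * D * 2 powr \<beta> / (1 - q)"
  have E: "0 \<le> E" using C D q by (simp add: E_def)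
  have "(\<lambda>m. E * q ^ m) \<longlonglongrightarrow> E * 0" using q by (intro tendsto_mult_left LIMSEQ_power_zero) simp
  then have "\<forall>\<^sub>F m in sequentially. E * q ^ m < A * measure \<nu> UNIV"
    using A nz by (intro order_tendstoD(2)) auto
  \<comment> \<open>m is fixed before y, so a single radius serves all centres.\<close>
  then obtain m where m: "E * q ^ m < A * measure \<nu> UNIV" by (auto simp: eventually_sequentially)
  have "\<exists>l\<in>\<Lambda>. \<bar>l - y\<bar> < 2 ^ m" for y
  proof (rule ccontr)
    assume "\<not> (\<exists>l\<in>\<Lambda>. \<bar>l - y\<bar> < 2 ^ m)"
    then have gap: "2 ^ m \<le> \<bar>l - y\<bar>" if "l \<in> \<Lambda>" for l using that by (auto simp: not_less)
    define f where "f x = iexp (2 * pi * y * x)" for x :: real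
    have nf: "(norm (f x))\<^sup>2 = 1" for x by (simp add: f_def)
    have "f \<in> borel_measurable borel" unfolding f_def[abs_def] by measurable
    then have sq: "square_integrable \<nu> f" unfolding square_integrable_def nf by simp
    have L2: "L2_norm_sq \<nu> f = measure \<nu> UNIV" unfolding L2_norm_sq_def nf by (simp add: sp)
    have fd: "fourier_density \<nu> f l = fourier_measure \<nu> (l - y)" for l
      unfolding fourier_density_def fourier_measure_def
      by (intro Bochner_Integration.integral_cong refl) (simp add: f_def algebra_simps flip: exp_add)
    have "infsum (\<lambda>l. ennreal ((norm (fourier_density \<nu> f l))\<^sup>2)) \<Lambda> \<le> ennreal (E * q ^ m)"
      unfolding infsum_ennreal_eq_SUP
    proof (rule SUP_least)
      fix F assume "F \<in> {F. finite F \<and> F \<subseteq> \<Lambda>}"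
      then have F: "finite F" "F \<subseteq> \<Lambda>" by auto
      have "bounded F" using F(1) by (rule finite_imp_bounded)
      then obtain b where b: "\<And>l. l \<in> F \<Longrightarrow> \<bar>l\<bar> \<le> b" by (auto simp: bounded_iff)
      obtain n :: nat where n: "b + \<bar>y\<bar> < 2 ^ n" using real_arch_pow[of 2 "b + \<bar>y\<bar>"] by auto
      let ?S = "\<lambda>k. {l \<in> F. \<bar>l - y\<bar> \<le> 2 ^ Suc k}"
      \<comment> \<open>Each l is charged to its own dyadic block. The sets \<open>?S k\<close> are
        full balls, which the counting bound handles directly; the additional terms are
        nonnegative.\<close>
      have pt: "(norm (fourier_density \<nu> f l))\<^sup>2 \<le> (\<Sum>k\<in>{m..<m+n}. C * (2 ^ k) powr (- \<tau>) * indicator (?S k) l)" if l: "l \<in> F" for l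
      proof -
        have g: "2 ^ m \<le> \<bar>l - y\<bar>" using gap l F by auto
        have "1 \<le> (2::real) ^ m" by simp
        then have l1: "1 \<le> \<bar>l - y\<bar>" using g by linarith
        have "\<bar>l - y\<bar> < 2 ^ n" using b[OF l] n by linarith
        also have "\<dots> \<le> 2 ^ (m + n)" by simp
        finally have up: "\<bar>l - y\<bar> < 2 ^ (m + n)" .
        define k where "k = (LEAST k. \<bar>l - y\<bar> < 2 ^ Suc k)"
        have ex: "\<bar>l - y\<bar> < 2 ^ Suc (m + n)" using up by simp
        have k1: "\<bar>l - y\<bar> < 2 ^ Suc k" unfolding k_def using ex by (rule LeastI)
        have k2: "2 ^ k \<le> \<bar>l - y\<bar>"
        proof (cases k)
          case 0 then show ?thesis using l1 by simp
        next
          case (Suc j)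
          then have "\<not> \<bar>l - y\<bar> < 2 ^ Suc j" using not_less_Least[of j "\<lambda>k. \<bar>l - y\<bar> < 2 ^ Suc k"] k_def by simp
          then show ?thesis using Suc by simp
        qed
        have "(2::real) ^ m < 2 ^ Suc k" using g k1 by linarith
        then have mk: "m \<le> k" by (simp only: power_strict_increasing_iff one_less_numeral_iff semiring_norm)
        have "(2::real) ^ k < 2 ^ (m + n)" using k2 up by linarith
        then have kn: "k < m + n" by simp
        have "(norm (fourier_density \<nu> f l))\<^sup>2 \<le> C * \<bar>l - y\<bar> powr (- \<tau>)" unfolding fd by (rule decay[OF l1])
        also have "\<dots> \<le> C * (2 ^ k) powr (- \<tau>)" using k2 C \<beta> by (intro mult_left_mono powr_mono2') auto
        also have "\<dots> = C * (2 ^ k) powr (- \<tau>) * indicator (?S k) l" using l k1 by simp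
        also have "\<dots> \<le> (\<Sum>k\<in>{m..<m+n}. C * (2 ^ k) powr (- \<tau>) * indicator (?S k) l)"
          using mk kn C by (intro member_le_sum[where f = "\<lambda>k. C * (2 ^ k) powr (- \<tau>) * indicator (?S k) l"]) auto
        finally show ?thesis .
      qed
      have "(\<Sum>l\<in>F. (norm (fourier_density \<nu> f l))\<^sup>2) \<le> (\<Sum>l\<in>F. \<Sum>k\<in>{m..<m+n}. C * (2 ^ k) powr (- \<tau>) * indicator (?S k) l)"
        by (intro sum_mono pt)
      also have "\<dots> = (\<Sum>k\<in>{m..<m+n}. C * (2 ^ k) powr (- \<tau>) * (\<Sum>l\<in>F. indicator (?S k) l))"
        by (subst sum.swap) (simp add: sum_distrib_left)
      also have "\<dots> \<le> (\<Sum>k\<in>{m..<m+n}. C * D * 2 powr \<beta> * q ^ k)"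
      proof (rule sum_mono)
        fix k
        have "(\<Sum>l\<in>F. indicator (?S k) l) = real (card (?S k))"
          using F(1) by (simp add: sum.If_cases indicator_def Int_def conj_commute)
        also have "\<dots> \<le> D * (2 ^ Suc k) powr \<beta>"
          using F by (intro count[of _ _ y]) (auto simp: one_le_power[of "2::real" "Suc k", simplified])
        finally have c: "(\<Sum>l\<in>F. indicator (?S k) l) \<le> D * (2 ^ Suc k) powr \<beta>" .
        have "C * (2 ^ k) powr (- \<tau>) * (\<Sum>l\<in>F. indicator (?S k) l) \<le> C * (2 ^ k) powr (- \<tau>) * (D * (2 ^ Suc k) powr \<beta>)"
          using c C by (intro mult_left_mono) auto
        also have "\<dots> = C * D * 2 powr \<beta> * ((2 ^ k) powr (- \<tau>) * (2 ^ k) powr \<beta>)"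
          by (simp add: powr_mult mult_ac)
        also have "((2::real) ^ k) powr (- \<tau>) * (2 ^ k) powr \<beta> = q ^ k"
          unfolding q_def by (simp add: powr_realpow[symmetric] powr_powr powr_add[symmetric] algebra_simps)
        finally show "C * (2 ^ k) powr (- \<tau>) * (\<Sum>l\<in>F. indicator (?S k) l) \<le> C * D * 2 powr \<beta> * q ^ k" .
      qed
      also have "\<dots> = C * D * 2 powr \<beta> * (q ^ m * (\<Sum>k<n. q ^ k))"
      proof -
        have "(\<Sum>k\<in>{m..<m+n}. q ^ k) = (\<Sum>k<n. q ^ (m + k))"
          using sum.shift_bounds_nat_ivl[of "\<lambda>k. q ^ k" 0 m n] by (simp add: lessThan_atLeast0 add.commute)
        then show ?thesis by (simp add: sum_distrib_left[symmetric] power_add)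
      qed
      also have "\<dots> \<le> C * D * 2 powr \<beta> * (q ^ m * (1 / (1 - q)))"
      proof -
        have "(\<Sum>k<n. q ^ k) \<le> (\<Sum>k. q ^ k)" using q by (intro sum_le_suminf summable_geometric) auto
        also have "\<dots> = 1 / (1 - q)" using q by (intro suminf_geometric) auto
        finally show ?thesis using C D q by (intro mult_left_mono) auto
      qed
      also have "\<dots> = E * q ^ m" by (simp add: E_def)
      finally show "(\<Sum>l\<in>F. ennreal ((norm (fourier_density \<nu> f l))\<^sup>2)) \<le> ennreal (E * q ^ m)"
        by (simp add: ennreal_leI)
    qed
    with lower[OF sq] have "ennreal (A * measure \<nu> UNIV) \<le> ennreal (E * q ^ m)" unfolding L2 by (rule order_trans)
    then show False using m E q by (simp add: ennreal_le_iff)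
  qed
  then show ?thesis using that[of "2 ^ m"] by simp
qed

text \<open>Relative density puts at least n distinct frequencies into an interval of length
  proportional to n, whereas the Bessel bound allows only a multiple of
  \<open>n powr \<beta>\<close> with \<beta> < 1.\<close>

lemma not_admits_fourier_frame:
  fixes \<nu> :: "real measure"
  assumes fin: "finite_measure \<nu>" and sets: "sets \<nu> = sets borel"
    and c0: "0 < c0" and mass: "\<And>r. 0 < r \<Longrightarrow> r \<le> 1 \<Longrightarrow> c0 * r powr \<beta> \<le> measure \<nu> {-r..r}"
    and \<beta>: "0 < \<beta>" "\<beta> < \<tau>" "\<beta> < 1"
    and decay: "\<And>\<xi>. 1 \<le> \<bar>\<xi>\<bar> \<Longrightarrow> (norm (fourier_measure \<nu> \<xi>))\<^sup>2 \<le> C * \<bar>\<xi>\<bar> powr (- \<tau>)"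
  shows "\<not> admits_fourier_frame \<nu>"
proof
  assume "admits_fourier_frame \<nu>"
  then obtain \<Lambda> A B where AB: "0 < A" "A \<le> B"
    and lower: "\<And>f. square_integrable \<nu> f \<Longrightarrow>
        ennreal (A * L2_norm_sq \<nu> f) \<le> infsum (\<lambda>l. ennreal ((norm (fourier_density \<nu> f l))\<^sup>2)) \<Lambda>"
    and upper: "\<And>f. square_integrable \<nu> f \<Longrightarrow>
        infsum (\<lambda>l. ennreal ((norm (fourier_density \<nu> f l))\<^sup>2)) \<Lambda> \<le> ennreal (B * L2_norm_sq \<nu> f)"
    unfolding admits_fourier_frame_def frame_spectrum_def by blast
  interpret finite_measure \<nu> by fact
  have "0 < measure \<nu> {-1..1}" using mass[of 1] c0 by simp
  also have "\<dots> \<le> measure \<nu> UNIV" by (intro finite_measure_mono) (auto simp: sets)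
  finally have nz: "0 < measure \<nu> UNIV" .
  define D where "D = 4 * B * 16 powr \<beta> / c0"
  have D: "0 \<le> D" using AB c0 by (simp add: D_def)
  have B: "0 \<le> B" using AB by simp
  have count: "real (card F) \<le> D * R powr \<beta>" if "finite F" "F \<subseteq> \<Lambda>" "1 \<le> R" "\<And>l. l \<in> F \<Longrightarrow> \<bar>l - y\<bar> \<le> R" for F R y
    unfolding D_def by (rule card_spectrum_le[OF fin sets B upper c0 mass that(3) that(1,2,4)])
  obtain R where R: "1 \<le> R" and dense: "\<And>y. \<exists>l\<in>\<Lambda>. \<bar>l - y\<bar> < R"
    by (rule spectrum_relatively_dense[OF fin sets AB(1) nz lower D count \<beta>(1,2) decay]) (assumption | rule that)+
  obtain l where l: "\<And>y. l y \<in> \<Lambda>" "\<And>y. \<bar>l y - y\<bar> < R" using dense by metis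
  have grow: "real n \<le> (D * (4 * R) powr \<beta>) * real n powr \<beta>" if n: "1 \<le> n" for n
  proof -
    \<comment> \<open>Centres 2 R apart with deviations strictly below R give distinct
      frequencies.\<close>
    let ?p = "\<lambda>j. l (2 * R * real j)"
    have inj: "inj_on ?p {1..n}"
    proof (rule linorder_inj_onI)
      fix i j assume ij: "i < j" "i \<in> {1..n}" "j \<in> {1..n}"
      then have "real i + 1 \<le> real j" by simp
      then have "2 * R * (real i + 1) \<le> 2 * R * real j" using R by (intro mult_left_mono) auto
      then show "?p i \<noteq> ?p j" using l(2)[of "2 * R * real i"] l(2)[of "2 * R * real j"] by (auto simp: distrib_left)
    qed auto
    have "real (card (?p ` {1..n})) \<le> D * (4 * R * real n) powr \<beta>"
    proof (rule count[of _ _ 0])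
      show "1 \<le> 4 * R * real n" using R n mult_mono[of 1 "4 * R" 1 "real n"] by simp
      fix a assume "a \<in> ?p ` {1..n}"
      then obtain j where j: "j \<in> {1..n}" "a = ?p j" by auto
      have "\<bar>2 * R * real j\<bar> \<le> 2 * R * real n" using j R by simp
      moreover have "R * 1 \<le> R * real n" using R n by (intro mult_left_mono) auto
      ultimately show "\<bar>a - 0\<bar> \<le> 4 * R * real n" using l(2)[of "2 * R * real j"] j R by linarith
    qed (use l in auto)
    then show ?thesis using inj R by (simp add: card_image powr_mult)
  qed
  define H where "H = D * (4 * R) powr \<beta>"
  \<comment> \<open>For such n, \<open>n powr (1 - \<beta>)\<close> is at least
    \<open>\<bar>H\<bar> + 1\<close>, while the growth estimate bounds it by H.\<close>
  obtain n :: nat where n: "(\<bar>H\<bar> + 1) powr (1 / (1 - \<beta>)) < real n" using reals_Archimedean2 by blast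
  have n1: "1 \<le> n" using n powr_ge_zero[of "\<bar>H\<bar> + 1" "1 / (1 - \<beta>)"] by (cases n) auto
  have "real n powr (1 - \<beta>) * real n powr \<beta> = real n" using n1 by (simp flip: powr_add)
  also have "\<dots> \<le> H * real n powr \<beta>" using grow[OF n1] by (simp add: H_def)
  finally have "real n powr (1 - \<beta>) \<le> H" using n1 by simp
  moreover have "((\<bar>H\<bar> + 1) powr (1 / (1 - \<beta>))) powr (1 - \<beta>) \<le> real n powr (1 - \<beta>)"
    using n \<beta> by (intro powr_mono2) auto
  then have "\<bar>H\<bar> + 1 \<le> real n powr (1 - \<beta>)" using \<beta> by (simp add: powr_powr)
  ultimately show False by linarith
qed

section \<open>The push-forward\<close>

text \<open>This is deterministic: probability enters only through the hypotheses on the path, which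
  hold almost surely for Brownian motion.\<close>

lemma (in nonuniform_measure) salem_and_no_frame:
  assumes w: "continuous_on {0..} w" and w0: "w 0 = 0"
    and dim: "hausdorff_dim (measure_support \<mu>) = ennreal s"
    and decay: "\<And>\<sigma>. 0 < \<sigma> \<Longrightarrow> \<sigma> < s \<Longrightarrow> \<exists>C. \<forall>\<xi>. 1 \<le> \<bar>\<xi>\<bar> \<longrightarrow>
           norm (fourier_measure (path_pushforward \<mu> w) \<xi>) \<le> C * \<bar>\<xi>\<bar> powr (- \<sigma>)"
    and holder: "\<And>\<alpha>. 0 < \<alpha> \<Longrightarrow> \<alpha> < 1/2 \<Longrightarrow>
           \<exists>D\<ge>0. \<forall>x\<in>{0..1}. \<forall>y\<in>{0..1}. \<bar>w x - w y\<bar> \<le> D * \<bar>x - y\<bar> powr \<alpha>"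
  shows "dim_salem_measure (2 * s) (path_pushforward \<mu> w)" "\<not> admits_fourier_frame (path_pushforward \<mu> w)"
proof -
  let ?\<nu> = "path_pushforward \<mu> w"
  have fin: "finite_measure ?\<nu>" by (rule finite_measure_path_pushforward[OF finite_measure_axioms w sets_eq])
  interpret \<nu>: finite_measure ?\<nu> by fact
  note supp = measure_support_path_pushforward[OF sets_eq w support_subset]
  have mass: "measure ?\<nu> B = measure \<mu> ({0..} \<inter> w -` B)" if "B \<in> sets borel" for B
    using emeasure_path_pushforward[OF w sets_eq that] by (simp add: measure_def)
  have preimage: "{0..} \<inter> w -` B \<in> sets \<mu>" if "B \<in> sets borel" for B
    using measurable_sets[OF measurable_path[OF w sets_eq] that]
    by (simp add: sets_restrict_space_iff space_restrict_space Int_commute)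
  have decay_sq: "\<exists>C. \<forall>\<xi>. 1 \<le> \<bar>\<xi>\<bar> \<longrightarrow> (norm (fourier_measure ?\<nu> \<xi>))\<^sup>2 \<le> C * \<bar>\<xi>\<bar> powr (- \<tau>)"
    if \<tau>: "0 < \<tau>" "\<tau> < 2 * s" for \<tau>
  proof -
    obtain C where C: "\<And>\<xi>. 1 \<le> \<bar>\<xi>\<bar> \<Longrightarrow> norm (fourier_measure ?\<nu> \<xi>) \<le> C * \<bar>\<xi>\<bar> powr (- (\<tau> / 2))"
      using decay[of "\<tau> / 2"] \<tau> by auto
    have "(norm (fourier_measure ?\<nu> \<xi>))\<^sup>2 \<le> C\<^sup>2 * \<bar>\<xi>\<bar> powr (- \<tau>)" if "1 \<le> \<bar>\<xi>\<bar>" for \<xi>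
    proof -
      have "(norm (fourier_measure ?\<nu> \<xi>))\<^sup>2 \<le> (C * \<bar>\<xi>\<bar> powr (- (\<tau> / 2)))\<^sup>2"
        by (intro power_mono C that) simp
      also have "\<dots> = C\<^sup>2 * \<bar>\<xi>\<bar> powr (- \<tau>)"
        by (simp add: power_mult_distrib power2_eq_square flip: powr_add)
      finally show ?thesis .
    qed
    then show ?thesis by blast
  qed
  have nz: "emeasure ?\<nu> (space ?\<nu>) \<noteq> 0"
  proof -
    have "0 < measure \<mu> {0..1}" using mass_at_0[of 1] cK by simp
    also have "\<dots> \<le> measure \<mu> ({0..} \<inter> w -` UNIV)" by (intro finite_measure_mono) auto
    also have "\<dots> = measure ?\<nu> UNIV" by (rule mass[symmetric]) simp
    finally show ?thesis by (simp add: \<nu>.emeasure_eq_measure)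
  qed
  have upper: "hausdorff_dim (measure_support ?\<nu>) \<le> ennreal x" if x: "2 * s < x" for x
  proof -
    \<comment> \<open>The midpoint of s and x / 2: being above s it serves the covering estimate,
      and being below x / 2 it makes \<alpha> = r / x an admissible Hoelder exponent, with r /
      \<alpha> = x.\<close>
    define r where "r = (s + x / 2) / 2"
    have r: "s < r" "2 * r < x" using x by (auto simp: r_def)
    define \<alpha> where "\<alpha> = r / x"
    have \<alpha>: "0 < \<alpha>" "\<alpha> < 1/2" using r s x by (auto simp: \<alpha>_def field_simps)
    obtain D where D: "0 \<le> D" "\<And>x y. x \<in> {0..1} \<Longrightarrow> y \<in> {0..1} \<Longrightarrow> \<bar>w x - w y\<bar> \<le> D * \<bar>x - y\<bar> powr \<alpha>"
      using holder[OF \<alpha>] by auto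
    have "hausdorff_dim (w ` measure_support \<mu>) \<le> ennreal (r / \<alpha>)"
      using D(2) support_subset s r
      by (intro hausdorff_dim_holder_image_le[OF _ D(1) \<alpha>(1) dim]) (auto simp: dist_real_def subset_iff)
    also have "r / \<alpha> = x" using r s by (simp add: \<alpha>_def)
    finally show ?thesis unfolding supp(1) .
  qed
  have lower: "ennreal t \<le> hausdorff_dim (measure_support ?\<nu>)" if t: "0 < t" "t < 2 * s" for t
  proof -
    \<comment> \<open>\<tau> leaves room above t and is a decay exponent below 2 s \<le> 1, as the
      Gaussian average requires.\<close>
    define \<tau> where "\<tau> = (t + 2 * s) / 2"
    have \<tau>: "t < \<tau>" "\<tau> < 2 * s" using t by (auto simp: \<tau>_def)
    obtain C where "\<And>\<xi>. 1 \<le> \<bar>\<xi>\<bar> \<Longrightarrow> (norm (fourier_measure ?\<nu> \<xi>))\<^sup>2 \<le> C * \<bar>\<xi>\<bar> powr (- \<tau>)"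
      using decay_sq[of \<tau>] \<tau> t by auto
    then show ?thesis
      using \<tau> t s by (intro hausdorff_dim_support_ge_of_decay[OF fin _ nz, where \<tau> = \<tau> and C = C]) auto
  qed
  have dim\<nu>: "hausdorff_dim (measure_support ?\<nu>) = ennreal (2 * s)"
  proof (rule antisym)
    show "hausdorff_dim (measure_support ?\<nu>) \<le> ennreal (2 * s)"
    proof (rule ennreal_le_epsilon)
      fix e :: real assume "0 < e"
      then show "hausdorff_dim (measure_support ?\<nu>) \<le> ennreal (2 * s) + ennreal e"
        using upper[of "2 * s + e"] s by simp
    qed
    show "ennreal (2 * s) \<le> hausdorff_dim (measure_support ?\<nu>)"
    proof (rule dense_le)
      fix y assume y: "y < ennreal (2 * s)"
      then obtain t where t: "y = ennreal t" "0 \<le> t" by (cases y) auto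
      then have "t < 2 * s" using y by (simp add: ennreal_less_iff)
      then show "y \<le> hausdorff_dim (measure_support ?\<nu>)" using lower[of t] t by (cases "t = 0") auto
    qed
  qed
  show "dim_salem_measure (2 * s) ?\<nu>"
    unfolding dim_salem_measure_def salem_measure_def
  proof (intro conjI allI impI dim\<nu> fin nz)
    show "compact (measure_support ?\<nu>)" unfolding supp(1) by (rule supp(2))
    fix \<epsilon> :: real assume \<epsilon>: "0 < \<epsilon>"
    \<comment> \<open>The maximum with s / 2 keeps \<sigma> positive when \<epsilon> is
      large.\<close>
    define \<sigma> where "\<sigma> = max (s - \<epsilon>) (s / 2)"
    have \<sigma>: "0 < \<sigma>" "\<sigma> < s" "s - \<epsilon> \<le> \<sigma>" using s \<epsilon> by (auto simp: \<sigma>_def)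
    obtain C where C: "\<And>\<xi>. 1 \<le> \<bar>\<xi>\<bar> \<Longrightarrow> norm (fourier_measure ?\<nu> \<xi>) \<le> C * \<bar>\<xi>\<bar> powr (- \<sigma>)"
      using decay[OF \<sigma>(1,2)] by auto
    have "0 \<le> norm (fourier_measure ?\<nu> 1)" by simp
    also have "\<dots> \<le> C" using C[of 1] by simp
    finally have C0: "0 \<le> C" .
    have "norm (fourier_measure ?\<nu> \<xi>) \<le> C * \<bar>\<xi>\<bar> powr (- (2 * s) / 2 + \<epsilon>)" if \<xi>: "1 \<le> \<bar>\<xi>\<bar>" for \<xi>
    proof -
      have "norm (fourier_measure ?\<nu> \<xi>) \<le> C * \<bar>\<xi>\<bar> powr (- \<sigma>)" by (rule C[OF \<xi>])
      also have "\<dots> \<le> C * \<bar>\<xi>\<bar> powr (- (2 * s) / 2 + \<epsilon>)"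
        using \<xi> \<sigma> C0 by (intro mult_left_mono powr_mono) auto
      finally show ?thesis .
    qed
    then show "\<exists>C. \<forall>\<xi>. 1 \<le> \<bar>\<xi>\<bar> \<longrightarrow>
        norm (fourier_measure ?\<nu> \<xi>) \<le> C * \<bar>\<xi>\<bar> powr (- enn2real (hausdorff_dim (measure_support ?\<nu>)) / 2 + \<epsilon>)"
      unfolding dim\<nu> using s by auto
  qed simp
  obtain D where D: "0 \<le> D" "\<And>x y. x \<in> {0..1} \<Longrightarrow> y \<in> {0..1} \<Longrightarrow> \<bar>w x - w y\<bar> \<le> D * \<bar>x - y\<bar> powr (1/3)"
    using holder[of "1/3"] by auto
  \<comment> \<open>7 s / 4 is the midpoint between the mass exponent 3 s / 2 and the limit 2 s of
    the decay exponents.\<close>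
  obtain C where C: "\<And>\<xi>. 1 \<le> \<bar>\<xi>\<bar> \<Longrightarrow> (norm (fourier_measure ?\<nu> \<xi>))\<^sup>2 \<le> C * \<bar>\<xi>\<bar> powr (- (7 * s / 4))"
    using decay_sq[of "7 * s / 4"] s by auto
  show "\<not> admits_fourier_frame ?\<nu>"
  proof (rule not_admits_fourier_frame[OF fin _ _ _ _ _ _ C])
    show "0 < c / (D + 1) powr (3 * s / 2)" using cK D by simp
    fix r :: real assume r: "0 < r" "r \<le> 1"
    \<comment> \<open>By then the path has moved by at most
      \<open>D * \<rho> powr (1/3) \<le> r\<close>, and the mass bound s / 2 at \<rho> becomes the
      exponent 3 s / 2 in r. The summand 1 gives \<rho> \<le> 1 and avoids dividing by 0.\<close>
    define \<rho> where "\<rho> = (r / (D + 1)) powr 3"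
    have q: "0 < r / (D + 1)" "r / (D + 1) \<le> 1" using r D by (auto simp: divide_le_eq_1)
    have "(r / (D + 1)) powr 3 \<le> 1 powr 3" using q by (intro powr_mono2) auto
    then have \<rho>: "0 < \<rho>" "\<rho> \<le> 1" using q unfolding \<rho>_def by (simp_all only: powr_one_eq_one powr_gt_zero)
    have "c / (D + 1) powr (3 * s / 2) * r powr (3 * s / 2) = c * (r / (D + 1)) powr (3 * s / 2)"
      using r D by (simp add: powr_divide)
    also have "\<dots> = c * \<rho> powr (s / 2)" by (simp add: \<rho>_def powr_powr)
    also have "\<dots> \<le> measure \<mu> {0..\<rho>}" using mass_at_0[OF \<rho>] by simp
    also have "\<dots> \<le> measure \<mu> ({0..} \<inter> w -` {-r..r})"
    proof (intro finite_measure_mono preimage)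
      show "{0..\<rho>} \<subseteq> {0..} \<inter> w -` {-r..r}"
      proof
        fix x assume x: "x \<in> {0..\<rho>}"
        have "\<bar>w x\<bar> \<le> D * x powr (1/3)" using D(2)[of x 0] x \<rho> w0 by auto
        also have "\<dots> \<le> D * \<rho> powr (1/3)" using x D(1) by (intro mult_left_mono powr_mono2) auto
        also have "\<dots> = D * (r / (D + 1))" using r D(1) unfolding \<rho>_def powr_powr by simp
        also have "\<dots> \<le> r" using D(1) r by (simp add: field_simps)
        finally show "x \<in> {0..} \<inter> w -` {-r..r}" using x by auto
      qed
    qed simp
    also have "\<dots> = measure ?\<nu> {-r..r}" by (rule mass[symmetric]) simp
    finally show "c / (D + 1) powr (3 * s / 2) * r powr (3 * s / 2) \<le> measure ?\<nu> {-r..r}" .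
  qed (use s in auto)
qed

lemma exists_seq_between:
  fixes a b :: real
  assumes "0 < b" "a < b"
  shows "\<exists>n. a < b * (real (Suc n) / real (Suc (Suc n)))"
proof -
  have "(\<lambda>n. b * (real (Suc n) / real (Suc (Suc n)))) \<longlonglongrightarrow> b * 1"
    by (intro tendsto_mult_left LIMSEQ_Suc[OF LIMSEQ_n_over_Suc_n])
  then have "\<forall>\<^sub>F n in sequentially. a < b * (real (Suc n) / real (Suc (Suc n)))"
    using assms by (intro order_tendstoD(1)) auto
  then show ?thesis by (auto simp: eventually_sequentially)
qed

theorem mainTheorem5:
  fixes s c K :: real and \<mu> :: "real measure"
    and M :: "'w measure" and W :: "real \<Rightarrow> 'w \<Rightarrow> real"
  assumes s: "0 < s" "s \<le> 1/2"
    and borel: "sets \<mu> = sets borel"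
    and finite: "finite_measure \<mu>"
    and on_unit_interval: "emeasure \<mu> (- {0..1}) = 0"
    and dim: "hausdorff_dim (measure_support \<mu>) = ennreal s"
    and cK: "0 < c" "c \<le> K"
    and mass_at_0: "\<And>r. 0 < r \<Longrightarrow> r \<le> 1 \<Longrightarrow>
          c * r powr (s/2) \<le> measure \<mu> {0..r} \<and> measure \<mu> {0..r} \<le> K * r powr (s/2)"
    and mass_away_from_0: "\<And>x r. x \<in> measure_support \<mu> - {0} \<Longrightarrow> 0 < r \<Longrightarrow>
          measure \<mu> {x..x + r} \<le> K * min 1 (x powr (- s/2) * r powr s)"
    and bm: "brownian_motion M W"
  shows "AE \<omega> in M.
           dim_salem_measure (2 * s) (path_pushforward \<mu> (\<lambda>t. W t \<omega>)) \<and>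
           \<not> admits_fourier_frame (path_pushforward \<mu> (\<lambda>t. W t \<omega>))"
proof -
  have N: "nonuniform_measure \<mu> s c K"
    unfolding nonuniform_measure_def nonuniform_measure_axioms_def using assms by blast
  interpret N: nonuniform_measure \<mu> s c K by (rule N)
  interpret brownian_motion M W by (rule bm)
  \<comment> \<open>Decay and Hoelder continuity are needed for all exponents on one null set.
    Countably many exponents increasing to s and to 1/2 suffice, since each larger exponent implies
    the smaller ones.\<close>
  define q where "q n = real (Suc n) / real (Suc (Suc n))" for n
  have q: "0 < q n" "q n < 1" for n by (auto simp: q_def)
  have decay: "AE \<omega> in M. \<forall>n. \<exists>C. \<forall>\<xi>. 1 \<le> \<bar>\<xi>\<bar> \<longrightarrow>
      norm (fourier_measure (path_pushforward \<mu> (\<lambda>t. W t \<omega>)) \<xi>) \<le> C * \<bar>\<xi>\<bar> powr (- (s * q n))"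
    unfolding AE_all_countable using q s by (intro allI fourier_decay_AE[OF N]) auto
  have holder: "AE \<omega> in M. \<forall>n. \<exists>D\<ge>0. \<forall>x\<in>{0..1}. \<forall>y\<in>{0..1}. \<bar>W x \<omega> - W y \<omega>\<bar> \<le> D * \<bar>x - y\<bar> powr (1/2 * q n)"
    unfolding AE_all_countable
  proof
    fix n
    show "AE \<omega> in M. \<exists>D\<ge>0. \<forall>x\<in>{0..1}. \<forall>y\<in>{0..1}. \<bar>W x \<omega> - W y \<omega>\<bar> \<le> D * \<bar>x - y\<bar> powr (1/2 * q n)"
      using q[of n] by (intro holder_AE) auto
  qed
  show ?thesis
    using decay holder continuous_paths start_at_0
  proof eventually_elim
    case (elim \<omega>)
    let ?w = "\<lambda>t. W t \<omega>"
    have dec: "\<exists>C. \<forall>\<xi>. 1 \<le> \<bar>\<xi>\<bar> \<longrightarrow> norm (fourier_measure (path_pushforward \<mu> ?w) \<xi>) \<le> C * \<bar>\<xi>\<bar> powr (- \<sigma>)"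
      if \<sigma>: "0 < \<sigma>" "\<sigma> < s" for \<sigma>
    proof -
      obtain n where n: "\<sigma> < s * q n" using exists_seq_between[OF s(1) \<sigma>(2)] by (auto simp: q_def)
      obtain C where C: "\<And>\<xi>. 1 \<le> \<bar>\<xi>\<bar> \<Longrightarrow> norm (fourier_measure (path_pushforward \<mu> ?w) \<xi>) \<le> C * \<bar>\<xi>\<bar> powr (- (s * q n))"
        using elim(1) by blast
      have "0 \<le> norm (fourier_measure (path_pushforward \<mu> ?w) 1)" by simp
      also have "\<dots> \<le> C" using C[of 1] by simp
      finally have "0 \<le> C" .
      then have "C * \<bar>\<xi>\<bar> powr (- (s * q n)) \<le> C * \<bar>\<xi>\<bar> powr (- \<sigma>)" if "1 \<le> \<bar>\<xi>\<bar>" for \<xi>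
        using n that by (intro mult_left_mono powr_mono) auto
      then show ?thesis using C by (meson order_trans)
    qed
    have hol: "\<exists>D\<ge>0. \<forall>x\<in>{0..1}. \<forall>y\<in>{0..1}. \<bar>?w x - ?w y\<bar> \<le> D * \<bar>x - y\<bar> powr \<alpha>"
      if \<alpha>: "0 < \<alpha>" "\<alpha> < 1/2" for \<alpha>
    proof -
      obtain n where n: "\<alpha> < 1/2 * q n" using exists_seq_between[of "1/2" \<alpha>] \<alpha> by (auto simp: q_def)
      obtain D where D: "0 \<le> D" "\<And>x y. x \<in> {0..1} \<Longrightarrow> y \<in> {0..1} \<Longrightarrow> \<bar>?w x - ?w y\<bar> \<le> D * \<bar>x - y\<bar> powr (1/2 * q n)"
        using elim(2) by blast
      have "\<bar>?w x - ?w y\<bar> \<le> D * \<bar>x - y\<bar> powr \<alpha>" if "x \<in> {0..1}" "y \<in> {0..1}" for x y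
      proof -
        have "\<bar>x - y\<bar> powr (1/2 * q n) \<le> \<bar>x - y\<bar> powr \<alpha>"
          using that n by (intro powr_mono') auto
        then show ?thesis using D(2)[OF that] D(1) by (meson mult_left_mono order_trans)
      qed
      then show ?thesis using D(1) by blast
    qed
    show ?case using N.salem_and_no_frame[OF elim(3,4) dim dec hol] by blast
  qed
qed

end
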